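(* Let $F:L\looparrowright\mathbb{C}^{m}$ be a Lagrangian translating soliton with $H+T^{\perp}=0$, where $T\in\mathbb{C}^{m}$, $|T|=1$. Let $f(z)=2\langle z,T\rangle$, and let $u$ be a function on $L$ satisfying $\int_{L}u^{2}e^{-\frac12F^*f}dV_{g}<\infty$ and $\Delta_{f}u=0$. Then $u\equiv0$.
   Context: $\mathbb{C}^{m}$ carries its standard complex structure, Kähler form and Euclidean metric $\langle\cdot,\cdot\rangle$ (real inner product). Submanifolds are immersed, oriented, connected; $F:L\looparrowright\mathbb{C}^m$ with $\dim_{\mathbb{R}} L=m$ is Lagrangian if the Kähler form pulls back to $0$. $H$ is the mean curvature vector, $\perp$ is projection to the normal bundle, and $g$ is the induced metric on $L$. On functions, $\Delta_{f}u=\Delta u-\frac12\langle\nabla (F^*f),\nabla u\rangle$, where $\Delta=\mathrm{div}\,\nabla$ is the Laplace–Beltrami operator of $g$ (the Witten Laplacian, up to sign).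
   Formalization: The induced metric on L is assumed complete; without this the claim fails, e.g. for m=1, L a bounded open segment parallel to T and u=1. The function u is taken to be of class C². *)

theory Defs
  imports "HOL-Analysis.Analysis"
begin

text \<open>
  An abstract \<open>m\<close>-manifold is a second countable Hausdorff type \<open>'a\<close> with an oriented smooth
  atlas modelled on \<open>real ^ 'm\<close>.  A chart is a pair of an open domain and a coordinate map
  (whose values outside the domain are irrelevant).
\<close>

section \<open>Functions of class C\<open>\<^sup>k\<close> on open sets\<close>

primrec C_k_on :: "nat \<Rightarrow> ('e::real_normed_vector \<Rightarrow> 'b::real_normed_vector) \<Rightarrow> 'e set \<Rightarrow> bool" where
  "C_k_on 0 f S \<longleftrightarrow> continuous_on S f"
| "C_k_on (Suc k) f S \<longleftrightarrow>
     (\<forall>x\<in>S. f differentiable (at x)) \<and> (\<forall>v. C_k_on k (\<lambda>x. frechet_derivative f (at x) v) S)"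

definition smooth_on :: "('e::real_normed_vector \<Rightarrow> 'b::real_normed_vector) \<Rightarrow> 'e set \<Rightarrow> bool" where
  "smooth_on f S \<longleftrightarrow> (\<forall>k. C_k_on k f S)"


section \<open>Oriented smooth manifolds\<close>

type_synonym ('a, 'm) chart = "'a set \<times> ('a \<Rightarrow> real ^ 'm)"

definition chart_image :: "('a, 'm::finite) chart \<Rightarrow> (real ^ 'm) set" where
  "chart_image c = snd c ` fst c"

definition chart_inv :: "('a, 'm::finite) chart \<Rightarrow> real ^ 'm \<Rightarrow> 'a" where
  "chart_inv c = inv_into (fst c) (snd c)"

definition is_chart :: "('a::topological_space, 'm::finite) chart \<Rightarrow> bool" where
  "is_chart c \<longleftrightarrow> open (fst c) \<and> open (chart_image c) \<and>
     homeomorphism (fst c) (chart_image c) (snd c) (chart_inv c)"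

definition oriented_smooth_atlas :: "('a::topological_space, 'm::finite) chart set \<Rightarrow> bool" where
  "oriented_smooth_atlas A \<longleftrightarrow>
     (\<forall>c\<in>A. is_chart c) \<and> (\<Union>c\<in>A. fst c) = UNIV \<and>
     (\<forall>c\<in>A. \<forall>d\<in>A.
        smooth_on (snd d \<circ> chart_inv c) (snd c ` (fst c \<inter> fst d)) \<and>
        (\<forall>p \<in> snd c ` (fst c \<inter> fst d). 0 < det (jacobian (snd d \<circ> chart_inv c) (at p))))"

definition in_chart :: "('a \<Rightarrow> 'b) \<Rightarrow> ('a, 'm::finite) chart \<Rightarrow> real ^ 'm \<Rightarrow> 'b" where
  "in_chart h c = h \<circ> chart_inv c"

definition C_k_function ::
  "nat \<Rightarrow> ('a, 'm::finite) chart set \<Rightarrow> ('a \<Rightarrow> 'b::real_normed_vector) \<Rightarrow> bool" where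
  "C_k_function k A h \<longleftrightarrow> (\<forall>c\<in>A. C_k_on k (in_chart h c) (chart_image c))"

definition smooth_function ::
  "('a, 'm::finite) chart set \<Rightarrow> ('a \<Rightarrow> 'b::real_normed_vector) \<Rightarrow> bool" where
  "smooth_function A h \<longleftrightarrow> (\<forall>c\<in>A. smooth_on (in_chart h c) (chart_image c))"

definition smooth_immersion ::
  "('a, 'm::finite) chart set \<Rightarrow> ('a \<Rightarrow> 'e::real_normed_vector) \<Rightarrow> bool" where
  "smooth_immersion A F \<longleftrightarrow> smooth_function A F \<and>
     (\<forall>c\<in>A. \<forall>p\<in>chart_image c. inj (frechet_derivative (in_chart F c) (at p)))"


section \<open>Local Riemannian geometry of a parametrized submanifold\<close>

text \<open>
  Throughout this section \<open>\<phi> :: real ^ 'm \<Rightarrow> 'e\<close> is an immersion of an open coordinate domain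
  (to be used with \<open>\<phi> = in_chart F c\<close>); tangent vectors of the domain are given by
  their coordinates.
\<close>

definition partial_deriv ::
  "'m \<Rightarrow> (real ^ 'm \<Rightarrow> 'b::real_normed_vector) \<Rightarrow> real ^ 'm::finite \<Rightarrow> 'b" where
  "partial_deriv i h p = frechet_derivative h (at p) (axis i 1)"

definition induced_metric ::
  "(real ^ 'm \<Rightarrow> 'e::euclidean_space) \<Rightarrow> real ^ 'm::finite \<Rightarrow> real ^ 'm ^ 'm" where
  "induced_metric \<phi> p = (\<chi> i j. partial_deriv i \<phi> p \<bullet> partial_deriv j \<phi> p)"

definition tangent_space ::
  "(real ^ 'm \<Rightarrow> 'e::euclidean_space) \<Rightarrow> real ^ 'm::finite \<Rightarrow> 'e set" where
  "tangent_space \<phi> p = range (frechet_derivative \<phi> (at p))"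

definition normal_part :: "'e::euclidean_space set \<Rightarrow> 'e \<Rightarrow> 'e" where
  "normal_part W v = (THE n. n \<in> W\<^sup>\<bottom> \<and> v - n \<in> W)"

definition second_fundamental_form ::
  "(real ^ 'm \<Rightarrow> 'e::euclidean_space) \<Rightarrow> real ^ 'm::finite \<Rightarrow> 'm \<Rightarrow> 'm \<Rightarrow> 'e" where
  "second_fundamental_form \<phi> p i j =
     normal_part (tangent_space \<phi> p) (partial_deriv i (partial_deriv j \<phi>) p)"

text \<open>The mean curvature vector is the trace (not the average) of the second fundamental form.\<close>

definition mean_curvature ::
  "(real ^ 'm \<Rightarrow> 'e::euclidean_space) \<Rightarrow> real ^ 'm::finite \<Rightarrow> 'e" where
  "mean_curvature \<phi> p =
     (\<Sum>i\<in>UNIV. \<Sum>j\<in>UNIV.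
        (matrix_inv (induced_metric \<phi> p) $ i $ j) *\<^sub>R second_fundamental_form \<phi> p i j)"

definition grad ::
  "(real ^ 'm \<Rightarrow> 'e::euclidean_space) \<Rightarrow> (real ^ 'm \<Rightarrow> real) \<Rightarrow> real ^ 'm::finite \<Rightarrow> real ^ 'm" where
  "grad \<phi> v p = matrix_inv (induced_metric \<phi> p) *v (\<chi> j. partial_deriv j v p)"

definition divergence ::
  "(real ^ 'm \<Rightarrow> 'e::euclidean_space) \<Rightarrow> (real ^ 'm \<Rightarrow> real ^ 'm) \<Rightarrow> real ^ 'm::finite \<Rightarrow> real" where
  "divergence \<phi> X p =
     (\<Sum>i\<in>UNIV. partial_deriv i (\<lambda>q. sqrt (det (induced_metric \<phi> q)) * X q $ i) p)
       / sqrt (det (induced_metric \<phi> p))"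

definition laplace_beltrami ::
  "(real ^ 'm \<Rightarrow> 'e::euclidean_space) \<Rightarrow> (real ^ 'm \<Rightarrow> real) \<Rightarrow> real ^ 'm::finite \<Rightarrow> real" where
  "laplace_beltrami \<phi> v = divergence \<phi> (grad \<phi> v)"

definition metric_inner ::
  "(real ^ 'm \<Rightarrow> 'e::euclidean_space) \<Rightarrow> real ^ 'm::finite \<Rightarrow> real ^ 'm \<Rightarrow> real ^ 'm \<Rightarrow> real" where
  "metric_inner \<phi> p X Y = X \<bullet> (induced_metric \<phi> p *v Y)"

definition drift_laplacian ::
  "(real ^ 'm \<Rightarrow> 'e::euclidean_space) \<Rightarrow> ('e \<Rightarrow> real) \<Rightarrow> (real ^ 'm \<Rightarrow> real) \<Rightarrow> real ^ 'm::finite \<Rightarrow> real" where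
  "drift_laplacian \<phi> f v p =
     laplace_beltrami \<phi> v p - 1/2 * metric_inner \<phi> p (grad \<phi> (f \<circ> \<phi>) p) (grad \<phi> v p)"


section \<open>Global notions\<close>

definition kaehler_form :: "complex ^ 'm::finite \<Rightarrow> complex ^ 'm \<Rightarrow> real" where
  "kaehler_form v w = (\<i> *s v) \<bullet> w"

text \<open>The dimension condition is built in: the charts take values in \<open>real ^ 'm\<close>.\<close>

definition lagrangian_immersion ::
  "('a, 'm::finite) chart set \<Rightarrow> ('a \<Rightarrow> complex ^ 'm) \<Rightarrow> bool" where
  "lagrangian_immersion A F \<longleftrightarrow> smooth_immersion A F \<and>
     (\<forall>c\<in>A. \<forall>p\<in>chart_image c. \<forall>v w.
        kaehler_form (frechet_derivative (in_chart F c) (at p) v)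
                     (frechet_derivative (in_chart F c) (at p) w) = 0)"

definition translating_soliton ::
  "('a, 'm::finite) chart set \<Rightarrow> ('a \<Rightarrow> 'e::euclidean_space) \<Rightarrow> 'e \<Rightarrow> bool" where
  "translating_soliton A F T \<longleftrightarrow>
     (\<forall>c\<in>A. \<forall>p\<in>chart_image c.
        mean_curvature (in_chart F c) p + normal_part (tangent_space (in_chart F c) p) T = 0)"

definition drift_harmonic ::
  "('a, 'm::finite) chart set \<Rightarrow> ('a \<Rightarrow> 'e::euclidean_space) \<Rightarrow> ('e \<Rightarrow> real) \<Rightarrow> ('a \<Rightarrow> real) \<Rightarrow> bool" where
  "drift_harmonic A F f u \<longleftrightarrow>
     (\<forall>c\<in>A. \<forall>p\<in>chart_image c. drift_laplacian (in_chart F c) f (in_chart u c) p = 0)"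

text \<open>
  In a chart the volume measure is \<open>sqrt (det g) dx\<close>.  These measures agree on overlaps, so
  their supremum in the lattice of Borel measures is the measure on the manifold that
  restricts to each of them.
\<close>

definition chart_volume ::
  "('a::topological_space \<Rightarrow> 'e::euclidean_space) \<Rightarrow> ('a, 'm::finite) chart \<Rightarrow> 'a measure" where
  "chart_volume F c =
     distr (density (restrict_space lborel (chart_image c))
              (\<lambda>p. ennreal (sqrt (det (induced_metric (in_chart F c) p)))))
           borel (chart_inv c)"

definition volume_measure ::
  "('a::topological_space, 'm::finite) chart set \<Rightarrow> ('a \<Rightarrow> 'e::euclidean_space) \<Rightarrow> 'a measure" where
  "volume_measure A F = (SUP c\<in>A. chart_volume F c)"

text \<open>
  The induced metric is the pullback of the Euclidean one, so the speed of a curve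
  \<open>\<gamma>\<close> is the norm of the derivative of \<open>F \<circ> \<gamma>\<close>.  The library notion of piecewise C1 does not
  bound the derivative near the break points; the length is therefore a nonnegative
  Lebesgue integral, infinite when the speed is not integrable.
\<close>

definition piecewise_C1_curve ::
  "('a::topological_space, 'm::finite) chart set \<Rightarrow> (real \<Rightarrow> 'a) \<Rightarrow> bool" where
  "piecewise_C1_curve A \<gamma> \<longleftrightarrow> continuous_on {0..1} \<gamma> \<and>
     (\<forall>c\<in>A. \<forall>a b. 0 \<le> a \<longrightarrow> a \<le> b \<longrightarrow> b \<le> 1 \<longrightarrow> \<gamma> ` {a..b} \<subseteq> fst c \<longrightarrow>
        (snd c \<circ> \<gamma>) piecewise_C1_differentiable_on {a..b})"

definition curve_length :: "('a \<Rightarrow> 'e::euclidean_space) \<Rightarrow> (real \<Rightarrow> 'a) \<Rightarrow> ennreal" where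
  "curve_length F \<gamma> = (\<integral>\<^sup>+t\<in>{0..1}. ennreal (norm (vector_derivative (F \<circ> \<gamma>) (at t))) \<partial>lborel)"

definition riemannian_dist ::
  "('a::topological_space, 'm::finite) chart set \<Rightarrow> ('a \<Rightarrow> 'e::euclidean_space) \<Rightarrow> 'a \<Rightarrow> 'a \<Rightarrow> ennreal" where
  "riemannian_dist A F p q =
     (INF \<gamma> \<in> {\<gamma>. piecewise_C1_curve A \<gamma> \<and> \<gamma> 0 = p \<and> \<gamma> 1 = q}. curve_length F \<gamma>)"

definition complete_immersion ::
  "('a::topological_space, 'm::finite) chart set \<Rightarrow> ('a \<Rightarrow> 'e::euclidean_space) \<Rightarrow> bool" where
  "complete_immersion A F \<longleftrightarrow>
     (\<forall>s :: nat \<Rightarrow> 'a.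
        (\<forall>e>0. \<exists>N. \<forall>i\<ge>N. \<forall>j\<ge>N. riemannian_dist A F (s i) (s j) < e) \<longrightarrow>
        (\<exists>l. \<forall>e>0. \<exists>N. \<forall>i\<ge>N. riemannian_dist A F (s i) l < e))"

end

theory Submission
  imports Defs
begin

text \<open>
  Put \<open>h = \<langle>F, T\<rangle>\<close>, so that \<open>f \<circ> F = 2 h\<close>, the weight is \<open>e\<^sup>-\<^sup>h\<close> and \<open>\<Delta>\<^sub>f u = \<Delta>u - \<langle>\<nabla>h, \<nabla>u\<rangle>\<close> is the divergence of \<open>\<nabla>u\<close> with respect to
  \<open>e\<^sup>-\<^sup>h dV\<close>.  The soliton equation gives \<open>\<Delta>h = \<langle>H, T\<rangle> = - |T\<^sup>\<bottom>|\<^sup>2\<close>, and \<open>|\<nabla>h|\<^sup>2\<close> is the squared length of the tangential part of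
  \<open>T\<close>; hence \<open>\<Delta>\<^sub>f h = -1\<close> (\<open>drift_laplacian_height\<close>).  A function with drift Laplacian -1 and gradient bounded by 1
  forces the bottom of the spectrum of \<open>- \<Delta>\<^sub>f\<close> to be positive (testing with \<open>e\<^sup>h\<^sup>/\<^sup>2\<close> gives at least 1/4), so a square integrable harmonic
  function has to vanish.  In particular no nonzero constant is square integrable.

  The spectral gap is used through one vector field, \<open>V = 8 u \<nabla>u - u\<^sup>2 \<nabla>h\<close>.  Because \<open>\<Delta>\<^sub>f u = 0\<close> and \<open>\<Delta>\<^sub>f h = -1\<close>, its weighted divergence is
  \<open>8 |\<nabla>u|\<^sup>2 - 2 u \<langle>\<nabla>u, \<nabla>h\<rangle> + u\<^sup>2\<close>, which dominates \<open>4 |\<nabla>u|\<^sup>2 + u\<^sup>2 / 2\<close>.  Integrating the divergence against \<open>\<phi>\<^sup>2\<close> for a compactly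
  supported cutoff \<open>\<phi>\<close> with Lipschitz constant \<open>1 / R\<close> and absorbing the boundary term \<open>2 \<phi> |V| / R\<close> leaves
  \<open>\<integral> \<phi>\<^sup>2 u\<^sup>2 e\<^sup>-\<^sup>h / 4 \<le> (20 / R\<^sup>2) \<integral> u\<^sup>2 e\<^sup>-\<^sup>h\<close> (\<open>energy_inequality\<close>), and \<open>R\<close> is arbitrary.

  Three things carry this argument on a manifold given by charts.  Cutoffs come from the Hopf--Rinow theorem
  (\<open>complete_imp_precompact_balls\<close>), for a distance defined by chains of coordinate segments, which is comparable to the
  Riemannian distance as far as Cauchy sequences are concerned.  Such cutoffs are only Lipschitz, so integration by parts is
  replaced by \<open>divergence_inequality\<close>: it moves the mass of \<open>\<phi>\<^sup>2\<close> along the field by the map \<open>x + t W x\<close> and uses nothing but change of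
  variables.  Finally, the chart integrals are glued with a finite partition of unity on the support of \<open>\<phi>\<close>
  (\<open>chart_flux_inequality\<close>, \<open>u_vanishes\<close>).
\<close>

section \<open>Change of variables over an arbitrary finite index type\<close>

text \<open>
  The indices of a finite type, numbered from 0.  The change of variables formula is first used for
  a well-ordered index type; this copy of an arbitrary finite type inherits the order of \<open>nat\<close>, and
  the result is carried back by renaming coordinates.
\<close>

typedef ('a::finite) enum_index = "{..<CARD('a)}"
  by (rule exI[of _ 0]) (simp add: finite_UNIV_card_ge_0)

setup_lifting type_definition_enum_index

instantiation enum_index :: (finite) wellorder
begin

lift_definition less_eq_enum_index :: "'a enum_index \<Rightarrow> 'a enum_index \<Rightarrow> bool" is "(\<le>)" .
lift_definition less_enum_index :: "'a enum_index \<Rightarrow> 'a enum_index \<Rightarrow> bool" is "(<)" .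

instance
proof (standard, goal_cases)
  case (6 P a)
  show ?case
  proof (induction "Rep_enum_index a" arbitrary: a rule: less_induct)
    case less
    show ?case by (rule 6) (simp add: less less_enum_index.rep_eq)
  qed
qed (transfer; auto)+

end

instance enum_index :: (finite) finite
proof
  have "inj_on Rep_enum_index UNIV" by (simp add: Rep_enum_index_inject inj_on_def)
  moreover have "finite (range (Rep_enum_index :: 'a enum_index \<Rightarrow> nat))"
    by (rule finite_subset[of _ "{..<CARD('a)}"]) (use Rep_enum_index in auto)
  ultimately show "finite (UNIV :: 'a enum_index set)" by (rule finite_imageD[rotated])
qed

lemma ex_bij_enum_index: "\<exists>\<iota> :: 'a::finite enum_index \<Rightarrow> 'a. bij \<iota>"
proof -
  have "bij_betw (Rep_enum_index :: 'a enum_index \<Rightarrow> nat) UNIV {..<CARD('a)}"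
    by (metis bij_betw_def inj_on_def Rep_enum_index_inject type_definition.Rep_range type_definition_enum_index)
  moreover obtain h where "bij_betw h {..<CARD('a)} (UNIV :: 'a set)"
    using ex_bij_betw_nat_finite[of "UNIV :: 'a set"] by (auto simp: atLeast0LessThan)
  ultimately show ?thesis using bij_betw_trans by blast
qed

text \<open>
  Conjugation by a bijection of the index types matches the permutations in the Leibniz formula and
  preserves their signs.
\<close>

lemma det_reindex:
  fixes A :: "real^'m::finite^'m" and \<iota> :: "'n::finite \<Rightarrow> 'm"
  assumes "bij \<iota>"
  shows "det (\<chi> i j. A $ \<iota> i $ \<iota> j) = det A"
proof -
  let ?S = "{p. p permutes (UNIV::'n set)}"
  let ?T = "{p. p permutes (UNIV::'m set)}"
  let ?f = "map_permutation UNIV \<iota>"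
  have inj: "inj \<iota>" using assms bij_is_inj by blast
  have app: "?f p (\<iota> x) = \<iota> (p x)" for p x by (rule map_permutation_apply) (use inj in auto)
  have bf: "bij_betw ?f ?S ?T"
  proof (rule bij_betw_byWitness[where f' = "\<lambda>q. inv \<iota> \<circ> q \<circ> \<iota>"])
    show "\<forall>p\<in>?S. inv \<iota> \<circ> ?f p \<circ> \<iota> = p" using app inj by (auto simp: fun_eq_iff)
    show "\<forall>q\<in>?T. ?f (inv \<iota> \<circ> q \<circ> \<iota>) = q"
    proof
      fix q assume "q \<in> ?T"
      show "?f (inv \<iota> \<circ> q \<circ> \<iota>) = q"
      proof
        fix y obtain x where "y = \<iota> x" using assms by (metis bij_pointE)
        then show "?f (inv \<iota> \<circ> q \<circ> \<iota>) y = q y" using app assms by (simp add: bij_is_surj surj_f_inv_f)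
      qed
    qed
    show "?f ` ?S \<subseteq> ?T" using map_permutation_permutes[of \<iota> UNIV UNIV] assms by auto
    show "(\<lambda>q. inv \<iota> \<circ> q \<circ> \<iota>) ` ?T \<subseteq> ?S"
    proof clarsimp
      fix q :: "'m \<Rightarrow> 'm" assume "q permutes UNIV"
      then have "bij (inv \<iota> \<circ> q \<circ> \<iota>)"
        using assms by (simp add: bij_comp bij_imp_bij_inv permutes_bij)
      then show "(inv \<iota> \<circ> q \<circ> \<iota>) permutes UNIV" by (intro bij_imp_permutes) auto
    qed
  qed
  have "det A = (\<Sum>p\<in>?S. of_int (sign (?f p)) * (\<Prod>i\<in>UNIV. A $ i $ ?f p i))"
    unfolding det_def by (rule sum.reindex_bij_betw[OF bf, symmetric])
  also have "\<dots> = (\<Sum>p\<in>?S. of_int (sign p) * (\<Prod>i\<in>UNIV. A $ \<iota> i $ \<iota> (p i)))"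
  proof (rule sum.cong[OF refl])
    fix p assume "p \<in> ?S"
    then have "sign (?f p) = sign p" by (simp add: inj sign_map_permutation)
    moreover have "(\<Prod>i\<in>UNIV. A $ i $ ?f p i) = (\<Prod>i\<in>UNIV. A $ \<iota> i $ ?f p (\<iota> i))"
      using prod.reindex_bij_betw[OF assms, of "\<lambda>i. A $ i $ ?f p i"] by simp
    ultimately show "of_int (sign (?f p)) * (\<Prod>i\<in>UNIV. A $ i $ ?f p i)
      = of_int (sign p) * (\<Prod>i\<in>UNIV. A $ \<iota> i $ \<iota> (p i))" by (simp add: app)
  qed
  finally show ?thesis by (simp add: det_def)
qed

definition reindex :: "('n \<Rightarrow> 'm) \<Rightarrow> real^'m::finite \<Rightarrow> real^'n::finite" where
  "reindex \<iota> x = (\<chi> i. x $ \<iota> i)"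

lemma linear_reindex: "linear (reindex \<iota>)"
  by (auto simp: linear_iff reindex_def vec_eq_iff)

lemma bounded_linear_reindex: "bounded_linear (reindex \<iota>)"
  using linear_reindex linear_conv_bounded_linear by blast

lemma reindex_inverse:
  assumes "bij \<iota>" shows "reindex (inv \<iota>) (reindex \<iota> x) = x" "reindex \<iota> (reindex (inv \<iota>) y) = y"
  using assms by (simp_all add: reindex_def vec_eq_iff bij_is_surj surj_f_inv_f bij_is_inj)

text \<open>
  Renaming coordinates maps boxes to boxes with the same side lengths.
\<close>

lemma lborel_reindex:
  fixes \<iota> :: "'n::finite \<Rightarrow> 'm::finite"
  assumes b: "bij \<iota>"
  shows "distr lborel borel (reindex \<iota>) = lborel"
proof (rule lborel_eqI[symmetric])
  have m: "reindex \<iota> \<in> borel_measurable (borel :: (real^'m) measure)"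
    by (intro borel_measurable_continuous_onI linear_continuous_on bounded_linear_reindex)
  fix l u :: "real^'n" assume lu: "\<And>b. b \<in> Basis \<Longrightarrow> l \<bullet> b \<le> u \<bullet> b"
  have lu': "l $ i \<le> u $ i" for i using lu[of "axis i 1"] by (auto simp: inner_axis axis_in_Basis_iff)
  let ?l = "reindex (inv \<iota>) l" and ?u = "reindex (inv \<iota>) u"
  have P: "(\<Prod>b\<in>Basis. (v::real^'k::finite) \<bullet> b) = (\<Prod>i\<in>UNIV. v $ i)" for v
    by (simp add: Basis_vec_def axis_eq_axis UNION_singleton_eq_range inner_axis
        prod.reindex inj_on_def)
  have "reindex \<iota> -` box l u = box ?l ?u"
    using b by (auto simp: mem_box_cart reindex_def)
      (metis bij_inv_eq_iff)+
  then have "emeasure (distr lborel borel (reindex \<iota>)) (box l u) = emeasure lborel (box ?l ?u)"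
    using m by (simp add: emeasure_distr)
  also have "\<dots> = (\<Prod>b\<in>Basis. (?u - ?l) \<bullet> b)"
    using lu' by (intro emeasure_lborel_box) (auto simp: Basis_vec_def inner_axis reindex_def)
  also have "\<dots> = (\<Prod>i\<in>UNIV. (?u - ?l) $ i)" by (simp add: P)
  also have "\<dots> = (\<Prod>i\<in>UNIV. (u - l) $ i)"
    using prod.reindex_bij_betw[OF b, of "\<lambda>i. (?u - ?l) $ i"] b
    by (simp add: reindex_def bij_is_inj)
  also have "\<dots> = (\<Prod>b\<in>Basis. (u - l) \<bullet> b)" by (simp add: P)
  finally show "emeasure (distr lborel borel (reindex \<iota>)) (box l u) = (\<Prod>b\<in>Basis. (u - l) \<bullet> b)" .
qed simp

lemma absolutely_integrable_continuous_compact: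
  fixes f :: "'a::euclidean_space \<Rightarrow> real"
  assumes "compact K" "continuous_on K f"
  shows "f absolutely_integrable_on K"
  using borel_integrable_compact[OF assms]
  by (simp add: absolutely_integrable_on_def set_integrable_def integrable_completion
      integrable_restrict_UNIV[symmetric] set_borel_integral_eq_integral
      set_lebesgue_integral_def)

lemma integral_reindex:
  fixes f :: "real^'n::finite \<Rightarrow> real" and \<iota> :: "'n \<Rightarrow> 'm::finite"
  assumes b: "bij \<iota>" and K: "compact K" and f: "continuous_on K f"
  shows "integral K f = integral (reindex (inv \<iota>) ` K) (\<lambda>x. f (reindex \<iota> x))"
proof -
  let ?K = "reindex (inv \<iota>) ` K"
  have m: "reindex \<iota> \<in> borel_measurable (borel :: (real^'m) measure)"
    by (intro borel_measurable_continuous_onI linear_continuous_on bounded_linear_reindex)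
  have K': "compact ?K"
    by (intro compact_continuous_image K linear_continuous_on bounded_linear_reindex)
  have f': "continuous_on ?K (\<lambda>x. f (reindex \<iota> x))"
    by (rule continuous_on_compose2[OF f linear_continuous_on[OF bounded_linear_reindex]])
      (auto simp: reindex_inverse b)
  have I: "integral C h = (LBINT x:C. h x)" if "compact C" "continuous_on C h" for C and h :: "real^'k::finite \<Rightarrow> real"
    using set_borel_integral_eq_integral(2)[of C h] borel_integrable_compact[OF that]
    by (simp add: set_integrable_def)
  have "integral K f = (\<integral>x. indicator K x *\<^sub>R f x \<partial>distr lborel borel (reindex \<iota> :: real^'m \<Rightarrow> _))"
    using I[OF K f] by (simp add: lborel_reindex b set_lebesgue_integral_def)
  also have "\<dots> = (\<integral>x. indicator K (reindex \<iota> x) *\<^sub>R f (reindex \<iota> x) \<partial>(lborel :: (real^'m) measure))"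
    using borel_measurable_continuous_on_indicator[OF _ f] K m
    by (subst integral_distr) (auto simp: borel_compact)
  also have "\<dots> = (\<integral>x. indicator ?K x *\<^sub>R f (reindex \<iota> x) \<partial>(lborel :: (real^'m) measure))"
  proof (rule Bochner_Integration.integral_cong[OF refl])
    fix x :: "real^'m"
    have "reindex \<iota> x \<in> K \<longleftrightarrow> x \<in> ?K"
      by (auto simp: reindex_inverse b intro: image_eqI[where x = "reindex \<iota> x"])
    then show "indicator K (reindex \<iota> x) *\<^sub>R f (reindex \<iota> x) = indicator ?K x *\<^sub>R f (reindex \<iota> x)"
      by (auto simp: indicator_def)
  qed
  also have "\<dots> = integral ?K (\<lambda>x. f (reindex \<iota> x))"
    using I[OF K' f'] by (simp add: set_lebesgue_integral_def)
  finally show ?thesis .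
qed

lemma integral_change_of_variables_wellorder:
  fixes f :: "real^'m::{finite,wellorder} \<Rightarrow> real" and g :: "real^'m::_ \<Rightarrow> real^'m::_"
  assumes K: "compact K"
    and der_g: "\<And>x. x \<in> K \<Longrightarrow> (g has_derivative g' x) (at x within K)"
    and inj: "inj_on g K" and f: "continuous_on (g ` K) f"
  shows "integral (g ` K) f = integral K (\<lambda>x. \<bar>det (matrix (g' x))\<bar> * f (g x))"
proof -
  have cg: "continuous_on K g"
    using der_g has_derivative_continuous_on by blast
  have ai: "f absolutely_integrable_on (g ` K)"
    by (intro absolutely_integrable_continuous_compact f compact_continuous_image cg K)
  let ?f = "\<lambda>x. vec (f x) :: real^1"
  have ai1: "?f absolutely_integrable_on (g ` K)"
    using ai unfolding absolutely_integrable_on_1_iff by simp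
  have "K \<in> sets lebesgue" using K by (simp add: borel_compact lmeasurable_compact fmeasurableD)
  note cv = has_absolute_integral_change_of_variables[OF this der_g inj, of ?f "integral (g ` K) ?f"]
  from ai1 cv have "(\<lambda>x. \<bar>det (matrix (g' x))\<bar> *\<^sub>R ?f (g x)) absolutely_integrable_on K"
    and "integral K (\<lambda>x. \<bar>det (matrix (g' x))\<bar> *\<^sub>R ?f (g x)) = integral (g ` K) ?f"
    by auto
  then show ?thesis
    using ai1 by (simp add: integral_on_1_eq vec_eq_iff)
qed

text \<open>
  Conjugating the map by a renaming of coordinates reduces the claim to a well-ordered index type:
  neither Lebesgue measure nor the Jacobian determinant notices the renaming.
\<close>

lemma integral_change_of_variables_finite:
  fixes f :: "real^'m::finite \<Rightarrow> real" and g :: "real^'m \<Rightarrow> real^'m"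
  assumes K: "compact K"
    and der_g: "\<And>x. x \<in> K \<Longrightarrow> (g has_derivative g' x) (at x within K)"
    and cont: "continuous_on K (\<lambda>x. det (matrix (g' x)))"
    and inj: "inj_on g K" and f: "continuous_on (g ` K) f"
  shows "integral (g ` K) f = integral K (\<lambda>x. \<bar>det (matrix (g' x))\<bar> * f (g x))"
proof -
  obtain \<iota> :: "'m enum_index \<Rightarrow> 'm" where b: "bij \<iota>" using ex_bij_enum_index by blast
  let ?P = "reindex \<iota>" and ?Q = "reindex (inv \<iota>)"
  have b': "bij (inv \<iota>)" "inv (inv \<iota>) = \<iota>" using b by (simp_all add: bij_imp_bij_inv inv_inv_eq)
  have QP: "?Q (?P x) = x" for x using b by (rule reindex_inverse)
  have PQ: "?P (?Q x) = x" for x using b by (rule reindex_inverse)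
  have cP: "continuous_on S ?P" and cQ: "continuous_on S' ?Q" for S S'
    by (intro linear_continuous_on bounded_linear_reindex)+
  have cg: "continuous_on K g" using der_g has_derivative_continuous_on by blast
  let ?K = "?P ` K" and ?g = "\<lambda>y. ?P (g (?Q y))" and ?f = "\<lambda>y. f (?Q y)"
  let ?g' = "\<lambda>y v. ?P (g' (?Q y) (?Q v))"
  have det: "det (matrix (?g' (?P x))) = det (matrix (g' x))" for x
  proof -
    have Qa: "?Q (axis j 1) = axis (\<iota> j) 1" for j
      using b by (auto simp: reindex_def vec_eq_iff axis_def bij_is_inj bij_inv_eq_iff)
    have "matrix (?g' (?P x)) = (\<chi> i j. ?P (g' x (axis (\<iota> j) 1)) $ i)"
      unfolding matrix_def QP Qa ..
    also have "\<dots> = (\<chi> i j. matrix (g' x) $ \<iota> i $ \<iota> j)"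
      by (simp add: matrix_def reindex_def)
    finally show ?thesis by (simp only: det_reindex[OF b])
  qed
  have "integral (g ` K) f = integral (?P ` g ` K) ?f"
    using integral_reindex[OF b'(1) compact_continuous_image[OF cg K] f] b'(2) by simp
  also have "?P ` g ` K = ?g ` ?K" by (simp add: image_image QP)
  also have "integral (?g ` ?K) ?f = integral ?K (\<lambda>y. \<bar>det (matrix (?g' y))\<bar> * ?f (?g y))"
  proof (rule integral_change_of_variables_wellorder)
    show "compact ?K" by (intro compact_continuous_image cP K)
    show "inj_on ?g ?K"
      using inj by (auto simp: inj_on_def QP) (metis QP)
    show "continuous_on (?g ` ?K) ?f"
      by (rule continuous_on_compose2[OF f cQ]) (auto simp: QP)
    fix y assume y: "y \<in> ?K"
    have Q: "(?Q has_derivative ?Q) (at y within ?K)"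
      by (rule bounded_linear_imp_has_derivative[OF bounded_linear_reindex])
    have "?Q ` ?K = K" by (simp add: image_image QP)
    then have "(g has_derivative g' (?Q y)) (at (?Q y) within ?Q ` ?K)"
      using der_g y by (auto simp: QP)
    then have "((\<lambda>y. g (?Q y)) has_derivative (\<lambda>v. g' (?Q y) (?Q v))) (at y within ?K)"
      by (rule has_derivative_in_compose[OF Q])
    then show "(?g has_derivative ?g' y) (at y within ?K)"
      by (rule bounded_linear.has_derivative[OF bounded_linear_reindex])
  qed
  also have "\<dots> = integral K (\<lambda>x. \<bar>det (matrix (?g' (?P x)))\<bar> * ?f (?g (?P x)))"
  proof -
    have "continuous_on K (\<lambda>x. \<bar>det (matrix (?g' (?P x)))\<bar> * ?f (?g (?P x)))"
      unfolding det unfolding QP by (intro continuous_intros cont continuous_on_compose2[OF f cg]) auto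
    then have "continuous_on ?K (\<lambda>y. \<bar>det (matrix (?g' (?P (?Q y))))\<bar> * ?f (?g (?P (?Q y))))"
      by (rule continuous_on_compose2[OF _ cQ]) (auto simp: QP)
    then have "continuous_on ?K (\<lambda>y. \<bar>det (matrix (?g' y))\<bar> * ?f (?g y))" by (simp add: PQ)
    from integral_reindex[OF b _ this] show ?thesis
      by (simp add: compact_continuous_image cP K image_image QP)
  qed
  also have "\<dots> = integral K (\<lambda>x. \<bar>det (matrix (g' x))\<bar> * f (g x))"
    unfolding det unfolding QP ..
  finally show ?thesis .
qed


section \<open>Calculus of continuously differentiable maps\<close>

definition C1_on :: "('e::real_normed_vector \<Rightarrow> 'b::real_normed_vector) \<Rightarrow> 'e set \<Rightarrow> bool" where
  "C1_on f S \<longleftrightarrow> C_k_on 1 f S"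

lemma C1_on_iff: "C1_on f S \<longleftrightarrow> (\<forall>x\<in>S. f differentiable (at x)) \<and>
    (\<forall>v. continuous_on S (\<lambda>x. frechet_derivative f (at x) v))"
  by (simp add: C1_on_def)

lemma C_2_onD: "C_k_on 2 f S \<Longrightarrow> C1_on (\<lambda>x. frechet_derivative f (at x) v) S"
  by (simp add: numeral_2_eq_2 C1_on_def)

lemma C1_onI:
  assumes "\<And>x. x \<in> S \<Longrightarrow> (f has_derivative f' x) (at x)"
    and "\<And>v. continuous_on S (\<lambda>x. f' x v)"
  shows "C1_on f S"
proof -
  have "frechet_derivative f (at x) = f' x" if "x \<in> S" for x
    using assms(1)[OF that] frechet_derivative_at by metis
  then have "continuous_on S (\<lambda>x. frechet_derivative f (at x) v) = continuous_on S (\<lambda>x. f' x v)" for v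
    by (intro continuous_on_cong) auto
  then show ?thesis using assms unfolding C1_on_iff differentiable_def by blast
qed

lemma C1_on_has_derivative: "C1_on f S \<Longrightarrow> x \<in> S \<Longrightarrow> (f has_derivative frechet_derivative f (at x)) (at x)"
  using frechet_derivative_works unfolding C1_on_iff by blast

lemma C1_on_continuous_derivative: "C1_on f S \<Longrightarrow> continuous_on S (\<lambda>x. frechet_derivative f (at x) v)"
  unfolding C1_on_iff by blast

lemma C1_on_continuous: "C1_on f S \<Longrightarrow> continuous_on S f"
  by (meson C1_on_has_derivative continuous_at_imp_continuous_on has_derivative_continuous)

lemma C1_on_subset: "C1_on f S \<Longrightarrow> T \<subseteq> S \<Longrightarrow> C1_on f T"
  unfolding C1_on_iff by (meson continuous_on_subset subsetD)

lemma C1_on_open_Un: "C1_on f S \<Longrightarrow> C1_on f T \<Longrightarrow> open S \<Longrightarrow> open T \<Longrightarrow> C1_on f (S \<union> T)"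
  unfolding C1_on_iff by (auto intro: continuous_on_open_Un)

lemma C1_on_open_UN:
  assumes "\<And>i. i \<in> I \<Longrightarrow> C1_on f (S i)" "\<And>i. i \<in> I \<Longrightarrow> open (S i)"
  shows "C1_on f (\<Union>i\<in>I. S i)"
  using assms unfolding C1_on_iff by (auto intro!: continuous_on_open_UN)

lemma C1_on_cong:
  assumes "open S" "\<And>x. x \<in> S \<Longrightarrow> f x = g x" "C1_on g S" shows "C1_on f S"
proof (rule C1_onI)
  fix x assume "x \<in> S"
  then show "(f has_derivative frechet_derivative g (at x)) (at x)"
    using has_derivative_transform_within_open[OF C1_on_has_derivative[OF assms(3)]] assms(1,2)
    by metis
qed (rule C1_on_continuous_derivative[OF assms(3)])

lemma frechet_derivative_cong_open:
  assumes "open S" "x \<in> S" "\<And>y. y \<in> S \<Longrightarrow> f y = g y"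
  shows "frechet_derivative f (at x) = frechet_derivative g (at x)"
proof -
  have "(f has_derivative D) (at x) \<longleftrightarrow> (g has_derivative D) (at x)" for D
    using has_derivative_transform_within_open[OF _ assms(1,2)] assms(3) by metis
  then show ?thesis by (simp add: frechet_derivative_def)
qed

lemma C1_on_const [intro]: "C1_on (\<lambda>x. c) S"
  by (rule C1_onI[where f' = "\<lambda>_ _. 0"]) auto

lemma C1_on_bounded_linear:
  assumes "bounded_linear g" "C1_on f S" shows "C1_on (\<lambda>x. g (f x)) S"
  by (rule C1_onI, rule bounded_linear.has_derivative[OF assms(1)], erule C1_on_has_derivative[OF assms(2)])
    (intro continuous_on_compose2[OF linear_continuous_on[OF assms(1), of UNIV]] C1_on_continuous_derivative assms(2), auto)

lemma C1_on_linear: "bounded_linear g \<Longrightarrow> C1_on g S"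
  by (rule C1_onI[OF bounded_linear_imp_has_derivative]) auto

lemma C1_on_add: "C1_on f S \<Longrightarrow> C1_on g S \<Longrightarrow> C1_on (\<lambda>x. f x + g x) S"
  by (rule C1_onI, rule has_derivative_add; (rule C1_on_has_derivative; assumption)?)
    (auto intro!: continuous_intros C1_on_continuous_derivative)

lemma C1_on_bilinear:
  assumes B: "bounded_bilinear B" and f: "C1_on f S" and g: "C1_on g S"
  shows "C1_on (\<lambda>x. B (f x) (g x)) S"
  by (rule C1_onI, rule bounded_bilinear.FDERIV[OF B]; (rule C1_on_has_derivative[OF f] C1_on_has_derivative[OF g])?)
   (auto intro!: continuous_intros bounded_bilinear.continuous_on[OF B] C1_on_continuous[OF f] C1_on_continuous[OF g]
       C1_on_continuous_derivative f g)

lemmas C1_on_mult = C1_on_bilinear[OF bounded_bilinear_mult]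
lemmas C1_on_scaleR = C1_on_bilinear[OF bounded_bilinear_scaleR]
lemmas C1_on_inner = C1_on_bilinear[OF bounded_bilinear_inner]

lemma C1_on_diff: "C1_on f S \<Longrightarrow> C1_on g S \<Longrightarrow> C1_on (\<lambda>x. f x - g x :: 'b::real_normed_vector) S"
  using C1_on_add[of f S "\<lambda>x. - g x"] C1_on_bounded_linear[OF bounded_linear_minus[OF bounded_linear_ident], of g S]
  by simp

lemma C1_on_sum: "(\<And>i. i \<in> I \<Longrightarrow> C1_on (f i) S) \<Longrightarrow> C1_on (\<lambda>x. \<Sum>i\<in>I. f i x) S"
  by (induction I rule: infinite_finite_induct) (auto intro: C1_on_add)

lemma C1_on_prod:
  fixes f :: "'i \<Rightarrow> 'e::real_normed_vector \<Rightarrow> real"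
  shows "(\<And>i. i \<in> I \<Longrightarrow> C1_on (f i) S) \<Longrightarrow> C1_on (\<lambda>x. \<Prod>i\<in>I. f i x) S"
  by (induction I rule: infinite_finite_induct) (auto intro: C1_on_mult)

lemma C1_on_real_compose:
  fixes f :: "'e::real_normed_vector \<Rightarrow> real" and g :: "real \<Rightarrow> real"
  assumes f: "C1_on f S" and g: "\<And>y. y \<in> f ` S \<Longrightarrow> (g has_real_derivative g' y) (at y)"
    and g': "continuous_on (f ` S) g'"
  shows "C1_on (\<lambda>x. g (f x)) S"
proof (rule C1_onI)
  fix x assume x: "x \<in> S"
  show "((\<lambda>x. g (f x)) has_derivative (\<lambda>v. g' (f x) * frechet_derivative f (at x) v)) (at x)"
    using has_derivative_compose[OF C1_on_has_derivative[OF f x], of g "\<lambda>v. g' (f x) * v"] g[of "f x"] x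
    by (simp add: has_field_derivative_def)
next
  fix v show "continuous_on S (\<lambda>x. g' (f x) * frechet_derivative f (at x) v)"
    by (intro continuous_intros C1_on_continuous_derivative f continuous_on_compose2[OF g' C1_on_continuous[OF f]]) auto
qed

lemma C1_on_exp: "C1_on f S \<Longrightarrow> C1_on (\<lambda>x. exp (f x :: real)) S"
  by (rule C1_on_real_compose[where g' = exp]) (auto intro: continuous_intros DERIV_exp)

lemma C1_on_sqrt: "C1_on f S \<Longrightarrow> (\<And>x. x \<in> S \<Longrightarrow> 0 < f x) \<Longrightarrow> C1_on (\<lambda>x. sqrt (f x)) S"
  by (erule C1_on_real_compose[where g' = "\<lambda>y. inverse (sqrt y) / 2"])
    (fastforce intro!: DERIV_real_sqrt continuous_intros)+

lemma C1_on_inverse: "C1_on f S \<Longrightarrow> (\<And>x. x \<in> S \<Longrightarrow> f x \<noteq> 0) \<Longrightarrow> C1_on (\<lambda>x. inverse (f x :: real)) S"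
  by (rule C1_on_real_compose[where g' = "\<lambda>y. - (inverse y)\<^sup>2"])
    (auto intro!: continuous_intros derivative_eq_intros simp: power2_eq_square)

lemma C1_on_divide: "C1_on f S \<Longrightarrow> C1_on g S \<Longrightarrow> (\<And>x. x \<in> S \<Longrightarrow> g x \<noteq> 0) \<Longrightarrow> C1_on (\<lambda>x. f x / g x :: real) S"
  unfolding divide_inverse by (intro C1_on_mult C1_on_inverse)

lemma C1_on_vec_nth: "C1_on f S \<Longrightarrow> C1_on (\<lambda>x. f x $ i) S"
  by (rule C1_on_bounded_linear[OF bounded_linear_vec_nth])

lemma C1_on_vec:
  fixes f :: "'e::real_normed_vector \<Rightarrow> real^'n::finite"
  assumes "\<And>i. C1_on (\<lambda>x. f x $ i) S" shows "C1_on f S"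
proof -
  have *: "f = (\<lambda>x. \<Sum>i\<in>UNIV. (f x $ i) *\<^sub>R axis i 1)"
    by (simp add: fun_eq_iff vec_eq_iff axis_def if_distrib cong: if_cong)
  show ?thesis by (subst *) (intro C1_on_sum C1_on_scaleR assms C1_on_const)
qed

lemma C1_on_det:
  fixes A :: "'e::real_normed_vector \<Rightarrow> real^'n::finite^'n"
  assumes "\<And>i j. C1_on (\<lambda>x. A x $ i $ j) S" shows "C1_on (\<lambda>x. det (A x)) S"
  unfolding det_def by (intro C1_on_sum C1_on_mult C1_on_prod C1_on_const assms)

lemma frechet_derivative_Basis_sum:
  fixes f :: "'e::euclidean_space \<Rightarrow> 'b::real_normed_vector"
  assumes "f differentiable (at x)"
  shows "frechet_derivative f (at x) v = (\<Sum>b\<in>Basis. (v \<bullet> b) *\<^sub>R frechet_derivative f (at x) b)"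
proof -
  have l: "linear (frechet_derivative f (at x))" using assms by (rule linear_frechet_derivative)
  have "frechet_derivative f (at x) (\<Sum>b\<in>Basis. (v \<bullet> b) *\<^sub>R b) = (\<Sum>b\<in>Basis. (v \<bullet> b) *\<^sub>R frechet_derivative f (at x) b)"
    by (simp only: linear_sum[OF l] linear_scale[OF l])
  then show ?thesis by (simp add: euclidean_representation)
qed

lemma continuous_on_frechet_derivative:
  fixes f :: "'e::euclidean_space \<Rightarrow> 'b::real_normed_vector" and g :: "'c::topological_space \<Rightarrow> 'e"
  assumes f: "C1_on f S" and g: "continuous_on T g" "\<And>t. t \<in> T \<Longrightarrow> g t \<in> S" and v: "continuous_on T v"
  shows "continuous_on T (\<lambda>t. frechet_derivative f (at (g t)) (v t))"
proof -
  have "continuous_on T (\<lambda>t. frechet_derivative f (at (g t)) (v t)) =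
      continuous_on T (\<lambda>t. \<Sum>b\<in>Basis. (v t \<bullet> b) *\<^sub>R frechet_derivative f (at (g t)) b)"
    by (intro continuous_on_cong refl frechet_derivative_Basis_sum) (use f g in \<open>auto simp: C1_on_iff\<close>)
  also have "\<dots>"
    by (intro continuous_intros v continuous_on_compose2[OF C1_on_continuous_derivative[OF f] g(1)]) (use g in auto)
  finally show ?thesis .
qed

lemma C1_on_compose:
  fixes f :: "'e::euclidean_space \<Rightarrow> 'b::real_normed_vector" and g :: "'c::real_normed_vector \<Rightarrow> 'e"
  assumes f: "C1_on f T" and g: "C1_on g S" and gS: "\<And>x. x \<in> S \<Longrightarrow> g x \<in> T"
  shows "C1_on (\<lambda>x. f (g x)) S"
proof (rule C1_onI)
  fix x assume "x \<in> S"
  then show "((\<lambda>x. f (g x)) has_derivative (\<lambda>v. frechet_derivative f (at (g x)) (frechet_derivative g (at x) v))) (at x)"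
    using has_derivative_compose[OF C1_on_has_derivative[OF g] C1_on_has_derivative[OF f gS]] by blast
next
  fix v show "continuous_on S (\<lambda>x. frechet_derivative f (at (g x)) (frechet_derivative g (at x) v))"
    by (intro continuous_on_frechet_derivative[OF f] C1_on_continuous g C1_on_continuous_derivative gS)
qed

text \<open>
  The determinant is linear in each row, so its derivative is the sum over the rows of the determinants
  in which that one row has been differentiated.
\<close>

lemma has_derivative_det:
  fixes A :: "'e::real_normed_vector \<Rightarrow> real^'n::finite^'n"
  assumes A: "\<And>i j. ((\<lambda>x. A x $ i $ j) has_derivative A' i j) (at x within S)"
  shows "((\<lambda>x. det (A x)) has_derivative
      (\<lambda>v. \<Sum>k\<in>UNIV. det (\<chi> i j. if i = k then A' i j v else A x $ i $ j))) (at x within S)"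
proof -
  let ?P = "{p. p permutes (UNIV::'n set)}"
  have "((\<lambda>x. \<Sum>p\<in>?P. of_int (sign p) * (\<Prod>i\<in>UNIV. A x $ i $ p i)) has_derivative
      (\<lambda>v. \<Sum>p\<in>?P. of_int (sign p) * (\<Sum>k\<in>UNIV. A' k (p k) v * (\<Prod>i\<in>UNIV - {k}. A x $ i $ p i)))) (at x within S)"
    by (intro has_derivative_sum has_derivative_mult_right has_derivative_prod A)
  moreover have "(\<Sum>p\<in>?P. of_int (sign p) * (\<Sum>k\<in>UNIV. A' k (p k) v * (\<Prod>i\<in>UNIV - {k}. A x $ i $ p i)))
     = (\<Sum>k\<in>UNIV. det (\<chi> i j. if i = k then A' i j v else A x $ i $ j))" for v
  proof -
    have "(\<Prod>i\<in>UNIV. if i = k then A' i (p i) v else A x $ i $ p i)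
       = A' k (p k) v * (\<Prod>i\<in>UNIV - {k}. A x $ i $ p i)" for p k
      by (subst prod.remove[of _ k]) (auto intro!: prod.cong)
    then show ?thesis
      unfolding det_def by (subst sum.swap) (simp add: sum_distrib_left)
  qed
  ultimately show ?thesis by (simp add: det_def)
qed

text \<open>
  With \<open>C\<close> the derivative of \<open>A\<close> and \<open>B = C A\<^sup>-\<^sup>1\<close> this turns the row formula into Jacobi's formula
  \<open>tr (A\<^sup>-\<^sup>1 A') det A\<close>; with \<open>A = 1\<close> it gives the trace.  Row \<open>k\<close> of \<open>C\<close> is the combination of the rows
  of \<open>A\<close> with coefficients \<open>B $ k\<close>, so Cramer's lemma evaluates each summand.
\<close>

lemma det_replace_row:
  fixes A B :: "real^'n::finite^'n"
  assumes "B ** A = C"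
  shows "(\<Sum>k\<in>UNIV. det (\<chi> i j. if i = k then C $ i $ j else A $ i $ j)) = trace B * det A"
proof -
  have "det (\<chi> i j. if i = k then C $ i $ j else A $ i $ j) = B $ k $ k * det A" for k
  proof -
    have "(\<chi> i j. if i = k then C $ i $ j else A $ i $ j)
       = (\<chi> i. if i = k then (\<Sum>l\<in>UNIV. (B $ k) $ l *s row l A) else row i A)"
      using assms by (auto simp: vec_eq_iff row_def matrix_matrix_mult_def)
    then show ?thesis using cramer_lemma_transpose[of k "B $ k" A] by simp
  qed
  then show ?thesis by (simp add: trace_def sum_distrib_right)
qed

text \<open>
  The second difference of \<open>f\<close> over a small parallelogram is symmetric in \<open>a\<close> and \<open>b\<close>, and two applications
  of the mean value theorem express it by either mixed derivative at a nearby point.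
\<close>

lemma mixed_derivatives_commute_real:
  fixes f :: "'e::real_normed_vector \<Rightarrow> real"
  assumes S: "open S" and p: "p \<in> S" and f: "\<And>x. x \<in> S \<Longrightarrow> (f has_derivative f' x) (at x)"
    and fa: "\<And>x. x \<in> S \<Longrightarrow> ((\<lambda>x. f' x a) has_derivative fa x) (at x)"
    and fb: "\<And>x. x \<in> S \<Longrightarrow> ((\<lambda>x. f' x b) has_derivative fb x) (at x)"
    and ca: "continuous_on S (\<lambda>x. fa x b)" and cb: "continuous_on S (\<lambda>x. fb x a)"
  shows "fa p b = fb p a"
proof -
  have key: "\<exists>x. dist x p \<le> t * (norm a + norm b) \<and>
      f (p + t *\<^sub>R a + t *\<^sub>R b) - f (p + t *\<^sub>R a) - f (p + t *\<^sub>R b) + f p = t\<^sup>2 * fa x b"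
    if t: "t > 0" and sub: "cball p (t * (norm a + norm b)) \<subseteq> S"
      and fa: "\<And>x. x \<in> S \<Longrightarrow> ((\<lambda>x. f' x a) has_derivative fa x) (at x)"
    for t a b fa
  proof -
    have inS: "p + s *\<^sub>R a + r *\<^sub>R b \<in> cball p (t * (norm a + norm b))"
      if "0 \<le> s" "s \<le> t" "0 \<le> r" "r \<le> t" for s r
    proof -
      have "norm (s *\<^sub>R a + r *\<^sub>R b) \<le> s * norm a + r * norm b"
        using that norm_triangle_ineq[of "s *\<^sub>R a" "r *\<^sub>R b"] by simp
      also have "\<dots> \<le> t * norm a + t * norm b"
        using that by (intro add_mono mult_right_mono) auto
      finally show ?thesis by (simp add: dist_norm norm_minus_commute algebra_simps)
    qed
    define g where "g s = f (p + s *\<^sub>R a + t *\<^sub>R b) - f (p + s *\<^sub>R a + 0 *\<^sub>R b)" for s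
    have "(g has_real_derivative (f' (p + s *\<^sub>R a + t *\<^sub>R b) a - f' (p + s *\<^sub>R a + 0 *\<^sub>R b) a)) (at s)"
      if "0 \<le> s" "s \<le> t" for s
    proof -
      have *: "((\<lambda>s. f (p + s *\<^sub>R a + r *\<^sub>R b)) has_real_derivative f' (p + s *\<^sub>R a + r *\<^sub>R b) a) (at s)"
        if "0 \<le> r" "r \<le> t" for r
      proof -
        have D: "(f has_derivative f' (p + s *\<^sub>R a + r *\<^sub>R b)) (at (p + s *\<^sub>R a + r *\<^sub>R b))"
          using f inS[of s r] sub \<open>0 \<le> s\<close> \<open>s \<le> t\<close> that by blast
        have "((\<lambda>s. p + s *\<^sub>R a + r *\<^sub>R b) has_derivative (\<lambda>h. h *\<^sub>R a)) (at s)"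
          by (auto intro!: derivative_eq_intros)
        from has_derivative_compose[OF this D] linear_scale[OF has_derivative_linear[OF D]]
        show ?thesis by (simp add: has_field_derivative_def mult_commute_abs)
      qed
      show ?thesis unfolding g_def using *[of t] *[of 0] t by (intro DERIV_diff) (auto simp del: scaleR_zero_left)
    qed
    from MVT2[OF t this] obtain s where s: "0 < s" "s < t" and
      gs: "g t - g 0 = (t - 0) * (f' (p + s *\<^sub>R a + t *\<^sub>R b) a - f' (p + s *\<^sub>R a + 0 *\<^sub>R b) a)" by blast
    have "((\<lambda>r. f' (p + s *\<^sub>R a + r *\<^sub>R b) a) has_real_derivative fa (p + s *\<^sub>R a + r *\<^sub>R b) b) (at r)"
      if "0 \<le> r" "r \<le> t" for r
    proof -
      have D: "((\<lambda>x. f' x a) has_derivative fa (p + s *\<^sub>R a + r *\<^sub>R b)) (at (p + s *\<^sub>R a + r *\<^sub>R b))"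
        using fa inS[of s r] sub s that by (meson less_imp_le subsetD)
      have "((\<lambda>r. p + s *\<^sub>R a + r *\<^sub>R b) has_derivative (\<lambda>h. h *\<^sub>R b)) (at r)"
        by (auto intro!: derivative_eq_intros)
      from has_derivative_compose[OF this D] linear_scale[OF has_derivative_linear[OF D]]
      show ?thesis by (simp add: has_field_derivative_def mult_commute_abs)
    qed
    from MVT2[OF t this] obtain r where r: "0 < r" "r < t" and
      fr: "f' (p + s *\<^sub>R a + t *\<^sub>R b) a - f' (p + s *\<^sub>R a + 0 *\<^sub>R b) a = (t - 0) * fa (p + s *\<^sub>R a + r *\<^sub>R b) b" by blast
    show ?thesis
    proof (intro exI conjI)
      show "dist (p + s *\<^sub>R a + r *\<^sub>R b) p \<le> t * (norm a + norm b)"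
        using inS[of s r] s r by (simp add: dist_commute)
      show "f (p + t *\<^sub>R a + t *\<^sub>R b) - f (p + t *\<^sub>R a) - f (p + t *\<^sub>R b) + f p = t\<^sup>2 * fa (p + s *\<^sub>R a + r *\<^sub>R b) b"
        using gs fr by (simp add: g_def power2_eq_square)
    qed
  qed
  let ?N = "norm a + norm b"
  have "\<bar>fa p b - fb p a\<bar> \<le> e" if e: "e > 0" for e
  proof -
    have "isCont (\<lambda>x. fa x b) p" "isCont (\<lambda>x. fb x a) p"
      using ca cb S p by (auto simp: continuous_on_eq_continuous_at)
    then obtain d1 d2 where d: "d1 > 0" "d2 > 0" "\<And>x. dist x p < d1 \<Longrightarrow> \<bar>fa x b - fa p b\<bar> < e/2"
      "\<And>x. dist x p < d2 \<Longrightarrow> \<bar>fb x a - fb p a\<bar> < e/2"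
      using e unfolding continuous_at_eps_delta dist_real_def by (metis half_gt_zero)
    obtain d3 where d3: "d3 > 0" "cball p d3 \<subseteq> S" using S p open_contains_cball by blast
    define t where "t = min (min d1 d2) d3 / (2 * (?N + 1))"
    have N: "?N + 1 > 0" by (simp add: add_nonneg_pos)
    have t: "t > 0" using d d3 N by (simp add: t_def)
    have "t * ?N \<le> t * (?N + 1)" using t by simp
    also have "\<dots> = min (min d1 d2) d3 / 2"
      unfolding t_def using N by (simp add: field_simps)
    also have "\<dots> < min (min d1 d2) d3"
    proof -
      have "0 < min (min d1 d2) d3" using d d3 by simp
      then show ?thesis by linarith
    qed
    finally have tN: "t * ?N < d1" "t * ?N < d2" "t * ?N < d3" by auto
    have sub: "cball p (t * ?N) \<subseteq> S" using tN d3 by force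
    then have sub': "cball p (t * (norm b + norm a)) \<subseteq> S" by (simp add: add.commute)
    obtain x where x: "dist x p \<le> t * ?N"
      "f (p + t *\<^sub>R a + t *\<^sub>R b) - f (p + t *\<^sub>R a) - f (p + t *\<^sub>R b) + f p = t\<^sup>2 * fa x b"
      using key[OF t sub fa] by blast
    obtain y where y: "dist y p \<le> t * (norm b + norm a)"
      "f (p + t *\<^sub>R b + t *\<^sub>R a) - f (p + t *\<^sub>R b) - f (p + t *\<^sub>R a) + f p = t\<^sup>2 * fb y a"
      using key[OF t sub' fb] by blast
    have "t\<^sup>2 * fa x b = t\<^sup>2 * fb y a" using x(2) y(2) by (simp add: algebra_simps)
    then have "fa x b = fb y a" using t by simp
    moreover have "\<bar>fa x b - fa p b\<bar> < e/2" "\<bar>fb y a - fb p a\<bar> < e/2"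
      using d x(1) y(1) tN by (auto simp: add.commute)
    ultimately show ?thesis by linarith
  qed
  then have "\<bar>fa p b - fb p a\<bar> \<le> 0" by (metis field_le_epsilon add_0)
  then show ?thesis by simp
qed

lemma mixed_derivatives_commute:
  fixes f :: "'e::euclidean_space \<Rightarrow> 'b::euclidean_space"
  assumes S: "open S" "p \<in> S" and f: "C_k_on 2 f S"
  shows "frechet_derivative (\<lambda>x. frechet_derivative f (at x) a) (at p) b
       = frechet_derivative (\<lambda>x. frechet_derivative f (at x) b) (at p) a"
proof (rule euclidean_eqI)
  fix w :: 'b
  have f': "(f has_derivative frechet_derivative f (at x)) (at x)" if "x \<in> S" for x
    using f that frechet_derivative_works by (auto simp: numeral_2_eq_2)
  note D = C1_on_has_derivative[OF C_2_onD[OF f]]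
  note I = bounded_linear.has_derivative[OF bounded_linear_inner_left]
  note C = continuous_on_inner[OF C1_on_continuous_derivative[OF C_2_onD[OF f]] continuous_on_const]
  show "frechet_derivative (\<lambda>x. frechet_derivative f (at x) a) (at p) b \<bullet> w
       = frechet_derivative (\<lambda>x. frechet_derivative f (at x) b) (at p) a \<bullet> w"
    by (rule mixed_derivatives_commute_real[OF S, of "\<lambda>x. f x \<bullet> w" "\<lambda>x v. frechet_derivative f (at x) v \<bullet> w"])
      (intro I D C f'; assumption)+
qed


section \<open>Geometry of an immersed patch\<close>

text \<open>
  The definite description in \<open>normal_part\<close> is the orthogonal projection: existence comes from the
  orthogonal decomposition, uniqueness from \<open>W \<inter> W\<^sup>\<bottom> = 0\<close>.
\<close>

lemma normal_part_decomposition: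
  assumes "subspace W"
  shows "normal_part W v \<in> W\<^sup>\<bottom>" "v - normal_part W v \<in> W"
proof -
  obtain y z where yz: "y \<in> span W" "\<And>w. w \<in> span W \<Longrightarrow> orthogonal z w" "v = y + z"
    using orthogonal_subspace_decomp_exists by metis
  have W: "span W = W" using assms by (simp add: span_eq_iff)
  have "\<exists>!n. n \<in> W\<^sup>\<bottom> \<and> v - n \<in> W"
  proof (rule ex1I[of _ z])
    show "z \<in> W\<^sup>\<bottom> \<and> v - z \<in> W"
      using yz W by (auto simp: orthogonal_comp_def orthogonal_commute)
    fix n assume n: "n \<in> W\<^sup>\<bottom> \<and> v - n \<in> W"
    have "n - z \<in> W\<^sup>\<bottom>"
      using n yz W by (intro subspace_diff subspace_orthogonal_comp) (auto simp: orthogonal_comp_def orthogonal_commute)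
    moreover have "n - z \<in> W"
      using subspace_diff[OF assms, of y "v - n"] yz W n by (simp add: algebra_simps)
    ultimately show "n = z" by (auto simp: orthogonal_comp_def orthogonal_def)
  qed
  from theI'[OF this] show "normal_part W v \<in> W\<^sup>\<bottom>" "v - normal_part W v \<in> W"
    unfolding normal_part_def by auto
qed

lemma inner_normal_part:
  assumes "subspace W" "N \<in> W\<^sup>\<bottom>" shows "normal_part W v \<bullet> N = v \<bullet> N"
proof -
  have "(v - normal_part W v) \<bullet> N = 0"
    using normal_part_decomposition(2)[OF assms(1)] assms(2)
    by (auto simp: orthogonal_comp_def orthogonal_def)
  then show ?thesis by (simp add: inner_diff_left)
qed

text \<open>
  Along the segment from the identity to \<open>G\<close> all matrices are positive definite, hence the determinant,
  which starts at 1, cannot vanish.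
\<close>

lemma det_pos_of_pos_def:
  fixes G :: "real^'m::finite^'m"
  assumes "\<And>x. x \<noteq> 0 \<Longrightarrow> 0 < x \<bullet> (G *v x)"
  shows "0 < det G"
proof (rule ccontr)
  assume "\<not> 0 < det G"
  define M where "M t = (1 - t) *\<^sub>R mat 1 + t *\<^sub>R G" for t
  have "continuous_on {0..1} (\<lambda>t. det (M t))"
    unfolding M_def det_def by (intro continuous_intros)
  moreover have "det (M 1) \<le> 0" "0 \<le> det (M 0)" using \<open>\<not> 0 < det G\<close> by (auto simp: M_def)
  ultimately obtain t where t: "0 \<le> t" "t \<le> 1" "det (M t) = 0"
    using IVT2'[of "\<lambda>t. det (M t)" 1 0 0] by auto
  then obtain x where x: "x \<noteq> 0" "M t *v x = 0"
    by (metis invertible_det_nz matrix_left_invertible_ker invertible_left_inverse)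
  have "0 = x \<bullet> (M t *v x)" using x by simp
  also have "\<dots> = (1 - t) * (x \<bullet> x) + t * (x \<bullet> (G *v x))"
    by (simp add: M_def matrix_vector_mult_add_rdistrib scaleR_matrix_vector_assoc[symmetric] inner_add_right)
  also have "\<dots> > 0"
  proof (cases "t = 0")
    case False
    then show ?thesis using t x assms[OF x(1)] by (intro add_nonneg_pos) auto
  qed (use x in auto)
  finally show False by simp
qed

lemma matrix_inv_inverse:
  fixes G :: "real^'m::finite^'m" assumes "det G \<noteq> 0"
  shows "G ** matrix_inv G = mat 1" "matrix_inv G ** G = mat 1"
proof -
  have "\<exists>B. G ** B = mat 1 \<and> B ** G = mat 1"
    using assms by (simp add: invertible_det_nz[symmetric] invertible_def)
  from someI_ex[OF this] show "G ** matrix_inv G = mat 1" "matrix_inv G ** G = mat 1"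
    unfolding matrix_inv_def by auto
qed

text \<open>
  Cramer's rule exhibits the entries of the inverse as quotients of polynomials in the entries of \<open>G\<close>;
  this is how the inverse metric inherits its differentiability.
\<close>

lemma matrix_inv_nth:
  fixes G :: "real^'m::finite^'m" assumes "det G \<noteq> 0"
  shows "matrix_inv G $ k $ l = det (\<chi> i j. if j = k then axis l 1 $ i else G $ i $ j) / det G"
proof -
  have "G *v (matrix_inv G *v axis l 1) = axis l 1"
    using matrix_inv_inverse[OF assms] by (simp add: matrix_vector_mul_assoc)
  then have "matrix_inv G *v axis l 1 = (\<chi> k. det (\<chi> i j. if j = k then axis l 1 $ i else G $ i $ j) / det G)"
    using cramer[OF assms] by blast
  then show ?thesis
    by (simp add: vec_eq_iff matrix_vector_mul_component inner_axis)
qed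

lemma linear_partial_deriv:
  fixes h :: "real^'m::finite \<Rightarrow> 'b::real_normed_vector"
  assumes "h differentiable (at p)"
  shows "frechet_derivative h (at p) v = (\<Sum>i\<in>UNIV. v $ i *\<^sub>R partial_deriv i h p)"
proof -
  have l: "linear (frechet_derivative h (at p))" using assms by (rule linear_frechet_derivative)
  have "v = (\<Sum>i\<in>UNIV. v $ i *\<^sub>R axis i 1)"
    by (simp add: vec_eq_iff axis_def if_distrib cong: if_cong)
  then have "frechet_derivative h (at p) v = frechet_derivative h (at p) (\<Sum>i\<in>UNIV. v $ i *\<^sub>R axis i 1)" by simp
  then show ?thesis by (simp only: linear_sum[OF l] linear_scale[OF l] partial_deriv_def)
qed

lemma partial_deriv_bilinear:
  assumes B: "bounded_bilinear B" and "a differentiable (at p)" "b differentiable (at p)"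
  shows "partial_deriv i (\<lambda>q. B (a q) (b q)) p = B (a p) (partial_deriv i b p) + B (partial_deriv i a p) (b p)"
  using bounded_bilinear.FDERIV[OF B assms(2,3)[unfolded frechet_derivative_works], THEN frechet_derivative_at]
  unfolding partial_deriv_def by metis

lemmas partial_deriv_scaleR = partial_deriv_bilinear[OF bounded_bilinear_scaleR]
lemmas partial_deriv_mult = partial_deriv_bilinear[OF bounded_bilinear_mult]
lemmas partial_deriv_inner = partial_deriv_bilinear[OF bounded_bilinear_inner]

lemma partial_deriv_sum:
  assumes "\<And>k. k \<in> I \<Longrightarrow> a k differentiable (at p)"
  shows "partial_deriv i (\<lambda>q. \<Sum>k\<in>I. a k q) p = (\<Sum>k\<in>I. partial_deriv i (a k) p)"
proof -
  have "((\<lambda>q. \<Sum>k\<in>I. a k q) has_derivative (\<lambda>v. \<Sum>k\<in>I. frechet_derivative (a k) (at p) v)) (at p)"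
    by (intro has_derivative_sum) (use assms frechet_derivative_works in blast)
  from frechet_derivative_at[OF this, symmetric] show ?thesis
    unfolding partial_deriv_def by simp
qed

lemma partial_deriv_inner_const:
  assumes "a differentiable (at p)"
  shows "partial_deriv i (\<lambda>q. a q \<bullet> c) p = partial_deriv i a p \<bullet> c"
  using has_derivative_inner_left[OF assms[unfolded frechet_derivative_works], of c, THEN frechet_derivative_at]
  unfolding partial_deriv_def by metis

lemma C1_on_differentiable: "C1_on f S \<Longrightarrow> x \<in> S \<Longrightarrow> f differentiable (at x)"
  by (simp add: C1_on_iff)

lemma half_inverse_sqrt:
  fixes d s :: real assumes "0 < d" shows "2 * s * d * (inverse (sqrt d) / 2) = sqrt d * s"
proof -
  define r where "r = sqrt d"
  have "d = r * r" "r \<noteq> 0" using assms by (auto simp: r_def)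
  then show ?thesis unfolding r_def[symmetric] by simp
qed

locale immersed_patch =
  fixes \<phi> :: "real^'m::finite \<Rightarrow> 'e::euclidean_space" and \<Omega> :: "(real^'m) set"
  assumes open_patch: "open \<Omega>" and C2: "C_k_on 2 \<phi> \<Omega>"
    and immersive: "\<And>p. p \<in> \<Omega> \<Longrightarrow> inj (frechet_derivative \<phi> (at p))"
begin

abbreviation "g \<equiv> induced_metric \<phi>"
abbreviation "J p \<equiv> frechet_derivative \<phi> (at p)"

lemma C1_phi: "C1_on \<phi> \<Omega>"
  using C2 C1_on_continuous[OF C_2_onD[OF C2]] by (simp add: C1_on_iff numeral_2_eq_2)

lemma C1_partial: "C1_on (partial_deriv i \<phi>) \<Omega>"
  using C_2_onD[OF C2, of "axis i 1"] by (simp add: partial_deriv_def[abs_def])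

lemma J_sum: "p \<in> \<Omega> \<Longrightarrow> J p v = (\<Sum>i\<in>UNIV. v $ i *\<^sub>R partial_deriv i \<phi> p)"
  by (intro linear_partial_deriv C1_on_differentiable[OF C1_phi])

lemma linear_J: "p \<in> \<Omega> \<Longrightarrow> linear (J p)"
  by (intro linear_frechet_derivative C1_on_differentiable[OF C1_phi])

lemma metric_inner_eq:
  assumes p: "p \<in> \<Omega>" shows "metric_inner \<phi> p X Y = J p X \<bullet> J p Y"
proof -
  have "J p X \<bullet> J p Y = (\<Sum>i\<in>UNIV. \<Sum>j\<in>UNIV. X $ i * (Y $ j * (partial_deriv i \<phi> p \<bullet> partial_deriv j \<phi> p)))"
    unfolding J_sum[OF p] by (simp add: inner_sum_left) (simp add: inner_sum_right sum_distrib_left)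
  also have "\<dots> = metric_inner \<phi> p X Y"
    unfolding metric_inner_def inner_vec_def matrix_vector_mult_def induced_metric_def
    by (simp add: sum_distrib_left mult.commute mult.left_commute)
  finally show ?thesis by simp
qed

lemma metric_pos: "p \<in> \<Omega> \<Longrightarrow> x \<noteq> 0 \<Longrightarrow> 0 < x \<bullet> (g p *v x)"
  using metric_inner_eq[of p x x] immersive[of p] linear_J[of p]
  unfolding metric_inner_def by (auto simp: linear_injective_0)

lemma det_metric_pos: "p \<in> \<Omega> \<Longrightarrow> 0 < det (g p)"
  using det_pos_of_pos_def metric_pos by blast

lemma metric_inverse:
  assumes "p \<in> \<Omega>" shows "g p ** matrix_inv (g p) = mat 1" "matrix_inv (g p) ** g p = mat 1"
  using matrix_inv_inverse det_metric_pos[OF assms] by (metis less_numeral_extra(3))+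

lemma metric_sym: "transpose (g p) = g p"
  by (simp add: transpose_def induced_metric_def inner_commute vec_eq_iff)

lemma inverse_metric_sym:
  assumes "p \<in> \<Omega>" shows "matrix_inv (g p) $ i $ j = matrix_inv (g p) $ j $ i"
proof -
  let ?I = "matrix_inv (g p)"
  have "transpose ?I = transpose ?I ** (g p ** ?I)" by (simp add: metric_inverse assms)
  also have "\<dots> = transpose (g p ** ?I) ** ?I"
    by (simp add: matrix_transpose_mul metric_sym matrix_mul_assoc)
  also have "\<dots> = ?I" by (simp add: metric_inverse assms)
  finally have "transpose ?I $ j $ i = ?I $ j $ i" by simp
  then show ?thesis by (simp add: transpose_def)
qed

lemma C1_metric: "C1_on (\<lambda>p. g p $ i $ j) \<Omega>"
  by (simp add: induced_metric_def C1_on_inner C1_partial)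

lemma C1_det_metric: "C1_on (\<lambda>p. det (g p)) \<Omega>"
  by (intro C1_on_det C1_metric)

lemma C1_volume: "C1_on (\<lambda>p. sqrt (det (g p))) \<Omega>"
  by (intro C1_on_sqrt C1_det_metric det_metric_pos)

lemma C1_inverse_metric: "C1_on (\<lambda>p. matrix_inv (g p) $ k $ l) \<Omega>"
proof (rule C1_on_cong[OF open_patch])
  fix p assume "p \<in> \<Omega>"
  then have "det (g p) \<noteq> 0" using det_metric_pos by force
  then show "matrix_inv (g p) $ k $ l = det (\<chi> i j. if j = k then axis l 1 $ i else g p $ i $ j) / det (g p)"
    by (rule matrix_inv_nth)
next
  show "C1_on (\<lambda>p. det (\<chi> i j. if j = k then axis l 1 $ i else g p $ i $ j) / det (g p)) \<Omega>"
  proof (rule C1_on_divide[OF C1_on_det C1_det_metric])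
    show "C1_on (\<lambda>p. (\<chi> i j. if j = k then axis l 1 $ i else g p $ i $ j) $ i $ j) \<Omega>" for i j
      by (cases "j = k") (auto intro: C1_on_const C1_metric)
  qed (use det_metric_pos in force)
qed

lemma grad_nth: "grad \<phi> a p $ k = (\<Sum>j\<in>UNIV. matrix_inv (g p) $ k $ j * partial_deriv j a p)"
  by (simp add: grad_def matrix_vector_mult_def)

text \<open>
  The defining property of the gradient, read in the ambient space after pushing the coordinate vector
  forward by the differential of the immersion.
\<close>

lemma inner_grad:
  assumes p: "p \<in> \<Omega>" and a: "a differentiable (at p)"
  shows "J p (grad \<phi> a p) \<bullet> J p X = frechet_derivative a (at p) X"
proof -
  have "J p (grad \<phi> a p) \<bullet> J p X = X \<bullet> (g p *v grad \<phi> a p)"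
    using metric_inner_eq[OF p] by (simp add: metric_inner_def inner_commute)
  also have "g p *v grad \<phi> a p = (\<chi> j. partial_deriv j a p)"
    by (simp add: grad_def matrix_vector_mul_assoc metric_inverse p)
  also have "X \<bullet> \<dots> = frechet_derivative a (at p) X"
    by (simp add: linear_partial_deriv[OF a] inner_vec_def)
  finally show ?thesis .
qed

lemma C1_grad: "C_k_on 2 a \<Omega> \<Longrightarrow> C1_on (grad \<phi> a) \<Omega>"
  using C_2_onD[of a \<Omega>]
  by (intro C1_on_vec) (auto simp: grad_nth partial_deriv_def intro!: C1_on_sum C1_on_mult C1_inverse_metric)

lemma continuous_grad: "C1_on a \<Omega> \<Longrightarrow> continuous_on \<Omega> (grad \<phi> a)"
proof -
  assume a: "C1_on a \<Omega>"
  have "continuous_on \<Omega> (\<lambda>p. \<chi> k. \<Sum>j\<in>UNIV. matrix_inv (g p) $ k $ j * partial_deriv j a p)"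
    unfolding partial_deriv_def
    by (intro continuous_on_vec_lambda continuous_intros C1_on_continuous[OF C1_inverse_metric]
        C1_on_continuous_derivative a)
  moreover have "grad \<phi> a = (\<lambda>p. \<chi> k. \<Sum>j\<in>UNIV. matrix_inv (g p) $ k $ j * partial_deriv j a p)"
    by (simp add: fun_eq_iff vec_eq_iff grad_nth)
  ultimately show "continuous_on \<Omega> (grad \<phi> a)" by simp
qed

text \<open>
  The difference of the two vectors is tangent and orthogonal to all tangent vectors.
\<close>

lemma tangent_unique:
  assumes p: "p \<in> \<Omega>" and "v \<in> tangent_space \<phi> p" "w \<in> tangent_space \<phi> p"
    and "\<And>X. v \<bullet> J p X = w \<bullet> J p X"
  shows "v = w"
proof -
  have "v - w \<in> tangent_space \<phi> p"
    using assms linear_subspace_image[OF linear_J[OF p] subspace_UNIV]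
    by (auto simp: tangent_space_def intro: subspace_diff)
  then obtain X where "v - w = J p X" by (auto simp: tangent_space_def)
  then have "(v - w) \<bullet> (v - w) = 0" using assms(4)[of X] by (metis inner_diff_left right_minus_eq)
  then show ?thesis by simp
qed

lemma subspace_tangent: "p \<in> \<Omega> \<Longrightarrow> subspace (tangent_space \<phi> p)"
  using linear_subspace_image[OF linear_J subspace_UNIV] by (simp add: tangent_space_def)

text \<open>
  Jacobi's formula for the derivative of \<open>det g\<close>, with the derivatives of \<open>g\<^sub>i\<^sub>j\<close> expanded by the product rule
  and combined using the symmetry of the inverse metric.
\<close>

lemma partial_deriv_volume:
  assumes p: "p \<in> \<Omega>"
  shows "partial_deriv k (\<lambda>q. sqrt (det (g q))) p = sqrt (det (g p)) *
    (\<Sum>i\<in>UNIV. \<Sum>j\<in>UNIV. matrix_inv (g p) $ i $ j * (partial_deriv j \<phi> p \<bullet> partial_deriv k (partial_deriv i \<phi>) p))"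
proof -
  let ?I = "matrix_inv (g p)" and ?e = "axis k 1 :: real^'m"
  define C :: "real^'m^'m" where "C = (\<chi> i j. partial_deriv k (\<lambda>q. g q $ i $ j) p)"
  note dm = C1_on_has_derivative[OF C1_metric p]
  have D: "((\<lambda>q. det (g q)) has_derivative (\<lambda>v. \<Sum>k\<in>UNIV. det (\<chi> i j. if i = k then
      frechet_derivative (\<lambda>q. g q $ i $ j) (at p) v else g p $ i $ j))) (at p)"
    by (rule has_derivative_det[OF dm])
  have "((\<lambda>q. sqrt (det (g q))) has_derivative
    (\<lambda>v. frechet_derivative (\<lambda>q. det (g q)) (at p) v * (inverse (sqrt (det (g p))) / 2))) (at p)"
    using det_metric_pos[OF p] C1_on_has_derivative[OF C1_det_metric p]
    by (intro DERIV_compose_FDERIV[OF DERIV_real_sqrt])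
  then have "partial_deriv k (\<lambda>q. sqrt (det (g q))) p =
      partial_deriv k (\<lambda>q. det (g q)) p * (inverse (sqrt (det (g p))) / 2)"
    unfolding partial_deriv_def using frechet_derivative_at by metis
  also have "partial_deriv k (\<lambda>q. det (g q)) p = (\<Sum>l\<in>UNIV. det (\<chi> i j. if i = l then C $ i $ j else g p $ i $ j))"
    unfolding partial_deriv_def[of k "\<lambda>q. det (g q)"] frechet_derivative_at[OF D, symmetric] C_def
    by (simp add: partial_deriv_def cong: if_cong)
  also have "\<dots> = trace (C ** ?I) * det (g p)"
    by (rule det_replace_row) (simp add: matrix_mul_assoc[symmetric] metric_inverse p)
  also have "trace (C ** ?I) = 2 * (\<Sum>i\<in>UNIV. \<Sum>j\<in>UNIV. ?I $ i $ j * (partial_deriv j \<phi> p \<bullet> partial_deriv k (partial_deriv i \<phi>) p))"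
  proof -
    let ?a = "\<lambda>i j. ?I $ i $ j * (partial_deriv j \<phi> p \<bullet> partial_deriv k (partial_deriv i \<phi>) p)"
    have "C $ i $ j = partial_deriv i \<phi> p \<bullet> partial_deriv k (partial_deriv j \<phi>) p
       + partial_deriv k (partial_deriv i \<phi>) p \<bullet> partial_deriv j \<phi> p" for i j
      by (simp add: C_def induced_metric_def partial_deriv_inner C1_on_differentiable[OF C1_partial p])
    then have "C $ i $ j * ?I $ j $ i = ?a j i + ?a i j" for i j
      by (simp add: distrib_right inner_commute[of "partial_deriv j \<phi> p"] inverse_metric_sym[OF p, of j i])
    then have "trace (C ** ?I) = (\<Sum>i\<in>UNIV. \<Sum>j\<in>UNIV. ?a j i + ?a i j)"
      by (simp add: trace_def matrix_matrix_mult_def)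
    also have "\<dots> = 2 * (\<Sum>i\<in>UNIV. \<Sum>j\<in>UNIV. ?a i j)"
      by (simp add: sum.distrib) (rule sum.swap)
    finally show ?thesis .
  qed
  finally have E: "partial_deriv k (\<lambda>q. sqrt (det (g q))) p = 2 *
    (\<Sum>i\<in>UNIV. \<Sum>j\<in>UNIV. ?I $ i $ j * (partial_deriv j \<phi> p \<bullet> partial_deriv k (partial_deriv i \<phi>) p))
    * det (g p) * (inverse (sqrt (det (g p))) / 2)" .
  show ?thesis unfolding E by (rule half_inverse_sqrt[OF det_metric_pos[OF p]])
qed

text \<open>
  The density of \<open>e\<^sup>-\<^sup>h dV\<close> in coordinates, where \<open>h = \<langle>\<phi>, T\<rangle>\<close>.
\<close>

definition weight :: "'e \<Rightarrow> real^'m \<Rightarrow> real" where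
  "weight T q = sqrt (det (g q)) * exp (- (\<phi> q \<bullet> T))"

lemma C2_height: "C_k_on 2 (\<lambda>q. \<phi> q \<bullet> T) \<Omega>"
proof -
  have D: "frechet_derivative (\<lambda>q. \<phi> q \<bullet> T) (at q) v = J q v \<bullet> T" if "q \<in> \<Omega>" for q v
    using has_derivative_inner_left[OF C1_on_has_derivative[OF C1_phi that], THEN frechet_derivative_at] by metis
  have "C1_on (\<lambda>q. frechet_derivative (\<lambda>q. \<phi> q \<bullet> T) (at q) v) \<Omega>" for v
    by (rule C1_on_cong[OF open_patch D]) (auto intro: C1_on_inner C_2_onD[OF C2] C1_on_const)
  moreover have "C1_on (\<lambda>q. \<phi> q \<bullet> T) \<Omega>" by (intro C1_on_inner C1_phi C1_on_const)
  ultimately show ?thesis by (simp add: numeral_2_eq_2 C1_on_def)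
qed

lemma C1_weight: "C1_on (weight T) \<Omega>"
proof -
  have "C1_on (\<lambda>q. sqrt (det (g q)) * exp ((-1) * (\<phi> q \<bullet> T))) \<Omega>"
    by (intro C1_on_mult C1_volume C1_on_exp C1_on_inner C1_phi C1_on_const)
  then show ?thesis by (simp add: weight_def[abs_def])
qed

lemma weight_pos: "p \<in> \<Omega> \<Longrightarrow> 0 < weight T p"
  by (simp add: weight_def det_metric_pos)

text \<open>
  The drift term of the Laplacian is exactly what differentiating the factor \<open>e\<^sup>-\<^sup>h\<close> produces, since
  \<open>f = 2 \<langle>\<cdot>, T\<rangle>\<close> and \<open>h\<close> is half of it.
\<close>

lemma weighted_divergence:
  assumes p: "p \<in> \<Omega>" and a: "C_k_on 2 a \<Omega>" and f: "\<And>z. f z = 2 * (z \<bullet> T)"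
  shows "(\<Sum>i\<in>UNIV. partial_deriv i (\<lambda>q. weight T q * grad \<phi> a q $ i) p) = weight T p * drift_laplacian \<phi> f a p"
proof -
  let ?s = "\<lambda>q. sqrt (det (g q))" and ?h = "\<lambda>q. \<phi> q \<bullet> T" and ?E = "exp (- (\<phi> p \<bullet> T))"
  have dh: "?h differentiable (at p)"
    by (intro C1_on_differentiable[OF _ p] C1_on_inner C1_phi C1_on_const)
  have dsG: "(\<lambda>q. ?s q * grad \<phi> a q $ i) differentiable (at p)" for i
    by (intro C1_on_differentiable[OF _ p] C1_on_mult C1_volume C1_on_vec_nth C1_grad a)
  have E: "((\<lambda>q. exp (- ?h q)) has_derivative (\<lambda>v. - ?E * frechet_derivative ?h (at p) v)) (at p)"
  proof -
    have "((\<lambda>q. exp (- k q)) has_derivative (\<lambda>v. - exp (- k p) * k' v)) (at p)"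
      if "(k has_derivative k') (at p)" for k :: "real^'m \<Rightarrow> real" and k'
      using that by (auto intro!: derivative_eq_intros)
    then show ?thesis using dh[unfolded frechet_derivative_works] by blast
  qed
  have "partial_deriv i (\<lambda>q. weight T q * grad \<phi> a q $ i) p
      = ?E * (partial_deriv i (\<lambda>q. ?s q * grad \<phi> a q $ i) p - ?s p * (grad \<phi> a p $ i * partial_deriv i ?h p))" for i
  proof -
    have "partial_deriv i (\<lambda>q. weight T q * grad \<phi> a q $ i) p
       = partial_deriv i (\<lambda>q. exp (- ?h q) * (?s q * grad \<phi> a q $ i)) p"
      by (simp add: weight_def mult_ac)
    also have "\<dots> = ?E * partial_deriv i (\<lambda>q. ?s q * grad \<phi> a q $ i) p
        + partial_deriv i (\<lambda>q. exp (- ?h q)) p * (?s p * grad \<phi> a p $ i)"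
      using E by (intro partial_deriv_mult dsG) (auto simp: differentiable_def)
    also have "partial_deriv i (\<lambda>q. exp (- ?h q)) p = - ?E * partial_deriv i ?h p"
      unfolding partial_deriv_def frechet_derivative_at[OF E, symmetric] ..
    finally show ?thesis by (simp add: algebra_simps)
  qed
  then have "(\<Sum>i\<in>UNIV. partial_deriv i (\<lambda>q. weight T q * grad \<phi> a q $ i) p)
     = ?E * ((\<Sum>i\<in>UNIV. partial_deriv i (\<lambda>q. ?s q * grad \<phi> a q $ i) p)
         - ?s p * (\<Sum>i\<in>UNIV. grad \<phi> a p $ i * partial_deriv i ?h p))"
    by (simp only: sum_distrib_left sum_subtractf[symmetric])
  also have "(\<Sum>i\<in>UNIV. partial_deriv i (\<lambda>q. ?s q * grad \<phi> a q $ i) p) = ?s p * laplace_beltrami \<phi> a p"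
    using det_metric_pos[OF p] by (simp add: laplace_beltrami_def divergence_def)
  also have "(\<Sum>i\<in>UNIV. grad \<phi> a p $ i * partial_deriv i ?h p) = 1/2 * metric_inner \<phi> p (grad \<phi> (f \<circ> \<phi>) p) (grad \<phi> a p)"
  proof -
    have fphi: "f \<circ> \<phi> = (\<lambda>q. \<phi> q \<bullet> (2 *\<^sub>R T))" by (simp add: fun_eq_iff f)
    have d: "(\<lambda>q. \<phi> q \<bullet> (2 *\<^sub>R T)) differentiable (at p)"
      by (intro C1_on_differentiable[OF _ p] C1_on_inner C1_phi C1_on_const)
    have "partial_deriv i (\<lambda>q. \<phi> q \<bullet> (2 *\<^sub>R T)) p = 2 * partial_deriv i ?h p" for i
      by (subst (1 2) partial_deriv_inner_const) (auto intro: C1_on_differentiable[OF C1_phi p])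
    then show ?thesis
      unfolding metric_inner_eq[OF p] fphi inner_grad[OF p d] linear_partial_deriv[OF d]
      by (simp add: sum_distrib_left)
  qed
  finally show ?thesis by (simp add: weight_def drift_laplacian_def algebra_simps)
qed

text \<open>
  The vector-valued Laplacian of the immersion is normal, by the formula for the derivative of the volume
  density, and its normal part is the mean curvature vector.  Hence \<open>\<Delta>h = \<langle>H, T\<rangle> = - |N|\<^sup>2\<close> with \<open>N\<close> the normal part
  of \<open>T\<close>, while \<open>|\<nabla>h|\<^sup>2\<close> is the squared length of the tangential part.  The two add up to \<open>|T|\<^sup>2 = 1\<close>.
\<close>

lemma drift_laplacian_height:
  assumes p: "p \<in> \<Omega>" and f: "\<And>z. f z = 2 * (z \<bullet> T)" and T: "norm T = 1"
    and soliton: "mean_curvature \<phi> p + normal_part (tangent_space \<phi> p) T = 0"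
  shows "drift_laplacian \<phi> f (\<lambda>q. \<phi> q \<bullet> T) p = -1"
proof -
  let ?s = "\<lambda>q. sqrt (det (g q))" and ?h = "\<lambda>q. \<phi> q \<bullet> T" and ?I = "\<lambda>q. matrix_inv (g q)"
  let ?W = "tangent_space \<phi> p"
  define N where "N = normal_part ?W T"
  note W = subspace_tangent[OF p]
  have N: "N \<in> ?W\<^sup>\<bottom>" "T - N \<in> ?W" unfolding N_def using normal_part_decomposition[OF W] by auto
  have Nperp: "J p X \<bullet> N = 0" for X
    using N(1) by (auto simp: orthogonal_comp_def orthogonal_def tangent_space_def)
  have Nd: "partial_deriv j \<phi> p \<bullet> N = 0" for j by (simp add: partial_deriv_def Nperp)
  have sp: "?s p > 0" using det_metric_pos[OF p] by simp
  \<comment> \<open>the vector fields whose coordinate divergence is the density times the vector-valued Laplacian of the immersion\<close>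
  define Y where "Y i q = (\<Sum>j\<in>UNIV. (?s q * ?I q $ i $ j) *\<^sub>R partial_deriv j \<phi> q)" for i q
  define Z where "Z = (\<Sum>i\<in>UNIV. partial_deriv i (Y i) p)"
  have C1sI: "C1_on (\<lambda>q. ?s q * ?I q $ i $ j) \<Omega>" for i j
    by (intro C1_on_mult C1_volume C1_inverse_metric)
  have C1Y: "C1_on (Y i) \<Omega>" for i
    unfolding Y_def by (intro C1_on_sum C1_on_scaleR C1sI C1_partial)
  have sgrad: "?s q * grad \<phi> ?h q $ i = Y i q \<bullet> T" if "q \<in> \<Omega>" for q i
    by (simp add: grad_nth Y_def inner_sum_left sum_distrib_left mult_ac
        partial_deriv_inner_const C1_on_differentiable[OF C1_phi that])
  have lap: "laplace_beltrami \<phi> ?h p = (Z \<bullet> T) / ?s p"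
  proof -
    have "partial_deriv i (\<lambda>q. ?s q * grad \<phi> ?h q $ i) p = partial_deriv i (Y i) p \<bullet> T" for i
    proof -
      have "partial_deriv i (\<lambda>q. ?s q * grad \<phi> ?h q $ i) p = partial_deriv i (\<lambda>q. Y i q \<bullet> T) p"
        unfolding partial_deriv_def by (subst frechet_derivative_cong_open[OF open_patch p sgrad]) auto
      then show ?thesis by (simp add: partial_deriv_inner_const C1_on_differentiable[OF C1Y p])
    qed
    then show ?thesis by (simp add: laplace_beltrami_def divergence_def Z_def inner_sum_left)
  qed
  have dY: "partial_deriv i (Y i) p = (\<Sum>j\<in>UNIV. (?s p * ?I p $ i $ j) *\<^sub>R partial_deriv i (partial_deriv j \<phi>) p
      + partial_deriv i (\<lambda>q. ?s q * ?I q $ i $ j) p *\<^sub>R partial_deriv j \<phi> p)" for i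
  proof -
    have "partial_deriv i (Y i) p = (\<Sum>j\<in>UNIV. partial_deriv i (\<lambda>q. (?s q * ?I q $ i $ j) *\<^sub>R partial_deriv j \<phi> q) p)"
      unfolding Y_def
      by (rule partial_deriv_sum) (intro C1_on_differentiable[OF _ p] C1_on_scaleR C1sI C1_partial)
    then show ?thesis
      by (simp add: partial_deriv_scaleR C1_on_differentiable[OF C1sI p] C1_on_differentiable[OF C1_partial p])
  qed
  \<comment> \<open>against a normal vector only the second derivatives of the immersion survive, and they give the mean curvature\<close>
  have ZN: "Z \<bullet> N = - ?s p * (N \<bullet> N)"
  proof -
    have "Z \<bullet> N = (\<Sum>i\<in>UNIV. \<Sum>j\<in>UNIV. ?s p * (?I p $ i $ j * (partial_deriv i (partial_deriv j \<phi>) p \<bullet> N)))"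
      by (simp add: Z_def dY inner_sum_left inner_add_left Nd mult.assoc)
    also have "\<dots> = ?s p * (mean_curvature \<phi> p \<bullet> N)"
      by (simp add: mean_curvature_def second_fundamental_form_def inner_sum_left sum_distrib_left
          inner_normal_part[OF W N(1)])
    also have "mean_curvature \<phi> p = - N" using soliton by (simp add: N_def add_eq_0_iff2)
    finally show ?thesis by simp
  qed
  \<comment> \<open>differentiate the identity \<open>Y\<^sub>i \<bullet> \<partial>\<^sub>k\<phi> = \<delta>\<^sub>i\<^sub>k sqrt (det g)\<close>; what is left cancels by the derivative of the density\<close>
  have Zk: "Z \<bullet> partial_deriv k \<phi> p = 0" for k
  proof -
    have Yk: "Y i q \<bullet> partial_deriv k \<phi> q = (if i = k then ?s q else 0)" if "q \<in> \<Omega>" for i q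
    proof -
      have "Y i q \<bullet> partial_deriv k \<phi> q = ?s q * (?I q ** g q) $ i $ k"
        by (simp add: Y_def inner_sum_left matrix_matrix_mult_def induced_metric_def[of _ q] sum_distrib_left mult_ac)
      then show ?thesis using that by (simp add: metric_inverse mat_def)
    qed
    have "partial_deriv i (Y i) p \<bullet> partial_deriv k \<phi> p
       = (if i = k then partial_deriv k ?s p else 0) - Y i p \<bullet> partial_deriv i (partial_deriv k \<phi>) p" for i
    proof -
      have "partial_deriv i (\<lambda>q. Y i q \<bullet> partial_deriv k \<phi> q) p = partial_deriv i (\<lambda>q. if i = k then ?s q else 0) p"
        unfolding partial_deriv_def[of i] by (subst frechet_derivative_cong_open[OF open_patch p Yk]) auto
      moreover have "partial_deriv i (\<lambda>q. Y i q \<bullet> partial_deriv k \<phi> q) p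
        = Y i p \<bullet> partial_deriv i (partial_deriv k \<phi>) p + partial_deriv i (Y i) p \<bullet> partial_deriv k \<phi> p"
        by (intro partial_deriv_inner C1_on_differentiable[OF C1Y p] C1_on_differentiable[OF C1_partial p])
      moreover have "partial_deriv i (\<lambda>q. if i = k then ?s q else 0) p = (if i = k then partial_deriv k ?s p else 0)"
        by (simp add: partial_deriv_def)
      ultimately show ?thesis by linarith
    qed
    then have "Z \<bullet> partial_deriv k \<phi> p = partial_deriv k ?s p - (\<Sum>i\<in>UNIV. Y i p \<bullet> partial_deriv i (partial_deriv k \<phi>) p)"
      by (simp add: Z_def inner_sum_left sum_subtractf)
    also have "(\<Sum>i\<in>UNIV. Y i p \<bullet> partial_deriv i (partial_deriv k \<phi>) p)
      = ?s p * (\<Sum>i\<in>UNIV. \<Sum>j\<in>UNIV. ?I p $ i $ j * (partial_deriv j \<phi> p \<bullet> partial_deriv k (partial_deriv i \<phi>) p))"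
    proof -
      have "partial_deriv i (partial_deriv k \<phi>) p = partial_deriv k (partial_deriv i \<phi>) p" for i
        using mixed_derivatives_commute[OF open_patch p C2] by (simp add: partial_deriv_def[abs_def])
      then show ?thesis by (simp add: Y_def inner_sum_left sum_distrib_left mult.assoc)
    qed
    finally show ?thesis by (simp add: partial_deriv_volume[OF p])
  qed
  obtain X where X: "T - N = J p X" using N(2) by (auto simp: tangent_space_def)
  have "Z \<bullet> (T - N) = 0" unfolding X J_sum[OF p] by (simp add: inner_sum_right Zk)
  then have "Z \<bullet> T = - ?s p * (N \<bullet> N)" using ZN by (simp add: inner_diff_right)
  then have L: "laplace_beltrami \<phi> ?h p = - (N \<bullet> N)" using lap sp by simp
  have G: "J p (grad \<phi> (\<lambda>q. \<phi> q \<bullet> c) p) \<bullet> J p Y = J p Y \<bullet> c" for c Y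
  proof -
    have d: "(\<lambda>q. \<phi> q \<bullet> c) differentiable (at p)"
      by (intro C1_on_differentiable[OF _ p] C1_on_inner C1_phi C1_on_const)
    have "frechet_derivative (\<lambda>q. \<phi> q \<bullet> c) (at p) Y = J p Y \<bullet> c"
      using has_derivative_inner_left[OF C1_on_has_derivative[OF C1_phi p], THEN frechet_derivative_at] by metis
    then show ?thesis using inner_grad[OF p d] by simp
  qed
  have fphi: "f \<circ> \<phi> = (\<lambda>q. \<phi> q \<bullet> (2 *\<^sub>R T))" by (simp add: fun_eq_iff f)
  have "J p (grad \<phi> ?h p) = T - N"
  proof (rule tangent_unique[OF p])
    show "J p (grad \<phi> ?h p) \<in> ?W" by (simp add: tangent_space_def)
    fix Y show "J p (grad \<phi> ?h p) \<bullet> J p Y = (T - N) \<bullet> J p Y"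
      using G[of T Y] Nperp[of Y] by (simp add: inner_diff_left inner_commute)
  qed (rule N(2))
  moreover have "metric_inner \<phi> p (grad \<phi> (f \<circ> \<phi>) p) (grad \<phi> ?h p) = 2 * (J p (grad \<phi> ?h p) \<bullet> T)"
    unfolding metric_inner_eq[OF p] fphi G by simp
  ultimately have "drift_laplacian \<phi> f ?h p = - (N \<bullet> N) - (T - N) \<bullet> T"
    using L by (simp add: drift_laplacian_def)
  moreover have "N \<bullet> N = T \<bullet> N"
    using Nperp[of X] X by (metis inner_diff_left right_minus_eq)
  ultimately show ?thesis using T by (simp add: inner_diff_left inner_commute[of N T] norm_eq_1)
qed

end


section \<open>Divergence inequality for Lipschitz weights\<close>

lemma integrable_continuous_compact:
  fixes f :: "'a::euclidean_space \<Rightarrow> real"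
  shows "compact K \<Longrightarrow> continuous_on K f \<Longrightarrow> f integrable_on K"
  using absolutely_integrable_continuous_compact absolutely_integrable_on_def by blast

text \<open>
  First order expansion of the determinant at the identity.  The error is controlled uniformly by the mean
  value theorem in \<open>t\<close>, because the \<open>t\<close>-derivative is jointly continuous on a compact set.
\<close>

lemma det_perturbation_uniform:
  fixes D :: "'x::metric_space \<Rightarrow> real^'m::finite^'m"
  assumes K: "compact K" and D: "\<And>i j. continuous_on K (\<lambda>x. D x $ i $ j)" and e: "0 < e"
  shows "\<exists>t1>0. t1 \<le> 1 \<and> (\<forall>t x. 0 < t \<longrightarrow> t < t1 \<longrightarrow> x \<in> K \<longrightarrow> \<bar>det (mat 1 + t *\<^sub>R D x) - 1 - t * trace (D x)\<bar> \<le> t * e)"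
proof -
  define \<psi> where "\<psi> = (\<lambda>(s, x). \<Sum>k\<in>UNIV. det (\<chi> i j. if i = k then D x $ i $ j else (mat 1 + s *\<^sub>R D x) $ i $ j))"
  have cD: "continuous_on ({0..1::real} \<times> K) (\<lambda>y. D (snd y) $ i $ j)" for i j
    by (rule continuous_on_compose2[OF D continuous_on_snd[OF continuous_on_id]]) auto
  have "continuous_on ({0..1::real} \<times> K) (\<lambda>y. if i = k then D (snd y) $ i $ j else (mat 1 + fst y *\<^sub>R D (snd y)) $ i $ j)" for i j k
    using cD by (cases "i = k") (simp_all add: continuous_on_add continuous_on_mult continuous_on_fst)
  then have "continuous_on ({0..1} \<times> K) \<psi>"
    unfolding \<psi>_def split_beta det_def vec_lambda_beta by (intro continuous_intros)
  then have "uniformly_continuous_on ({0..1} \<times> K) \<psi>"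
    by (intro compact_uniformly_continuous compact_Times K) auto
  then obtain d where d: "d > 0" "\<And>y z. y \<in> {0..1} \<times> K \<Longrightarrow> z \<in> {0..1} \<times> K \<Longrightarrow> dist z y < d \<Longrightarrow> dist (\<psi> z) (\<psi> y) < e"
    using e unfolding uniformly_continuous_on_def by metis
  have \<psi>0: "\<psi> (0, x) = trace (D x)" for x
    unfolding \<psi>_def prod.case scaleR_zero_left add_0_right
    using det_replace_row[of "D x" "mat 1" "D x"] by simp
  show ?thesis
  proof (intro exI[of _ "min d 1"] conjI allI impI)
    fix t x assume t: "0 < t" "t < min d 1" and x: "x \<in> K"
    have "((\<lambda>s. det (mat 1 + s *\<^sub>R D x)) has_real_derivative \<psi> (s, x)) (at s)" for s
    proof -
      have "((\<lambda>s. (mat 1 + s *\<^sub>R D x) $ i $ j) has_derivative (\<lambda>h. h * D x $ i $ j)) (at s)" for i j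
        by (auto intro!: derivative_eq_intros)
      from has_derivative_det[of "\<lambda>s. mat 1 + s *\<^sub>R D x", OF this]
      have "((\<lambda>s. det (mat 1 + s *\<^sub>R D x)) has_derivative
        (\<lambda>h. \<Sum>k\<in>UNIV. det (\<chi> i j. if i = k then h * D x $ i $ j else (mat 1 + s *\<^sub>R D x) $ i $ j))) (at s)" .
      moreover have "(\<Sum>k\<in>UNIV. det (\<chi> i j. if i = k then h * D x $ i $ j else (mat 1 + s *\<^sub>R D x) $ i $ j)) = \<psi> (s, x) * h" for h
      proof -
        have "det (\<chi> i j. if i = k then h * D x $ i $ j else (mat 1 + s *\<^sub>R D x) $ i $ j)
            = h * det (\<chi> i j. if i = k then D x $ i $ j else (mat 1 + s *\<^sub>R D x) $ i $ j)" for k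
        proof -
          have "(\<chi> i j. if i = k then h * D x $ i $ j else (mat 1 + s *\<^sub>R D x) $ i $ j)
             = (\<chi> i. if i = k then h *s (D x $ i) else (mat 1 + s *\<^sub>R D x) $ i)"
            "(\<chi> i j. if i = k then D x $ i $ j else (mat 1 + s *\<^sub>R D x) $ i $ j)
             = (\<chi> i. if i = k then D x $ i else (mat 1 + s *\<^sub>R D x) $ i)"
            by (auto simp: vec_eq_iff)
          then show ?thesis by (simp only: det_row_mul)
        qed
        then show ?thesis by (simp add: \<psi>_def sum_distrib_left mult.commute)
      qed
      ultimately show ?thesis by (simp add: has_field_derivative_def)
    qed
    from MVT2[OF t(1) this] obtain s where s: "0 < s" "s < t"
      "det (mat 1 + t *\<^sub>R D x) - det (mat 1 + 0 *\<^sub>R D x) = (t - 0) * \<psi> (s, x)" by blast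
    have "dist (\<psi> (s, x)) (\<psi> (0, x)) < e"
      using s t x by (intro d(2)) (auto simp: dist_Pair_Pair)
    then have "\<bar>t * (\<psi> (s, x) - \<psi> (0, x))\<bar> \<le> t * e"
      using t by (simp add: abs_mult dist_real_def)
    moreover have "det (mat 1 + t *\<^sub>R D x) - 1 - t * trace (D x) = t * (\<psi> (s, x) - \<psi> (0, x))"
      using s(3) by (simp add: \<psi>0 algebra_simps)
    ultimately show "\<bar>det (mat 1 + t *\<^sub>R D x) - 1 - t * trace (D x)\<bar> \<le> t * e" by simp
  qed (use d(1) in auto)
qed

lemma C1_compact_support_Lipschitz:
  fixes W :: "'e::euclidean_space \<Rightarrow> 'b::real_normed_vector"
  assumes K: "compact K" and W: "C1_on W UNIV" and supp: "\<And>x. x \<notin> K \<Longrightarrow> W x = 0"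
  obtains B where "0 < B" "\<And>x y. norm (W x - W y) \<le> B * norm (x - y)"
proof -
  have D: "(W has_derivative frechet_derivative W (at x)) (at x)" for x
    using C1_on_has_derivative[OF W] by simp
  have "bounded ((\<lambda>x. \<Sum>b\<in>Basis. norm (frechet_derivative W (at x) b)) ` K)"
    by (intro compact_imp_bounded compact_continuous_image K continuous_intros
        continuous_on_subset[OF C1_on_continuous_derivative[OF W]]) auto
  then obtain B where B: "B > 0" "\<And>x. x \<in> K \<Longrightarrow> (\<Sum>b\<in>Basis. norm (frechet_derivative W (at x) b)) \<le> B"
    unfolding bounded_pos by force
  have bnd: "norm (frechet_derivative W (at x) v) \<le> B * norm v" for x v
  proof (cases "x \<in> K")
    case True
    have "norm (frechet_derivative W (at x) v) \<le> (\<Sum>b\<in>Basis. norm ((v \<bullet> b) *\<^sub>R frechet_derivative W (at x) b))"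
      by (subst frechet_derivative_Basis_sum[OF C1_on_differentiable[OF W UNIV_I]]) (rule norm_sum)
    also have "\<dots> \<le> (\<Sum>b\<in>Basis. norm v * norm (frechet_derivative W (at x) b))"
      by (auto intro!: sum_mono mult_right_mono simp: Basis_le_norm)
    also have "\<dots> \<le> norm v * B"
      unfolding sum_distrib_left[symmetric] using B(2)[OF True] by (intro mult_left_mono) auto
    finally show ?thesis by (simp add: mult.commute)
  next
    case False
    have "frechet_derivative W (at x) = frechet_derivative (\<lambda>x. 0) (at x)"
      by (rule frechet_derivative_cong_open[of "- K"]) (use K False supp in \<open>auto simp: compact_imp_closed\<close>)
    then show ?thesis using B(1) by simp
  qed
  have "norm (W x - W y) \<le> B * norm (x - y)" for x y
    by (rule differentiable_bound[of UNIV W "\<lambda>x. frechet_derivative W (at x)"])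
      (use D bnd in \<open>auto intro: onorm_bound less_imp_le[OF B(1)] has_derivative_at_withinI\<close>)
  with B(1) show ?thesis by (rule that)
qed

text \<open>
  The divergence theorem, tested against a function \<open>\<eta>\<close> of which only one-sided difference quotients along \<open>W\<close>
  are controlled.  The map \<open>\<Phi> x = x + t W x\<close> is injective for small \<open>t\<close> and fixes the complement of \<open>K\<close>, so it maps
  \<open>K\<close> into itself, and since \<open>\<eta> \<ge> 0\<close> the change of variables formula gives
  \<open>\<integral>\<^sub>K (det D\<Phi>) (\<eta> \<circ> \<Phi>) \<le> \<integral>\<^sub>K \<eta>\<close>.  Expanding to first order in \<open>t\<close> and letting \<open>t\<close> tend to 0 yields the claim.
  In this form a Lipschitz cutoff can be used as it is, without smoothing it.
\<close>

lemma divergence_inequality: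
  fixes W :: "real^'m::finite \<Rightarrow> real^'m" and \<eta> M :: "real^'m \<Rightarrow> real"
  assumes K: "compact K" and W: "C1_on W UNIV" and supp: "\<And>x. x \<notin> K \<Longrightarrow> W x = 0"
    and \<eta>: "continuous_on K \<eta>" "\<And>x. x \<in> K \<Longrightarrow> 0 \<le> \<eta> x" and M: "continuous_on K M"
    and lip: "\<And>e. 0 < e \<Longrightarrow> \<exists>t0>0. \<forall>t x. 0 < t \<longrightarrow> t < t0 \<longrightarrow> x \<in> K \<longrightarrow> \<bar>\<eta> (x + t *\<^sub>R W x) - \<eta> x\<bar> \<le> t * (M x + e)"
  shows "integral K (\<lambda>x. \<eta> x * (\<Sum>i\<in>UNIV. partial_deriv i (\<lambda>q. W q $ i) x)) \<le> integral K M"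
proof -
  let ?D = "\<lambda>x. matrix (frechet_derivative W (at x))"
  let ?tr = "\<lambda>x. trace (?D x)"
  have D: "(W has_derivative frechet_derivative W (at x)) (at x)" for x
    using C1_on_has_derivative[OF W] by simp
  have cD: "continuous_on K (\<lambda>x. ?D x $ i $ j)" for i j
    unfolding matrix_def using continuous_on_subset[OF C1_on_continuous_derivative[OF W]]
    by (auto intro!: continuous_intros)
  have ctr: "continuous_on K ?tr" unfolding trace_def by (intro continuous_intros cD)
  have trace: "(\<Sum>i\<in>UNIV. partial_deriv i (\<lambda>q. W q $ i) x) = ?tr x" for x
  proof -
    have "frechet_derivative (\<lambda>q. W q $ i) (at x) = (\<lambda>v. frechet_derivative W (at x) v $ i)" for i
      using bounded_linear.has_derivative[OF bounded_linear_vec_nth D] frechet_derivative_at by metis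
    then show ?thesis by (simp add: trace_def matrix_def partial_deriv_def)
  qed
  obtain B where B: "0 < B" "\<And>x y. norm (W x - W y) \<le> B * norm (x - y)"
    using C1_compact_support_Lipschitz[OF K W supp] by blast
  have bdd: "\<exists>C>0. \<forall>x\<in>K. \<bar>f x\<bar> \<le> C" if "continuous_on K f" for f :: "real^'m \<Rightarrow> real"
    using compact_imp_bounded[OF compact_continuous_image[OF that K]] unfolding bounded_pos by force
  obtain C\<^sub>\<eta> where C\<eta>: "C\<^sub>\<eta> > 0" "\<And>x. x \<in> K \<Longrightarrow> \<bar>\<eta> x\<bar> \<le> C\<^sub>\<eta>" using bdd[OF \<eta>(1)] by blast
  obtain C\<^sub>t where Ct: "C\<^sub>t > 0" "\<And>x. x \<in> K \<Longrightarrow> \<bar>?tr x\<bar> \<le> C\<^sub>t" using bdd[OF ctr] by blast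
  obtain C\<^sub>M where CM: "C\<^sub>M > 0" "\<And>x. x \<in> K \<Longrightarrow> \<bar>M x\<bar> \<le> C\<^sub>M" using bdd[OF M] by blast
  note int = integrable_continuous_compact[OF K]
  define V where "V = integral K (\<lambda>x. 1::real)"
  have V: "V \<ge> 0" unfolding V_def by (intro integral_nonneg int) auto
  have main: "integral K (\<lambda>x. \<eta> x * ?tr x) - integral K M \<le> e * (V * (2 + C\<^sub>\<eta>))" if e: "e > 0" for e
  proof -
    obtain t0 where t0: "t0 > 0" "\<And>t x. 0 < t \<Longrightarrow> t < t0 \<Longrightarrow> x \<in> K \<Longrightarrow> \<bar>\<eta> (x + t *\<^sub>R W x) - \<eta> x\<bar> \<le> t * (M x + e)"
      using lip[OF e] by blast
    obtain t1 where t1: "t1 > 0" "\<And>t x. 0 < t \<Longrightarrow> t < t1 \<Longrightarrow> x \<in> K \<Longrightarrow> \<bar>det (mat 1 + t *\<^sub>R ?D x) - 1 - t * ?tr x\<bar> \<le> t * e"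
      using det_perturbation_uniform[OF K cD e] by blast
    \<comment> \<open>\<open>t < 1 / B\<close> makes the map injective; the last bound makes the product of the two first order errors smaller than \<open>t e\<close>\<close>
    define m where "m = min (min t0 t1) (min (1 / B) (e / (C\<^sub>t * (C\<^sub>M + e))))"
    define t where "t = m / 2"
    have "0 < m" using t0 t1 e Ct CM B by (simp add: m_def)
    then have "0 < t" "t < m" by (simp_all add: t_def)
    then have t: "0 < t" "t < t0" "t < t1" "t < 1 / B" "t < e / (C\<^sub>t * (C\<^sub>M + e))"
      by (simp_all add: m_def)
    have tB: "t * B < 1" using t B by (simp add: field_simps)
    have "0 < C\<^sub>t * (C\<^sub>M + e)" using e Ct CM by simp
    from pos_less_divide_eq[OF this] t(5) have tC: "t * (C\<^sub>t * (C\<^sub>M + e)) \<le> e" by (simp add: less_imp_le)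
    let ?\<Phi> = "\<lambda>x. x + t *\<^sub>R W x"
    have inj: "inj ?\<Phi>"
    proof (rule injI)
      fix x y assume "?\<Phi> x = ?\<Phi> y"
      then have xy: "x - y = - t *\<^sub>R (W x - W y)" by (simp add: algebra_simps)
      have "norm (x - y) = t * norm (W x - W y)" by (subst xy) (use t in simp)
      also have "\<dots> \<le> t * B * norm (x - y)" using B(2)[of x y] t by (simp add: mult.assoc)
      finally have "(1 - t * B) * norm (x - y) \<le> 0" by (simp add: algebra_simps)
      then have "norm (x - y) \<le> 0" using tB by (simp add: mult_le_0_iff)
      then show "x = y" by simp
    qed
    have \<Phi>K: "?\<Phi> x \<in> K" if "x \<in> K" for x
    proof (rule ccontr)
      assume n: "?\<Phi> x \<notin> K"
      then have "?\<Phi> x = x" by - (rule injD[OF inj], simp add: supp)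
      with n that show False by simp
    qed
    have c\<Phi>: "continuous_on K ?\<Phi>"
      by (intro continuous_intros continuous_on_subset[OF C1_on_continuous[OF W]]) auto
    have c\<eta>\<Phi>: "continuous_on K (\<lambda>x. \<eta> (?\<Phi> x))"
      by (rule continuous_on_compose2[OF \<eta>(1) c\<Phi>]) (use \<Phi>K in auto)
    have m: "matrix (\<lambda>v. v + t *\<^sub>R frechet_derivative W (at x) v) = mat 1 + t *\<^sub>R ?D x" for x
      by (simp add: vec_eq_iff matrix_def mat_def axis_def)
    have cdet: "continuous_on K (\<lambda>x. det (mat 1 + t *\<^sub>R ?D x))"
      unfolding det_def plus_vec_def scaleR_vec_def vec_lambda_beta by (intro continuous_intros cD)
    have "integral (?\<Phi> ` K) \<eta> = integral K (\<lambda>x. \<bar>det (matrix (\<lambda>v. v + t *\<^sub>R frechet_derivative W (at x) v))\<bar> * \<eta> (?\<Phi> x))"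
    proof (rule integral_change_of_variables_finite[OF K])
      show "(?\<Phi> has_derivative (\<lambda>v. v + t *\<^sub>R frechet_derivative W (at x) v)) (at x within K)" for x
        by (intro has_derivative_add has_derivative_ident has_derivative_scaleR_right has_derivative_at_withinI[OF D])
      show "continuous_on K (\<lambda>x. det (matrix (\<lambda>v. v + t *\<^sub>R frechet_derivative W (at x) v)))"
        unfolding m by (rule cdet)
      show "inj_on ?\<Phi> K" using inj inj_on_subset by blast
      show "continuous_on (?\<Phi> ` K) \<eta>" using \<eta>(1) \<Phi>K by (auto intro: continuous_on_subset)
    qed
    moreover have "integral (?\<Phi> ` K) \<eta> \<le> integral K \<eta>"
      using \<Phi>K \<eta>
      by (intro integral_subset_le int integrable_continuous_compact compact_continuous_image c\<Phi> K)
        (auto intro: continuous_on_subset)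
    ultimately have 1: "integral K (\<lambda>x. \<bar>det (mat 1 + t *\<^sub>R ?D x)\<bar> * \<eta> (?\<Phi> x)) \<le> integral K \<eta>"
      by (simp only: m)
    have "integral K (\<lambda>x. \<eta> x + t * (\<eta> x * ?tr x - M x - e * (2 + C\<^sub>\<eta>)))
       \<le> integral K (\<lambda>x. \<bar>det (mat 1 + t *\<^sub>R ?D x)\<bar> * \<eta> (?\<Phi> x))"
    proof (intro integral_le int)
      show "continuous_on K (\<lambda>x. \<eta> x + t * (\<eta> x * ?tr x - M x - e * (2 + C\<^sub>\<eta>)))"
        by (intro continuous_intros \<eta> ctr M)
      show "continuous_on K (\<lambda>x. \<bar>det (mat 1 + t *\<^sub>R ?D x)\<bar> * \<eta> (?\<Phi> x))"
        by (intro continuous_intros cdet c\<eta>\<Phi>)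
      fix x assume x: "x \<in> K"
      define a where "a = \<eta> (?\<Phi> x)"
      define b where "b = ?tr x"
      have a: "0 \<le> a" "a \<le> C\<^sub>\<eta>" using \<eta>(2)[OF \<Phi>K[OF x]] C\<eta>(2)[OF \<Phi>K[OF x]] by (auto simp: a_def)
      have d: "\<bar>a - \<eta> x\<bar> \<le> t * (M x + e)" using t0(2)[OF t(1,2) x] by (simp add: a_def)
      have "\<bar>b * (a - \<eta> x)\<bar> \<le> C\<^sub>t * (t * (C\<^sub>M + e))"
      proof -
        have "t * (M x + e) \<le> t * (C\<^sub>M + e)" using CM(2)[OF x] t by simp
        then show ?thesis unfolding abs_mult using d Ct(1) Ct(2)[OF x] by (intro mult_mono) (auto simp: b_def)
      qed
      also have "\<dots> \<le> e" using tC by (simp add: mult_ac)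
      finally have ba: "b * \<eta> x - e \<le> b * a" by (simp add: algebra_simps abs_le_iff)
      have "(1 + t * b - t * e) * a \<le> \<bar>det (mat 1 + t *\<^sub>R ?D x)\<bar> * a"
        using t1(2)[OF t(1,3) x] a(1) by (intro mult_right_mono) (auto simp: b_def)
      moreover have "\<eta> x + t * (\<eta> x * b - M x - e * (2 + C\<^sub>\<eta>)) \<le> (1 + t * b - t * e) * a"
      proof -
        have "t * (b * \<eta> x - e) \<le> t * (b * a)" using ba t by simp
        moreover have "t * (e * a) \<le> t * (e * C\<^sub>\<eta>)" using a e t by simp
        ultimately show ?thesis using d by (simp add: algebra_simps abs_le_iff)
      qed
      ultimately show "\<eta> x + t * (\<eta> x * ?tr x - M x - e * (2 + C\<^sub>\<eta>)) \<le> \<bar>det (mat 1 + t *\<^sub>R ?D x)\<bar> * \<eta> (?\<Phi> x)"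
        unfolding a_def b_def by linarith
    qed
    also have "\<dots> \<le> integral K \<eta>" by (rule 1)
    also have "integral K (\<lambda>x. \<eta> x + t * (\<eta> x * ?tr x - M x - e * (2 + C\<^sub>\<eta>)))
       = integral K \<eta> + t * (integral K (\<lambda>x. \<eta> x * ?tr x) - integral K M - e * (2 + C\<^sub>\<eta>) * V)"
    proof -
      have i: "(\<lambda>x. \<eta> x * ?tr x) integrable_on K" "M integrable_on K" "\<eta> integrable_on K"
        "(\<lambda>x. e * (2 + C\<^sub>\<eta>)) integrable_on K"
        by (intro int continuous_intros \<eta> ctr M)+
      have "integral K (\<lambda>x. e * (2 + C\<^sub>\<eta>)) = e * (2 + C\<^sub>\<eta>) * V"
        unfolding V_def by (subst integral_mult_right[symmetric]) simp
      then show ?thesis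
        using i by (simp add: integral_add integral_diff integrable_diff integrable_on_mult_right)
    qed
    finally have "t * (integral K (\<lambda>x. \<eta> x * ?tr x) - integral K M - e * (2 + C\<^sub>\<eta>) * V) \<le> 0" by simp
    then have "integral K (\<lambda>x. \<eta> x * ?tr x) - integral K M - e * (2 + C\<^sub>\<eta>) * V \<le> 0"
      using t(1) by (simp add: mult_le_0_iff)
    then show ?thesis by (simp add: mult_ac)
  qed
  have "integral K (\<lambda>x. \<eta> x * ?tr x) - integral K M \<le> 0"
  proof (rule field_le_epsilon)
    fix e :: real assume e: "e > 0"
    let ?c = "V * (2 + C\<^sub>\<eta>) + 1"
    have c: "?c > 0" using V C\<eta>(1) by (simp add: add_nonneg_pos)
    have "integral K (\<lambda>x. \<eta> x * ?tr x) - integral K M \<le> e / ?c * (V * (2 + C\<^sub>\<eta>))"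
      by (rule main) (use e c in simp)
    also have "\<dots> \<le> e / ?c * ?c" using e c by (intro mult_left_mono) auto
    also have "\<dots> = 0 + e" using c by simp
    finally show "integral K (\<lambda>x. \<eta> x * ?tr x) - integral K M \<le> 0 + e" .
  qed
  then show ?thesis by (simp add: trace)
qed


section \<open>Chains of coordinate segments\<close>

locale immersed_manifold =
  fixes A :: "('a::t2_space, 'm::finite) chart set" and F :: "'a \<Rightarrow> 'e::euclidean_space"
  assumes atlas: "oriented_smooth_atlas A" and immersion: "smooth_immersion A F"
begin

lemma chart_facts:
  assumes "c \<in> A"
  shows "open (fst c)" "open (chart_image c)" "continuous_on (fst c) (snd c)"
    "continuous_on (chart_image c) (chart_inv c)"
    "p \<in> fst c \<Longrightarrow> snd c p \<in> chart_image c" "p \<in> fst c \<Longrightarrow> chart_inv c (snd c p) = p"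
    "x \<in> chart_image c \<Longrightarrow> chart_inv c x \<in> fst c" "x \<in> chart_image c \<Longrightarrow> snd c (chart_inv c x) = x"
proof -
  have "is_chart c" using atlas assms unfolding oriented_smooth_atlas_def by blast
  then have o: "open (fst c)" "open (chart_image c)"
    and h: "homeomorphism (fst c) (chart_image c) (snd c) (chart_inv c)"
    unfolding is_chart_def by blast+
  show "open (fst c)" "open (chart_image c)" by (rule o)+
  show "continuous_on (fst c) (snd c)" "continuous_on (chart_image c) (chart_inv c)"
    "p \<in> fst c \<Longrightarrow> snd c p \<in> chart_image c" "p \<in> fst c \<Longrightarrow> chart_inv c (snd c p) = p"
    "x \<in> chart_image c \<Longrightarrow> chart_inv c x \<in> fst c" "x \<in> chart_image c \<Longrightarrow> snd c (chart_inv c x) = x"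
    using h unfolding homeomorphism_def by blast+
qed

lemma ex_chart: obtains c where "c \<in> A" "p \<in> fst c"
  using atlas unfolding oriented_smooth_atlas_def by blast

lemma open_image_chart_inv:
  assumes c: "c \<in> A" and U: "open U" "U \<subseteq> chart_image c" shows "open (chart_inv c ` U)"
proof -
  have "chart_inv c ` U = fst c \<inter> snd c -` U"
  proof (intro equalityI subsetI)
    fix p assume "p \<in> chart_inv c ` U"
    then show "p \<in> fst c \<inter> snd c -` U" using chart_facts(7,8)[OF c] U by auto
  next
    fix p assume "p \<in> fst c \<inter> snd c -` U"
    then show "p \<in> chart_inv c ` U" using chart_facts(6)[OF c] by (metis IntD1 IntD2 imageI vimageD)
  qed
  then show ?thesis
    using continuous_on_open_vimage[OF chart_facts(1)[OF c]] chart_facts(3)[OF c] U(1) by (metis Int_commute)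
qed

lemma compact_image_chart_inv:
  "c \<in> A \<Longrightarrow> compact K \<Longrightarrow> K \<subseteq> chart_image c \<Longrightarrow> compact (chart_inv c ` K)"
  using compact_continuous_image continuous_on_subset chart_facts(4) by metis

lemma patch: "c \<in> A \<Longrightarrow> immersed_patch (in_chart F c) (chart_image c)"
  using immersion chart_facts(2)[of c] unfolding smooth_immersion_def smooth_function_def smooth_on_def
  by unfold_locales auto

lemma C1_F: "c \<in> A \<Longrightarrow> C1_on (in_chart F c) (chart_image c)"
  using immersed_patch.C1_phi[OF patch] .

lemma linear_dF: "c \<in> A \<Longrightarrow> x \<in> chart_image c \<Longrightarrow> linear (frechet_derivative (in_chart F c) (at x))"
  using immersed_patch.linear_J[OF patch] .

lemma continuous_F: "continuous_on UNIV F"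
proof -
  have "continuous_on (fst c) F" if c: "c \<in> A" for c
  proof -
    have "continuous_on (fst c) (\<lambda>p. in_chart F c (snd c p))"
      by (rule continuous_on_compose2[OF C1_on_continuous[OF C1_F[OF c]] chart_facts(3)[OF c]])
        (auto intro: chart_facts(5)[OF c])
    then show ?thesis
      by (rule continuous_on_eq) (simp add: in_chart_def chart_facts(6)[OF c])
  qed
  then have "continuous_on (\<Union>c\<in>A. fst c) F" by (intro continuous_on_open_UN) (auto simp: chart_facts(1))
  then show ?thesis using atlas by (simp add: oriented_smooth_atlas_def)
qed

text \<open>
  \<open>joined p q l\<close> says that \<open>q\<close> is reached from \<open>p\<close> by finitely many straight coordinate segments of total cost
  \<open>l\<close>, the cost of a segment being any upper bound for the length of its image's velocity when it is run through in
  unit time.  Chains replace curves in all metric arguments: they can be concatenated,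
  reversed and cut at a prescribed cost without measuring any length.
\<close>

inductive joined :: "'a \<Rightarrow> 'a \<Rightarrow> real \<Rightarrow> bool" for p where
  joined_refl: "joined p p 0"
| joined_step: "joined p (chart_inv c x) l \<Longrightarrow> c \<in> A \<Longrightarrow> closed_segment x y \<subseteq> chart_image c \<Longrightarrow> 0 \<le> L \<Longrightarrow>
    (\<And>z. z \<in> closed_segment x y \<Longrightarrow> norm (frechet_derivative (in_chart F c) (at z) (y - x)) \<le> L) \<Longrightarrow>
    joined p (chart_inv c y) (l + L)"

lemma joined_nonneg: "joined p q l \<Longrightarrow> 0 \<le> l"
  by (induction rule: joined.induct) auto

lemma joined_segment:
  "c \<in> A \<Longrightarrow> closed_segment x y \<subseteq> chart_image c \<Longrightarrow> 0 \<le> L \<Longrightarrow>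
    (\<And>z. z \<in> closed_segment x y \<Longrightarrow> norm (frechet_derivative (in_chart F c) (at z) (y - x)) \<le> L) \<Longrightarrow>
    joined (chart_inv c x) (chart_inv c y) L"
  using joined_step[OF joined_refl, of c x y L] by simp

lemma joined_segment_reverse:
  assumes c: "c \<in> A" and s: "closed_segment x y \<subseteq> chart_image c" and L: "0 \<le> L"
    "\<And>z. z \<in> closed_segment x y \<Longrightarrow> norm (frechet_derivative (in_chart F c) (at z) (y - x)) \<le> L"
  shows "joined (chart_inv c y) (chart_inv c x) L"
proof (rule joined_segment[OF c])
  show "closed_segment y x \<subseteq> chart_image c" using s by (simp add: closed_segment_commute)
  fix z assume z: "z \<in> closed_segment y x"
  then have z': "z \<in> closed_segment x y" by (simp add: closed_segment_commute)
  have "frechet_derivative (in_chart F c) (at z) (x - y) = - frechet_derivative (in_chart F c) (at z) (y - x)"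
    using linear_neg[OF linear_dF[OF c, of z], of "y - x"] z' s by auto
  then show "norm (frechet_derivative (in_chart F c) (at z) (x - y)) \<le> L" using L(2)[OF z'] by simp
qed (rule L)

lemma joined_trans:
  assumes "joined q r l'" "joined p q l" shows "joined p r (l + l')"
  using assms
proof (induction rule: joined.induct)
  case (joined_step c x l' y L)
  from joined.joined_step[OF joined_step.IH[OF joined_step.prems] joined_step.hyps(2-)]
  show ?case by (simp add: add.assoc)
qed simp

lemma joined_sym: "joined p q l \<Longrightarrow> joined q p l"
proof (induction rule: joined.induct)
  case (joined_step c x l y L)
  have "joined (chart_inv c y) (chart_inv c x) L" by (rule joined_segment_reverse) (use joined_step in auto)
  from joined_trans[OF joined_step.IH this] show ?case by (simp add: add.commute)
qed (rule joined_refl)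

text \<open>
  A segment that stands still may be given any nonnegative cost.
\<close>

lemma joined_mono:
  assumes "joined p q l" "l \<le> l'" shows "joined p q l'"
proof -
  obtain c where c: "c \<in> A" "q \<in> fst c" by (rule ex_chart)
  let ?x = "snd c q"
  have x: "?x \<in> chart_image c" "chart_inv c ?x = q" using chart_facts(5,6)[OF c(1)] c(2) by auto
  have "joined p (chart_inv c ?x) (l + (l' - l))"
    by (rule joined_step[where x = ?x and c = c]) (use x c assms linear_0[OF linear_dF[OF c(1) x(1)]] in auto)
  then show ?thesis by (simp add: x)
qed

text \<open>
  The cut falls inside one of the segments, and a fraction \<open>s\<close> of a segment costs the fraction \<open>s\<close>.  This is the
  length space property behind the Hopf--Rinow argument.
\<close>

lemma joined_split:
  assumes "joined p q l" "0 \<le> a" "a \<le> l" shows "\<exists>r. joined p r a \<and> joined r q (l - a)"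
  using assms
proof (induction arbitrary: a rule: joined.induct)
  case joined_refl
  then show ?case using joined.joined_refl by auto
next
  case (joined_step c x l y L)
  show ?case
  proof (cases "a \<le> l")
    case True
    then obtain r where r: "joined p r a" "joined r (chart_inv c x) (l - a)"
      using joined_step.IH joined_step.prems by blast
    from joined.joined_step[OF r(2) joined_step.hyps(2-)] r(1) show ?thesis by (auto simp: algebra_simps)
  next
    case False
    define s where "s = (a - l) / L"
    have L: "L > 0" "s \<ge> 0" "s \<le> 1" "s * L = a - l"
      using False joined_step by (auto simp: s_def field_simps)
    define z where "z = (1 - s) *\<^sub>R x + s *\<^sub>R y"
    have z: "z \<in> closed_segment x y" using L by (auto simp: z_def in_segment)
    have sub: "closed_segment x z \<subseteq> closed_segment x y" "closed_segment z y \<subseteq> closed_segment x y"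
      using z by (simp_all add: subset_closed_segment)
    have sc: "norm (frechet_derivative (in_chart F c) (at v) (k *\<^sub>R (y - x))) \<le> k * L"
      if "v \<in> closed_segment x y" "0 \<le> k" for v k
    proof -
      have "v \<in> chart_image c" using that joined_step.hyps by blast
      then have "norm (frechet_derivative (in_chart F c) (at v) (k *\<^sub>R (y - x)))
        = k * norm (frechet_derivative (in_chart F c) (at v) (y - x))"
        using linear_scale[OF linear_dF[OF joined_step.hyps(2)]] that by simp
      then show ?thesis using joined_step.hyps(5)[OF that(1)] that by (simp add: mult_left_mono)
    qed
    have zx: "z - x = s *\<^sub>R (y - x)" "y - z = (1 - s) *\<^sub>R (y - x)"
      by (simp_all add: z_def algebra_simps)
    have "joined p (chart_inv c z) (l + s * L)"
    proof (rule joined.joined_step[OF joined_step.hyps(1,2)])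
      show "closed_segment x z \<subseteq> chart_image c" using sub joined_step.hyps(3) by blast
      show "0 \<le> s * L" by (rule mult_nonneg_nonneg) (use L in auto)
      show "norm (frechet_derivative (in_chart F c) (at v) (z - x)) \<le> s * L" if "v \<in> closed_segment x z" for v
        unfolding zx by (rule sc) (use that sub L in auto)
    qed
    moreover have "joined (chart_inv c z) (chart_inv c y) ((1 - s) * L)"
    proof (rule joined_segment[OF joined_step.hyps(2)])
      show "closed_segment z y \<subseteq> chart_image c" using sub joined_step.hyps(3) by blast
      show "0 \<le> (1 - s) * L" using L by simp
      show "norm (frechet_derivative (in_chart F c) (at v) (y - z)) \<le> (1 - s) * L" if "v \<in> closed_segment z y" for v
        unfolding zx by (rule sc) (use that sub L in auto)
    qed
    moreover have "l + s * L = a" "(1 - s) * L = l + L - a" using L(4) by (auto simp: algebra_simps)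
    ultimately show ?thesis by auto
  qed
qed

lemma joined_nearby:
  assumes e: "0 < e" obtains U where "open U" "q \<in> U" "\<And>p. p \<in> U \<Longrightarrow> joined q p e"
proof -
  obtain c where c: "c \<in> A" "q \<in> fst c" by (rule ex_chart)
  let ?x = "snd c q" and ?D = "\<lambda>z. frechet_derivative (in_chart F c) (at z)"
  have x: "?x \<in> chart_image c" "chart_inv c ?x = q" using chart_facts(5,6)[OF c(1)] c(2) by auto
  obtain d where d: "d > 0" "cball ?x d \<subseteq> chart_image c"
    using open_contains_cball x(1) chart_facts(2)[OF c(1)] by blast
  have "bounded ((\<lambda>z. \<Sum>b\<in>Basis. norm (?D z b)) ` cball ?x d)"
    by (intro compact_imp_bounded compact_continuous_image compact_cball continuous_intros
        continuous_on_subset[OF C1_on_continuous_derivative[OF C1_F[OF c(1)]] d(2)])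
  then obtain B where B: "B > 0" "\<And>z. z \<in> cball ?x d \<Longrightarrow> (\<Sum>b\<in>Basis. norm (?D z b)) \<le> B"
    unfolding bounded_pos by force
  define r where "r = min d (e / B)"
  have r: "r > 0" "r \<le> d" "r * B \<le> e" using d B e by (auto simp: r_def min_def field_simps)
  show ?thesis
  proof
    show "open (chart_inv c ` ball ?x r)"
      using r d by (intro open_image_chart_inv c) (auto simp: subset_eq)
    show "q \<in> chart_inv c ` ball ?x r" using x r by (intro image_eqI[of _ _ ?x]) auto
    fix p assume "p \<in> chart_inv c ` ball ?x r"
    then obtain y where y: "y \<in> ball ?x r" "p = chart_inv c y" by blast
    have seg: "closed_segment ?x y \<subseteq> cball ?x d"
      using y r d(1) by (intro closed_segment_subset) auto
    have "joined (chart_inv c ?x) (chart_inv c y) e"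
    proof (rule joined_segment[OF c(1)])
      show "closed_segment ?x y \<subseteq> chart_image c" using seg d by blast
      fix z assume "z \<in> closed_segment ?x y"
      then have z: "z \<in> cball ?x d" using seg by blast
      have dz: "in_chart F c differentiable (at z)" using C1_on_differentiable[OF C1_F[OF c(1)]] z d by blast
      have "norm (?D z (y - ?x)) \<le> (\<Sum>b\<in>Basis. norm (((y - ?x) \<bullet> b) *\<^sub>R ?D z b))"
        by (subst frechet_derivative_Basis_sum[OF dz]) (rule norm_sum)
      also have "\<dots> \<le> (\<Sum>b\<in>Basis. norm (y - ?x) * norm (?D z b))"
        by (auto intro!: sum_mono mult_right_mono simp: Basis_le_norm)
      also have "\<dots> \<le> norm (y - ?x) * B"
        unfolding sum_distrib_left[symmetric] using B(2)[OF z] by (intro mult_left_mono) auto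
      also have "\<dots> \<le> r * B" using y B(1) by (intro mult_right_mono) (auto simp: dist_norm norm_minus_commute)
      finally show "norm (?D z (y - ?x)) \<le> e" using r by simp
    qed (use e in simp)
    then show "joined q p e" using x y by simp
  qed
qed

end


section \<open>Chains as curves of bounded speed\<close>

lemma C1_on_imp_C1_differentiable_on:
  fixes f :: "real \<Rightarrow> 'b::real_normed_vector"
  assumes "C1_on f N" shows "f C1_differentiable_on N"
  unfolding C1_differentiable_on_def
proof (intro exI[of _ "\<lambda>t. frechet_derivative f (at t) 1"] conjI ballI)
  fix t assume "t \<in> N"
  note D = C1_on_has_derivative[OF assms this]
  have "frechet_derivative f (at t) h = h *\<^sub>R frechet_derivative f (at t) 1" for h
    using linear_scale[OF has_derivative_linear[OF D], of h 1] by simp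
  then have "frechet_derivative f (at t) = (\<lambda>h. h *\<^sub>R frechet_derivative f (at t) 1)" by (rule ext)
  then show "(f has_vector_derivative frechet_derivative f (at t) 1) (at t)"
    unfolding has_vector_derivative_def using D by metis
qed (rule C1_on_continuous_derivative[OF assms])

context immersed_manifold
begin

text \<open>
  Near \<open>t\<close> the curve is an affinely parametrized coordinate segment whose image has speed at most \<open>l\<close> at \<open>t\<close>.
\<close>

definition affine_in_chart :: "(real \<Rightarrow> 'a) \<Rightarrow> real \<Rightarrow> real \<Rightarrow> bool" where
  "affine_in_chart \<gamma> l t \<longleftrightarrow> (\<exists>c\<in>A. \<exists>d>0. \<exists>x w.
     (\<forall>s. \<bar>s - t\<bar> < d \<longrightarrow> x + s *\<^sub>R w \<in> chart_image c \<and> \<gamma> s = chart_inv c (x + s *\<^sub>R w)) \<and>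
     norm (frechet_derivative (in_chart F c) (at (x + t *\<^sub>R w)) w) \<le> l)"

lemma affine_in_chartI:
  assumes "c \<in> A" "0 < d"
    "\<And>s. \<bar>s - t\<bar> < d \<Longrightarrow> x + s *\<^sub>R w \<in> chart_image c \<and> \<gamma> s = chart_inv c (x + s *\<^sub>R w)"
    "norm (frechet_derivative (in_chart F c) (at (x + t *\<^sub>R w)) w) \<le> l"
  shows "affine_in_chart \<gamma> l t"
  using assms unfolding affine_in_chart_def by blast

lemma affine_in_chartE:
  assumes "affine_in_chart \<gamma> l t"
  obtains c d x w where "c \<in> A" "0 < d"
    "\<And>s. \<bar>s - t\<bar> < d \<Longrightarrow> x + s *\<^sub>R w \<in> chart_image c \<and> \<gamma> s = chart_inv c (x + s *\<^sub>R w)"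
    "norm (frechet_derivative (in_chart F c) (at (x + t *\<^sub>R w)) w) \<le> l"
  using assms unfolding affine_in_chart_def by blast

definition polygonal_curve :: "(real \<Rightarrow> 'a) \<Rightarrow> real \<Rightarrow> bool" where
  "polygonal_curve \<gamma> l \<longleftrightarrow> continuous_on {0..1} \<gamma> \<and>
     (\<exists>S. finite S \<and> (\<forall>t\<in>{0<..<1} - S. affine_in_chart \<gamma> l t))"

lemma affine_in_chart_C1:
  assumes "affine_in_chart \<gamma> l t" and c': "c' \<in> A" and U: "open U" "t \<in> U" "\<gamma> ` U \<subseteq> fst c'"
  obtains N where "open N" "t \<in> N" "C1_on (snd c' \<circ> \<gamma>) N"
proof -
  obtain c d x w where c: "c \<in> A" "d > 0"
    and g: "\<And>s. \<bar>s - t\<bar> < d \<Longrightarrow> x + s *\<^sub>R w \<in> chart_image c \<and> \<gamma> s = chart_inv c (x + s *\<^sub>R w)"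
    using affine_in_chartE[OF assms(1)] by metis
  define N where "N = U \<inter> {s. \<bar>s - t\<bar> < d}"
  have "{s. \<bar>s - t\<bar> < d} = ball t d" by (auto simp: dist_real_def abs_minus_commute)
  then have N: "open N" "t \<in> N" using U c(2) by (auto simp: N_def)
  have "C1_on (snd c' \<circ> \<gamma>) N"
  proof (rule C1_on_cong[OF N(1)])
    show "(snd c' \<circ> \<gamma>) s = (snd c' \<circ> chart_inv c) (x + s *\<^sub>R w)" if "s \<in> N" for s
      using g[of s] that by (simp add: N_def)
    show "C1_on (\<lambda>s. (snd c' \<circ> chart_inv c) (x + s *\<^sub>R w)) N"
    proof (rule C1_on_compose[where f = "snd c' \<circ> chart_inv c" and g = "\<lambda>s. x + s *\<^sub>R w"])
      show "C1_on (snd c' \<circ> chart_inv c) (snd c ` (fst c \<inter> fst c'))"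
        using atlas c(1) c' unfolding oriented_smooth_atlas_def smooth_on_def C1_on_def by blast
      show "C1_on (\<lambda>s. x + s *\<^sub>R w) N"
        by (intro C1_on_add C1_on_const C1_on_scaleR C1_on_linear bounded_linear_ident)
      fix s assume s: "s \<in> N"
      then have "\<gamma> s \<in> fst c'" "x + s *\<^sub>R w \<in> chart_image c" "\<gamma> s = chart_inv c (x + s *\<^sub>R w)"
        using g[of s] U by (auto simp: N_def)
      then show "x + s *\<^sub>R w \<in> snd c ` (fst c \<inter> fst c')"
        using chart_facts(7,8)[OF c(1)] by (metis IntI image_eqI)
    qed
  qed
  with N show ?thesis by (rule that)
qed

lemma polygonal_imp_piecewise_C1:
  assumes "polygonal_curve \<gamma> l" shows "piecewise_C1_curve A \<gamma>"
  unfolding piecewise_C1_curve_def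
proof (intro conjI ballI allI impI)
  show cont: "continuous_on {0..1} \<gamma>" using assms by (simp add: polygonal_curve_def)
  obtain S where S: "finite S" "\<And>t. t \<in> {0<..<1} - S \<Longrightarrow> affine_in_chart \<gamma> l t"
    using assms unfolding polygonal_curve_def by blast
  fix c a b assume c: "c \<in> A" and ab: "0 \<le> a" "a \<le> b" "b \<le> 1" and im: "\<gamma> ` {a..b} \<subseteq> fst c"
  let ?f = "snd c \<circ> \<gamma>"
  have "continuous_on {a..b} ?f"
    by (rule continuous_on_compose[OF continuous_on_subset[OF cont] continuous_on_subset[OF chart_facts(3)[OF c] im]])
      (use ab in auto)
  moreover have "?f C1_differentiable_on {a..b} - (S \<union> {a, b})"
  proof (rule C1_on_imp_C1_differentiable_on)
    have "\<exists>N. open N \<and> t \<in> N \<and> C1_on ?f N" if "t \<in> {a<..<b} - S" for t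
      by (rule affine_in_chart_C1[OF S(2) c, of t "{a<..<b}"]) (use that ab im in auto)
    then obtain N where N: "\<And>t. t \<in> {a<..<b} - S \<Longrightarrow> open (N t) \<and> t \<in> N t \<and> C1_on ?f (N t)" by metis
    then have "C1_on ?f (\<Union>t\<in>{a<..<b} - S. N t)" by (intro C1_on_open_UN) auto
    then show "C1_on ?f ({a..b} - (S \<union> {a, b}))"
      by (rule C1_on_subset) (use N in force)
  qed
  ultimately show "?f piecewise_C1_differentiable_on {a..b}"
    unfolding piecewise_C1_differentiable_on_def using S(1) by (metis finite.emptyI finite.insertI finite_Un)
qed

lemma polygonal_curve_length:
  assumes "polygonal_curve \<gamma> l" shows "curve_length F \<gamma> \<le> ennreal l"
proof -
  obtain S where S: "finite S" "\<And>t. t \<in> {0<..<1} - S \<Longrightarrow> affine_in_chart \<gamma> l t"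
    using assms unfolding polygonal_curve_def by blast
  have speed: "norm (vector_derivative (F \<circ> \<gamma>) (at t)) \<le> l" if tS: "t \<in> {0<..<1} - S" for t
  proof -
    obtain c d x w where c: "c \<in> A" "d > 0"
      and g: "\<And>s. \<bar>s - t\<bar> < d \<Longrightarrow> x + s *\<^sub>R w \<in> chart_image c \<and> \<gamma> s = chart_inv c (x + s *\<^sub>R w)"
      and b: "norm (frechet_derivative (in_chart F c) (at (x + t *\<^sub>R w)) w) \<le> l"
      using affine_in_chartE[OF S(2)[OF tS]] by metis
    let ?D = "frechet_derivative (in_chart F c) (at (x + t *\<^sub>R w))"
    have x: "x + t *\<^sub>R w \<in> chart_image c" using g[of t] c(2) by simp
    have "((\<lambda>s. x + s *\<^sub>R w) has_vector_derivative w) (at t)"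
      by (auto intro!: derivative_eq_intros)
    from has_derivative_compose[OF this[unfolded has_vector_derivative_def] C1_on_has_derivative[OF C1_F[OF c(1)] x]]
    have "((\<lambda>s. in_chart F c (x + s *\<^sub>R w)) has_vector_derivative ?D w) (at t)"
      using linear_scale[OF linear_dF[OF c(1) x]] by (simp add: has_vector_derivative_def)
    then have "(F \<circ> \<gamma> has_vector_derivative ?D w) (at t)"
      by (rule has_vector_derivative_transform_within_open[of _ _ _ "ball t d"])
        (use c g in \<open>auto simp: dist_real_def abs_minus_commute in_chart_def\<close>)
    then show ?thesis using b by (simp add: vector_derivative_at)
  qed
  have "curve_length F \<gamma> \<le> (\<integral>\<^sup>+t. ennreal l * indicator {0..1} (t::real) \<partial>lborel)"
    unfolding curve_length_def
  proof (rule nn_integral_mono_AE)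
    have "AE t in lborel. t \<notin> S \<union> {0, 1 :: real}"
      by (rule AE_not_in) (use S(1) in \<open>simp add: finite_imp_null_set_lborel\<close>)
    then show "AE t in lborel. ennreal (norm (vector_derivative (F \<circ> \<gamma>) (at t))) * indicator {0..1} t
        \<le> ennreal l * indicator {0..1} t"
      by eventually_elim (use speed in \<open>auto simp: indicator_def intro!: ennreal_leI\<close>)
  qed
  also have "\<dots> = ennreal l" by (simp add: nn_integral_cmult)
  finally show ?thesis .
qed

lemma affine_in_chart_reparametrize:
  assumes "affine_in_chart \<gamma> l (m * t)" "0 < m" "0 < d'"
    and "\<And>s. \<bar>s - t\<bar> < d' \<Longrightarrow> \<gamma>' s = \<gamma> (m * s)"
  shows "affine_in_chart \<gamma>' (m * l) t"
proof -
  obtain c d x w where c: "c \<in> A" "d > 0"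
    and g: "\<And>s. \<bar>s - m * t\<bar> < d \<Longrightarrow> x + s *\<^sub>R w \<in> chart_image c \<and> \<gamma> s = chart_inv c (x + s *\<^sub>R w)"
    and b: "norm (frechet_derivative (in_chart F c) (at (x + (m * t) *\<^sub>R w)) w) \<le> l"
    using affine_in_chartE[OF assms(1)] by metis
  have x: "x + (m * t) *\<^sub>R w \<in> chart_image c" using g[of "m * t"] c(2) by simp
  show ?thesis
  proof (rule affine_in_chartI[of c "min d' (d / m)" t x "m *\<^sub>R w", OF c(1)])
    fix s assume s: "\<bar>s - t\<bar> < min d' (d / m)"
    then have "\<bar>s - t\<bar> * m < d" using assms(2) by (simp add: field_simps)
    then have "\<bar>m * s - m * t\<bar> < d" using assms(2)
      by (metis abs_mult abs_of_pos mult.commute right_diff_distrib)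
    from g[OF this] assms(4)[of s] s
    show "x + s *\<^sub>R m *\<^sub>R w \<in> chart_image c \<and> \<gamma>' s = chart_inv c (x + s *\<^sub>R m *\<^sub>R w)"
      by (auto simp: mult.commute)
  next
    show "norm (frechet_derivative (in_chart F c) (at (x + t *\<^sub>R m *\<^sub>R w)) (m *\<^sub>R w)) \<le> m * l"
      using linear_scale[OF linear_dF[OF c(1) x], of m w] b assms(2) by (simp add: mult.commute)
  qed (use c assms in auto)
qed

lemma affine_in_chart_segment:
  assumes c: "c \<in> A" and seg: "closed_segment x y \<subseteq> chart_image c"
    and L: "\<And>z. z \<in> closed_segment x y \<Longrightarrow> norm (frechet_derivative (in_chart F c) (at z) (y - x)) \<le> L"
    and t: "0 < t" "t < 1"
  shows "affine_in_chart (\<lambda>s. chart_inv c (x + s *\<^sub>R (y - x))) L t"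
proof (rule affine_in_chartI[of c "min t (1 - t)" t x "y - x", OF c])
  have z: "x + s *\<^sub>R (y - x) \<in> closed_segment x y" if "0 \<le> s" "s \<le> 1" for s
    using that unfolding in_segment by (intro exI[of _ s]) (auto simp: algebra_simps)
  show "x + s *\<^sub>R (y - x) \<in> chart_image c \<and> chart_inv c (x + s *\<^sub>R (y - x)) = chart_inv c (x + s *\<^sub>R (y - x))"
    if "\<bar>s - t\<bar> < min t (1 - t)" for s
    using z[of s] seg that by (auto simp: abs_less_iff)
  show "norm (frechet_derivative (in_chart F c) (at (x + t *\<^sub>R (y - x))) (y - x)) \<le> L"
    using L z t by simp
qed (use t in auto)

text \<open>
  The old curve is compressed to \<open>[0, \<theta>]\<close> and the segment to \<open>[\<theta>, 1]\<close> with \<open>\<theta> = l / (l + L)\<close>, which makes both speed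
  bounds equal to \<open>l + L\<close>.
\<close>

lemma polygonal_curve_append:
  assumes \<gamma>: "polygonal_curve \<gamma> l" and l: "0 < l" and c: "c \<in> A"
    and seg: "closed_segment x y \<subseteq> chart_image c" and "\<gamma> 1 = chart_inv c x" and L: "0 < L"
    and D: "\<And>z. z \<in> closed_segment x y \<Longrightarrow> norm (frechet_derivative (in_chart F c) (at z) (y - x)) \<le> L"
  obtains \<gamma>' where "polygonal_curve \<gamma>' (l + L)" "\<gamma>' 0 = \<gamma> 0" "\<gamma>' 1 = chart_inv c y"
proof -
  obtain S where S: "finite S" "\<And>t. t \<in> {0<..<1} - S \<Longrightarrow> affine_in_chart \<gamma> l t"
    and cont: "continuous_on {0..1} \<gamma>"
    using \<gamma> unfolding polygonal_curve_def by blast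
  define \<theta> where "\<theta> = l / (l + L)"
  have \<theta>: "0 < \<theta>" "\<theta> < 1" using l L by (auto simp: \<theta>_def)
  have m1: "1 / \<theta> * l = l + L" using l L by (simp add: \<theta>_def)
  have "1 - \<theta> = L / (l + L)" using l L by (simp add: \<theta>_def field_simps)
  then have m2: "1 / (1 - \<theta>) * L = l + L" using l L by simp
  define \<sigma> where "\<sigma> s = chart_inv c (x + s *\<^sub>R (y - x))" for s
  define \<gamma>' where "\<gamma>' s = (if s \<le> \<theta> then \<gamma> (1 / \<theta> * s) else \<sigma> (1 / (1 - \<theta>) * (s - \<theta>)))" for s
  have z: "x + s *\<^sub>R (y - x) \<in> closed_segment x y" if "0 \<le> s" "s \<le> 1" for s
    using that unfolding in_segment by (intro exI[of _ s]) (auto simp: algebra_simps)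
  have "continuous_on {0..1} \<sigma>" unfolding \<sigma>_def
    by (rule continuous_on_compose2[OF chart_facts(4)[OF c]]) (use z seg in \<open>auto intro!: continuous_intros\<close>)
  then have c2: "continuous_on {\<theta>..1} (\<lambda>s. \<sigma> (1 / (1 - \<theta>) * (s - \<theta>)))"
    by (rule continuous_on_compose2) (use \<theta> in \<open>auto intro!: continuous_intros simp: field_simps\<close>)
  have c1: "continuous_on {0..\<theta>} (\<lambda>s. \<gamma> (1 / \<theta> * s))"
    by (rule continuous_on_compose2[OF cont]) (use \<theta> in \<open>auto intro!: continuous_intros simp: field_simps\<close>)
  have "continuous_on ({0..\<theta>} \<union> {\<theta>..1}) \<gamma>'"
    unfolding \<gamma>'_def
    by (rule continuous_on_cases) (use c1 c2 \<theta> assms(5) in \<open>auto simp: \<sigma>_def\<close>)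
  moreover have "{0..\<theta>} \<union> {\<theta>..1} = {0..1}" using \<theta> by auto
  moreover have "affine_in_chart \<gamma>' (l + L) t" if t: "t \<in> {0<..<1} - insert \<theta> ((*) \<theta> ` S)" for t
  proof (cases "t < \<theta>")
    case True
    have "1 / \<theta> * t \<notin> S"
    proof
      assume "1 / \<theta> * t \<in> S"
      then have "\<theta> * (1 / \<theta> * t) \<in> (*) \<theta> ` S" by blast
      then show False using t \<theta> by simp
    qed
    then have "affine_in_chart \<gamma> l (1 / \<theta> * t)" using t True \<theta> by (intro S(2)) auto
    then have "affine_in_chart \<gamma>' (1 / \<theta> * l) t"
      by (rule affine_in_chart_reparametrize[of _ _ _ _ "\<theta> - t"]) (use \<theta> True in \<open>auto simp: \<gamma>'_def\<close>)
    then show ?thesis by (simp only: m1)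
  next
    case False
    then have t\<theta>: "\<theta> < t" "t < 1" using t by auto
    let ?m = "1 / (1 - \<theta>)"
    have "affine_in_chart \<sigma> L (?m * (t - \<theta>))"
      unfolding \<sigma>_def[abs_def] by (rule affine_in_chart_segment[OF c seg D]) (use \<theta> t\<theta> in \<open>auto simp: field_simps\<close>)
    then obtain c' d x' w where c': "c' \<in> A" "d > 0"
      and g: "\<And>s. \<bar>s - ?m * (t - \<theta>)\<bar> < d \<Longrightarrow> x' + s *\<^sub>R w \<in> chart_image c' \<and> \<sigma> s = chart_inv c' (x' + s *\<^sub>R w)"
      and b: "norm (frechet_derivative (in_chart F c') (at (x' + (?m * (t - \<theta>)) *\<^sub>R w)) w) \<le> L"
      by (rule affine_in_chartE) metis
    have "affine_in_chart (\<lambda>s. \<sigma> (s - ?m * \<theta>)) L (?m * t)"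
    proof (rule affine_in_chartI[of c' d "?m * t" "x' - (?m * \<theta>) *\<^sub>R w" w, OF c'])
      fix s assume s: "\<bar>s - ?m * t\<bar> < d"
      have "\<bar>(s - ?m * \<theta>) - ?m * (t - \<theta>)\<bar> < d" using s by (simp add: right_diff_distrib diff_divide_distrib)
      from g[OF this]
      show "x' - (?m * \<theta>) *\<^sub>R w + s *\<^sub>R w \<in> chart_image c' \<and>
        \<sigma> (s - ?m * \<theta>) = chart_inv c' (x' - (?m * \<theta>) *\<^sub>R w + s *\<^sub>R w)"
        by (auto simp: scaleR_left_diff_distrib algebra_simps)
    next
      have "x' - (?m * \<theta>) *\<^sub>R w + (?m * t) *\<^sub>R w = x' + (?m * (t - \<theta>)) *\<^sub>R w"
        by (simp add: right_diff_distrib scaleR_left_diff_distrib diff_divide_distrib)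
      then show "norm (frechet_derivative (in_chart F c') (at (x' - (?m * \<theta>) *\<^sub>R w + (?m * t) *\<^sub>R w)) w) \<le> L"
        using b by metis
    qed
    then have "affine_in_chart \<gamma>' (?m * L) t"
      by (rule affine_in_chart_reparametrize[of _ _ _ _ "t - \<theta>"])
        (use \<theta> t\<theta> in \<open>auto simp: \<gamma>'_def right_diff_distrib diff_divide_distrib\<close>)
    then show ?thesis by (simp only: m2)
  qed
  ultimately have "polygonal_curve \<gamma>' (l + L)"
    unfolding polygonal_curve_def using S(1) by (metis finite.insertI finite_imageI)
  moreover have "\<gamma>' 0 = \<gamma> 0" "\<gamma>' 1 = chart_inv c y" using \<theta> by (auto simp: \<gamma>'_def \<sigma>_def)
  ultimately show ?thesis by (rule that)
qed

text \<open>
  The slack \<open>e\<close> keeps all speeds positive, so that every piece occupies a nondegenerate interval.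
\<close>

lemma joined_imp_polygonal_curve:
  assumes "joined p q l" "0 < e"
  shows "\<exists>\<gamma>. polygonal_curve \<gamma> (l + e) \<and> \<gamma> 0 = p \<and> \<gamma> 1 = q"
  using assms
proof (induction arbitrary: e rule: joined.induct)
  case joined_refl
  obtain c where c: "c \<in> A" "p \<in> fst c" by (rule ex_chart)
  have x: "snd c p \<in> chart_image c" "chart_inv c (snd c p) = p" using chart_facts(5,6)[OF c(1)] c(2) by auto
  have "affine_in_chart (\<lambda>_. p) e t" for t
    by (rule affine_in_chartI[of c 1 t "snd c p" 0, OF c(1)])
      (use x joined_refl linear_0[OF linear_dF[OF c(1) x(1)]] in auto)
  then show ?case unfolding polygonal_curve_def by (intro exI[of _ "\<lambda>_. p"]) auto
next
  case (joined_step c x l y L)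
  obtain \<gamma> where \<gamma>: "polygonal_curve \<gamma> (l + e / 2)" "\<gamma> 0 = p" "\<gamma> 1 = chart_inv c x"
    using joined_step.IH[of "e / 2"] joined_step.prems by auto
  have "0 < l + e / 2" using joined_nonneg[OF joined_step.hyps(1)] joined_step.prems by simp
  moreover have "0 < L + e / 2" using joined_step by simp
  moreover have "norm (frechet_derivative (in_chart F c) (at z) (y - x)) \<le> L + e / 2" if "z \<in> closed_segment x y" for z
    using joined_step.hyps(5)[OF that] joined_step.prems by simp
  ultimately obtain \<gamma>' where "polygonal_curve \<gamma>' (l + e / 2 + (L + e / 2))" "\<gamma>' 0 = \<gamma> 0" "\<gamma>' 1 = chart_inv c y"
    using polygonal_curve_append[OF \<gamma>(1) _ joined_step.hyps(2,3) \<gamma>(3)] by metis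
  moreover have "l + e / 2 + (L + e / 2) = l + L + e" by simp
  ultimately show ?case using \<gamma>(2) by metis
qed

lemma riemannian_dist_le_joined:
  assumes "joined p q l" "0 < e" shows "riemannian_dist A F p q \<le> ennreal (l + e)"
proof -
  obtain \<gamma> where \<gamma>: "polygonal_curve \<gamma> (l + e)" "\<gamma> 0 = p" "\<gamma> 1 = q"
    using joined_imp_polygonal_curve[OF assms] by blast
  have "riemannian_dist A F p q \<le> curve_length F \<gamma>"
    unfolding riemannian_dist_def using polygonal_imp_piecewise_C1[OF \<gamma>(1)] \<gamma> by (intro INF_lower) auto
  also have "\<dots> \<le> ennreal (l + e)" by (rule polygonal_curve_length[OF \<gamma>(1)])
  finally show ?thesis .
qed

end


section \<open>Completeness and compactness of chain balls\<close>

text \<open>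
  The lower bound is stated through a measurable minorant of the speed because the speed itself is uncontrolled
  at the exceptional points; it is also what makes the bound additive over adjacent intervals.  If the minorant has
  infinite integral there is nothing to show, and otherwise the fundamental theorem of calculus applies.
\<close>

lemma displacement_le_speed_integral:
  fixes f :: "real \<Rightarrow> 'e::euclidean_space"
  assumes ab: "a \<le> b" and f: "continuous_on {a..b} f" and S: "finite S"
    and C1: "C1_on f ({a<..<b} - S)"
  shows "\<exists>g \<in> borel_measurable lborel.
    (\<forall>t. g t \<le> ennreal (norm (vector_derivative f (at t))) * indicator {a<..<b} t) \<and>
    ennreal (norm (f b - f a)) \<le> (\<integral>\<^sup>+t. g t \<partial>lborel)"
proof -
  let ?U = "{a<..<b} - S"
  let ?v = "\<lambda>t. vector_derivative f (at t)"
  have fc: "f C1_differentiable_on ?U" by (rule C1_on_imp_C1_differentiable_on[OF C1])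
  then have D: "(f has_vector_derivative ?v t) (at t)" if "t \<in> ?U" for t
    using that by (simp add: C1_differentiable_on_eq vector_derivative_works)
  have cv: "continuous_on ?U ?v" using fc by (simp add: C1_differentiable_on_eq)
  have U: "open ?U" using S by (simp add: finite_imp_closed open_Diff)
  define g where "g t = indicator ?U t *\<^sub>R ?v t" for t
  have "(?v has_integral (f b - f a)) {a..b}"
    by (rule fundamental_theorem_of_calculus_interior_strong[OF S ab D f])
  then have hk: "(g has_integral (f b - f a)) {a..b}"
    by (rule has_integral_spike_finite[of "S \<union> {a, b}", rotated 2]) (use S in \<open>auto simp: g_def\<close>)
  have gm: "g \<in> borel_measurable lborel"
    using borel_measurable_continuous_on_indicator[OF _ cv] U unfolding g_def[abs_def] by simp
  have "ennreal (norm (f b - f a)) \<le> (\<integral>\<^sup>+t. ennreal (norm (g t)) \<partial>lborel)"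
  proof (cases "(\<integral>\<^sup>+t. ennreal (norm (g t)) \<partial>lborel) = \<infinity>")
    case False
    then have gi: "integrable lborel g" by (intro integrableI_bounded[OF gm]) (simp add: less_top)
    have "(g has_integral (LINT t|lborel. g t)) UNIV" by (rule has_integral_integral_lborel[OF gi])
    moreover have "g = (\<lambda>t. if t \<in> {a..b} then g t else 0)"
    proof
      fix t show "g t = (if t \<in> {a..b} then g t else 0)" by (cases "t \<in> ?U") (simp_all add: g_def)
    qed
    ultimately have "(g has_integral (LINT t|lborel. g t)) {a..b}"
      using has_integral_restrict_UNIV[of "{a..b}" g] by simp
    then have "f b - f a = (LINT t|lborel. g t)" using hk has_integral_unique by blast
    then show ?thesis using integral_norm_bound_ennreal[OF gi] by simp
  qed simp
  moreover have "(\<lambda>t. ennreal (norm (g t))) \<in> borel_measurable lborel" using gm by measurable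
  moreover have "ennreal (norm (g t)) \<le> ennreal (norm (?v t)) * indicator {a<..<b} t" for t
    by (cases "t \<in> ?U") (simp_all add: g_def)
  ultimately show ?thesis by (intro bexI[of _ "\<lambda>t. ennreal (norm (g t))"]) auto
qed

context immersed_manifold
begin

text \<open>
  The previous bound holds on short intervals, on which the curve stays in one chart, and bisection
  extends it to all intervals.
\<close>

lemma displacement_le_curve_length:
  assumes \<gamma>: "piecewise_C1_curve A \<gamma>" and "0 \<le> a" "a \<le> b" "b \<le> 1"
  shows "ennreal (norm (F (\<gamma> b) - F (\<gamma> a))) \<le> curve_length F \<gamma>"
proof -
  let ?s = "\<lambda>t. ennreal (norm (vector_derivative (F \<circ> \<gamma>) (at t)))"
  have cont: "continuous_on {0..1} \<gamma>" using \<gamma> by (simp add: piecewise_C1_curve_def)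
  \<comment> \<open>The speed need not be measurable, so the integral is bounded from below through measurable minorants,
    which add up over adjacent intervals.\<close>
  define P where "P a b \<longleftrightarrow> (0 \<le> a \<longrightarrow> b \<le> 1 \<longrightarrow> (\<exists>g \<in> borel_measurable lborel.
      (\<forall>t. g t \<le> ?s t * indicator {a<..<b} t) \<and> ennreal (norm (F (\<gamma> b) - F (\<gamma> a))) \<le> (\<integral>\<^sup>+t. g t \<partial>lborel)))" for a b
  have "P a b"
  proof (rule Bolzano[OF \<open>a \<le> b\<close>])
    fix a b c assume h: "P a b" "P b c" "a \<le> b" "b \<le> c"
    show "P a c" unfolding P_def
    proof (intro impI)
      assume ac: "0 \<le> a" "c \<le> 1"
      obtain g where g: "g \<in> borel_measurable lborel" "\<And>t. g t \<le> ?s t * indicator {a<..<b} t"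
        "ennreal (norm (F (\<gamma> b) - F (\<gamma> a))) \<le> (\<integral>\<^sup>+t. g t \<partial>lborel)"
        using h ac unfolding P_def by fastforce
      obtain k where k: "k \<in> borel_measurable lborel" "\<And>t. k t \<le> ?s t * indicator {b<..<c} t"
        "ennreal (norm (F (\<gamma> c) - F (\<gamma> b))) \<le> (\<integral>\<^sup>+t. k t \<partial>lborel)"
        using h ac unfolding P_def by fastforce
      have "ennreal (norm (F (\<gamma> c) - F (\<gamma> a))) \<le> ennreal (norm (F (\<gamma> b) - F (\<gamma> a)) + norm (F (\<gamma> c) - F (\<gamma> b)))"
        using norm_triangle_ineq[of "F (\<gamma> b) - F (\<gamma> a)" "F (\<gamma> c) - F (\<gamma> b)"] by (intro ennreal_leI) simp
      also have "\<dots> \<le> (\<integral>\<^sup>+t. g t \<partial>lborel) + (\<integral>\<^sup>+t. k t \<partial>lborel)"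
        using add_mono[OF g(3) k(3)] by simp
      finally have 1: "ennreal (norm (F (\<gamma> c) - F (\<gamma> a))) \<le> (\<integral>\<^sup>+t. g t + k t \<partial>lborel)"
        unfolding nn_integral_add[OF g(1) k(1)] .
      have 2: "g t + k t \<le> ?s t * indicator {a<..<c} t" for t
        using g(2)[of t] k(2)[of t] h(3,4) by (cases "t < b"; cases "t = b") (auto simp: indicator_def split: if_splits)
      have 3: "(\<lambda>t. g t + k t) \<in> borel_measurable lborel" using g(1) k(1) by measurable
      show "\<exists>g \<in> borel_measurable lborel. (\<forall>t. g t \<le> ?s t * indicator {a<..<c} t) \<and>
          ennreal (norm (F (\<gamma> c) - F (\<gamma> a))) \<le> (\<integral>\<^sup>+t. g t \<partial>lborel)"
        using 1 2 3 by (intro bexI[of _ "\<lambda>t. g t + k t"]) auto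
    qed
  next
    fix x assume x: "a \<le> x" "x \<le> b"
    then have x01: "x \<in> {0..1}" using assms by auto
    obtain c where c: "c \<in> A" "\<gamma> x \<in> fst c" by (rule ex_chart)
    obtain B where B: "open B" "B \<inter> {0..1} = \<gamma> -` fst c \<inter> {0..1}"
      using cont chart_facts(1)[OF c(1)] unfolding continuous_on_open_invariant by blast
    have "x \<in> B" using B(2) c(2) x01 by blast
    then obtain d where d: "d > 0" "ball x d \<subseteq> B" using B(1) open_contains_ball by blast
    show "\<exists>d>0. \<forall>a b. a \<le> x \<and> x \<le> b \<and> b - a < d \<longrightarrow> P a b"
    proof (intro exI[of _ d] conjI allI impI)
      fix a b assume ab: "a \<le> x \<and> x \<le> b \<and> b - a < d"
      show "P a b" unfolding P_def
      proof (intro impI)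
        assume a: "0 \<le> a" and b: "b \<le> 1"
        have sub: "{a..b} \<subseteq> B \<inter> {0..1}" using d(2) ab a b by (auto simp: dist_real_def subset_eq)
        then have im: "\<gamma> ` {a..b} \<subseteq> fst c" using B(2) by blast
        have aleb: "a \<le> b" using ab by simp
        let ?x = "snd c \<circ> \<gamma>"
        have "?x piecewise_C1_differentiable_on {a..b}"
          using \<gamma> c(1) a b aleb im unfolding piecewise_C1_curve_def by blast
        then obtain S where S: "finite S" "?x C1_differentiable_on {a..b} - S"
          unfolding piecewise_C1_differentiable_on_def by blast
        let ?U = "{a<..<b} - S"
        have U: "open ?U" using S by (simp add: finite_imp_closed open_Diff)
        have "C1_on ?x ?U"
        proof (rule C1_onI)
          fix t assume "t \<in> ?U"
          then have "t \<in> {a..b} - S" by auto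
          then have "(?x has_vector_derivative vector_derivative ?x (at t)) (at t)"
            using S(2) by (simp add: C1_differentiable_on_eq vector_derivative_works)
          then show "(?x has_derivative (\<lambda>h. h *\<^sub>R vector_derivative ?x (at t))) (at t)"
            by (simp add: has_vector_derivative_def)
        next
          have "continuous_on ?U (\<lambda>t. vector_derivative ?x (at t))"
            using S(2) by (auto simp: C1_differentiable_on_eq intro: continuous_on_subset)
          then show "continuous_on ?U (\<lambda>t. v *\<^sub>R vector_derivative ?x (at t))" for v
            by (intro continuous_intros)
        qed
        then have "C1_on (\<lambda>t. in_chart F c (?x t)) ?U"
        proof (rule C1_on_compose[where f = "in_chart F c" and g = ?x, OF C1_F[OF c(1)]])
          fix t assume "t \<in> ?U"
          then have "\<gamma> t \<in> fst c" using im by force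
          then show "?x t \<in> chart_image c" using chart_facts(5)[OF c(1)] by simp
        qed
        then have "C1_on (F \<circ> \<gamma>) ?U"
        proof (rule C1_on_cong[OF U, rotated])
          fix t assume "t \<in> ?U"
          then have "\<gamma> t \<in> fst c" using im by force
          then show "(F \<circ> \<gamma>) t = in_chart F c (?x t)" using chart_facts(6)[OF c(1)] by (simp add: in_chart_def)
        qed
        moreover have "continuous_on {a..b} (F \<circ> \<gamma>)"
          by (rule continuous_on_compose[OF continuous_on_subset[OF cont] continuous_on_subset[OF continuous_F]])
            (use a b in auto)
        ultimately show "\<exists>g \<in> borel_measurable lborel. (\<forall>t. g t \<le> ?s t * indicator {a<..<b} t) \<and>
          ennreal (norm (F (\<gamma> b) - F (\<gamma> a))) \<le> (\<integral>\<^sup>+t. g t \<partial>lborel)"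
          using displacement_le_speed_integral[OF aleb _ S(1), of "F \<circ> \<gamma>"] by simp
      qed
    qed (rule d)
  qed
  then obtain g where g: "\<And>t. g t \<le> ?s t * indicator {a<..<b} t"
    "ennreal (norm (F (\<gamma> b) - F (\<gamma> a))) \<le> (\<integral>\<^sup>+t. g t \<partial>lborel)" using assms unfolding P_def by blast
  note g(2)
  also have "(\<integral>\<^sup>+t. g t \<partial>lborel) \<le> curve_length F \<gamma>"
    unfolding curve_length_def
  proof (rule nn_integral_mono)
    fix t show "g t \<le> ?s t * indicator {0..1} t"
      by (rule order_trans[OF g(1)]) (use assms in \<open>auto simp: indicator_def\<close>)
  qed
  finally show ?thesis .
qed

text \<open>
  Points at small Riemannian distance are close in the topology.  Near \<open>q\<close> the immersion expands coordinate distances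
  from \<open>q\<close> by at least a fixed factor, so a curve that ends at \<open>q\<close> and starts outside a small coordinate ball has a
  point on the bounding sphere whose image is far from \<open>F q\<close>; the length dominates this displacement.
\<close>

lemma riemannian_dist_escape:
  assumes U: "open U" "q \<in> U"
  obtains \<delta> where "0 < \<delta>" "\<And>p. riemannian_dist A F p q < ennreal \<delta> \<Longrightarrow> p \<in> U"
proof -
  obtain c where c: "c \<in> A" "q \<in> fst c" by (rule ex_chart)
  let ?x = "snd c q" and ?\<Omega> = "chart_image c" and ?\<phi> = "in_chart F c"
  let ?D = "frechet_derivative ?\<phi> (at ?x)"
  have x: "?x \<in> ?\<Omega>" "chart_inv c ?x = q" using chart_facts(5,6)[OF c(1)] c(2) by auto
  have "inj ?D" using immersed_patch.immersive[OF patch[OF c(1)] x(1)] .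
  then obtain k where k: "k > 0" "\<And>v. k * norm v \<le> norm (?D v)"
    using linear_inj_bounded_below_pos[OF linear_dF[OF c(1) x(1)]] by blast
  obtain d1 where d1: "d1 > 0" "\<And>y. norm (y - ?x) < d1 \<Longrightarrow> norm (?\<phi> y - ?\<phi> ?x - ?D (y - ?x)) \<le> k / 2 * norm (y - ?x)"
    using C1_on_has_derivative[OF C1_F[OF c(1)] x(1)] k(1) unfolding has_derivative_at_alt
    by (meson half_gt_zero)
  have below: "k / 2 * norm (y - ?x) \<le> norm (?\<phi> y - ?\<phi> ?x)" if "norm (y - ?x) < d1" for y
    using k(2)[of "y - ?x"] d1(2)[OF that] norm_triangle_ineq2[of "?D (y - ?x)" "?D (y - ?x) - (?\<phi> y - ?\<phi> ?x)"]
    by (simp add: norm_minus_commute)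
  have "open (?\<Omega> \<inter> chart_inv c -` U)"
    using continuous_on_open_vimage[OF chart_facts(2)[OF c(1)]] chart_facts(4)[OF c(1)] U(1) by (metis Int_commute)
  then obtain d2 where d2: "d2 > 0" "cball ?x d2 \<subseteq> ?\<Omega> \<inter> chart_inv c -` U"
    using x U(2) open_contains_cball by (metis IntI vimageI)
  \<comment> \<open>inside radius \<open>d1\<close> the immersion expands distances from the centre by at least \<open>k / 2\<close>\<close>
  define r where "r = min (d1 / 2) d2"
  have r: "r > 0" "r < d1" "r \<le> d2" using d1 d2 by (auto simp: r_def)
  let ?N = "chart_inv c ` ball ?x r" and ?C = "chart_inv c ` cball ?x r"
  have sub: "cball ?x r \<subseteq> ?\<Omega>" using r d2 by (auto simp: subset_eq)
  have N: "open ?N" by (intro open_image_chart_inv c(1) open_ball order_trans[OF ball_subset_cball sub])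
  have C: "closed ?C" using sub by (intro compact_imp_closed compact_image_chart_inv c compact_cball)
  have CU: "?C \<subseteq> U" using r d2 by (auto simp: subset_eq)
  show ?thesis
  proof
    show "0 < k / 2 * r" using k r by simp
    fix p assume "riemannian_dist A F p q < ennreal (k / 2 * r)"
    then obtain \<gamma> where \<gamma>: "piecewise_C1_curve A \<gamma>" "\<gamma> 0 = p" "\<gamma> 1 = q" "curve_length F \<gamma> < ennreal (k / 2 * r)"
      unfolding riemannian_dist_def INF_less_iff by blast
    show "p \<in> U"
    proof (rule ccontr)
      assume "p \<notin> U"
      then have pC: "p \<notin> ?C" using CU by blast
      have qN: "q \<in> ?N" using x r by (intro image_eqI[of _ _ ?x]) auto
      have "connected (\<gamma> ` {0..1})"
        using \<gamma>(1) by (intro connected_continuous_image) (auto simp: piecewise_C1_curve_def)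
      moreover have "?N \<inter> - ?C \<inter> \<gamma> ` {0..1} = {}" by auto
      moreover have "?N \<inter> \<gamma> ` {0..1} \<noteq> {}" using qN \<gamma>(3) by force
      moreover have "- ?C \<inter> \<gamma> ` {0..1} \<noteq> {}" using pC \<gamma>(2) by force
      ultimately have "\<not> \<gamma> ` {0..1} \<subseteq> ?N \<union> - ?C"
        using N C unfolding connected_def by (metis open_Compl)
      then obtain t where t01: "t \<in> {0..1}" and "\<gamma> t \<notin> ?N \<union> - ?C" by (meson image_subsetI)
      then have t: "\<gamma> t \<in> ?C" "\<gamma> t \<notin> ?N" by (simp_all only: Un_iff Compl_iff de_Morgan_disj not_not simp_thms)
      from t(1) obtain y where y: "\<gamma> t = chart_inv c y" "y \<in> cball ?x r" by (rule imageE)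
      moreover have "y \<notin> ball ?x r" using t(2) unfolding y(1) by (meson imageI)
      ultimately have ny: "norm (y - ?x) = r" by (simp add: dist_norm norm_minus_commute)
      have "k / 2 * r \<le> norm (?\<phi> y - ?\<phi> ?x)" using below[of y] ny r by simp
      also have "?\<phi> y - ?\<phi> ?x = F (\<gamma> t) - F (\<gamma> 1)" using y x \<gamma>(3) by (simp add: in_chart_def)
      finally have "ennreal (k / 2 * r) \<le> ennreal (norm (F (\<gamma> 1) - F (\<gamma> t)))"
        by (intro ennreal_leI) (simp add: norm_minus_commute)
      also have "\<dots> \<le> curve_length F \<gamma>"
        by (rule displacement_le_curve_length[OF \<gamma>(1)]) (use t01 in auto)
      finally show False using \<gamma>(4) by simp
    qed
  qed
qed

definition precompact_ball :: "'a \<Rightarrow> real \<Rightarrow> bool" where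
  "precompact_ball p r \<longleftrightarrow> (\<exists>K. compact K \<and> {q. joined p q r} \<subseteq> K)"

lemma precompact_ball_mono:
  assumes "precompact_ball p r" "s \<le> r" shows "precompact_ball p s"
proof -
  have "{x. joined p x s} \<subseteq> {x. joined p x r}" using joined_mono[OF _ assms(2)] by auto
  then show ?thesis using assms(1) unfolding precompact_ball_def by (meson order_trans)
qed

lemma precompact_ball_shift:
  assumes "precompact_ball p (l + r)" "joined p q l" shows "precompact_ball q r"
proof -
  have "{x. joined q x r} \<subseteq> {x. joined p x (l + r)}" using joined_trans[OF _ assms(2)] by auto
  then show ?thesis using assms(1) unfolding precompact_ball_def by (meson order_trans)
qed

lemma ex_precompact_ball:
  obtains r where "0 < r" "precompact_ball q r"
proof -
  obtain c where c: "c \<in> A" "q \<in> fst c" by (rule ex_chart)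
  let ?x = "snd c q"
  have x: "?x \<in> chart_image c" "chart_inv c ?x = q" using chart_facts(5,6)[OF c(1)] c(2) by auto
  obtain d where d: "d > 0" "cball ?x d \<subseteq> chart_image c"
    using open_contains_cball x(1) chart_facts(2)[OF c(1)] by blast
  have o: "open (chart_inv c ` ball ?x d)"
    by (intro open_image_chart_inv c(1) open_ball order_trans[OF ball_subset_cball d(2)])
  have "q \<in> chart_inv c ` ball ?x d" using x d by (intro image_eqI[of _ _ ?x]) auto
  from riemannian_dist_escape[OF o this] obtain \<delta> where
    \<delta>: "0 < \<delta>" "\<And>p. riemannian_dist A F p q < ennreal \<delta> \<Longrightarrow> p \<in> chart_inv c ` ball ?x d" by blast
  have "p \<in> chart_inv c ` cball ?x d" if "joined q p (\<delta> / 2)" for p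
  proof -
    have "riemannian_dist A F p q \<le> ennreal (\<delta> / 2 + \<delta> / 4)"
      by (rule riemannian_dist_le_joined[OF joined_sym[OF that]]) (use \<delta> in simp)
    also have "\<dots> < ennreal \<delta>" using \<delta>(1) by (intro ennreal_lessI) auto
    finally show ?thesis using \<delta>(2)[of p] by (metis ball_subset_cball image_mono subsetD)
  qed
  then have "precompact_ball q (\<delta> / 2)"
    unfolding precompact_ball_def using compact_image_chart_inv[OF c(1) compact_cball d(2)] by blast
  then show ?thesis using that[of "\<delta> / 2"] \<delta>(1) by simp
qed

text \<open>
  If all points within cost \<open>s\<close> of \<open>x\<close> have precompact balls of radius \<open>s / 2\<close>, then so does \<open>x\<close> with radius \<open>s\<close>.
  Otherwise let \<open>m \<le> s\<close> be the supremum of the good radii of \<open>x\<close>.  The closure of the ball of radius slightly below \<open>m\<close> is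
  compact, hence covered by finitely many small balls, and slightly larger balls around their centres are still
  precompact and cover a ball around \<open>x\<close> of radius more than \<open>m\<close>.
\<close>

lemma extend_precompact_ball:
  assumes s: "0 < s" and near: "\<And>y. joined x y s \<Longrightarrow> precompact_ball y (s / 2)"
  shows "precompact_ball x s"
proof (rule ccontr)
  assume n: "\<not> precompact_ball x s"
  obtain r0 where r0: "0 < r0" "precompact_ball x r0" by (rule ex_precompact_ball)
  let ?S = "{r. 0 < r \<and> precompact_ball x r}"
  define m where "m = Sup ?S"
  have bd: "r \<le> s" if "r \<in> ?S" for r
    using that n precompact_ball_mono[of x r s] by force
  then have bdd: "bdd_above ?S" by (meson bdd_above.I)
  have m: "0 < m" "m \<le> s"
  proof -
    have "r0 \<le> m" unfolding m_def using r0 bdd by (intro cSup_upper) auto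
    then show "0 < m" using r0 by simp
    show "m \<le> s" unfolding m_def by (rule cSup_least) (use r0 bd in auto)
  qed
  \<comment> \<open>16 leaves room for all margins: a cover by balls of radius \<open>e\<close>, enlarged to \<open>6 e\<close>, passes from \<open>m - e\<close> to \<open>m + e\<close>\<close>
  define e where "e = m / 16"
  have e: "e > 0" "16 * e = m" using m by (auto simp: e_def)
  obtain r where r: "0 < r" "precompact_ball x r" "m - e < r"
    using less_cSupE[of "m - e" ?S] e r0 unfolding m_def by auto
  have "precompact_ball x (m - e)" using precompact_ball_mono r by (meson less_imp_le)
  then obtain K where K: "compact K" "{q. joined x q (m - e)} \<subseteq> K" unfolding precompact_ball_def by blast
  let ?B = "closure {q. joined x q (m - e)}"
  have cB: "compact ?B"
    using K compact_Int_closed[OF K(1), of ?B] closure_minimal[OF K(2) compact_imp_closed[OF K(1)]]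
    by (simp add: inf_absorb2)
  have "\<exists>U. open U \<and> z \<in> U \<and> (\<forall>p\<in>U. joined z p e)" for z
    by (rule joined_nearby[OF e(1), of z]) blast
  then obtain U where U: "\<And>z. open (U z)" "\<And>z. z \<in> U z" "\<And>z p. p \<in> U z \<Longrightarrow> joined z p e" by metis
  obtain Z where Z: "Z \<subseteq> ?B" "finite Z" "?B \<subseteq> (\<Union>z\<in>Z. U z)"
    using compactE_image[OF cB, of ?B U] U by blast
  have "precompact_ball z (6 * e)" if z: "z \<in> Z" for z
  proof -
    have "z \<in> ?B" using z Z by blast
    then obtain y where y: "joined x y (m - e)" "y \<in> U z"
      using open_Int_closure_eq_empty[OF U(1)[of z], of "{q. joined x q (m - e)}"] U(2)[of z] by blast
    have "joined x y s" by (rule joined_mono[OF y(1)]) (use m e in simp)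
    then have "precompact_ball y (s / 2)" by (rule near)
    then have "precompact_ball y (e + 6 * e)" by (rule precompact_ball_mono) (use m e in simp)
    then show ?thesis by (rule precompact_ball_shift[OF _ joined_sym[OF U(3)[OF y(2)]]])
  qed
  then obtain C where C: "\<And>z. z \<in> Z \<Longrightarrow> compact (C z)" "\<And>z. z \<in> Z \<Longrightarrow> {q. joined z q (6 * e)} \<subseteq> C z"
    unfolding precompact_ball_def by metis
  have "{q. joined x q (m + e)} \<subseteq> (\<Union>z\<in>Z. C z)"
  proof
    fix q assume "q \<in> {q. joined x q (m + e)}"
    then obtain y where y: "joined x y (m - e)" "joined y q (m + e - (m - e))"
      using joined_split[of x q "m + e" "m - e"] e by auto
    have "y \<in> ?B" by (rule subsetD[OF closure_subset]) (simp add: y(1))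
    then obtain z where z: "z \<in> Z" "y \<in> U z" using Z(3) by (meson UN_E subsetD)
    have "joined z q (e + (m + e - (m - e)))" by (rule joined_trans[OF y(2) U(3)[OF z(2)]])
    then have "joined z q (6 * e)" by (rule joined_mono) (use e in simp)
    then show "q \<in> (\<Union>z\<in>Z. C z)" using C(2)[OF z(1)] z(1) by blast
  qed
  moreover have "compact (\<Union>z\<in>Z. C z)" using Z(2) C(1) by blast
  ultimately have "m + e \<in> ?S" using m e unfolding precompact_ball_def by auto
  then have "m + e \<le> m" unfolding m_def using bdd by (intro cSup_upper)
  then show False using e by simp
qed

text \<open>
  The Hopf--Rinow theorem.  If a ball were not precompact, the preceding lemma would give a sequence of points with
  steps of cost \<open>R / 2\<^sup>n\<close> whose balls of radius \<open>R / 2\<^sup>n\<close> are not precompact either.  The sequence is Cauchy for the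
  Riemannian distance, and its limit has a precompact ball of some positive radius, which contains the small balls
  around late members of the sequence.
\<close>

theorem complete_imp_precompact_balls:
  assumes complete: "complete_immersion A F" and R: "0 < R"
  shows "precompact_ball p R"
proof (rule ccontr)
  assume n: "\<not> precompact_ball p R"
  have "\<exists>y. joined x y (R / 2 ^ n) \<and> \<not> precompact_ball y (R / 2 ^ Suc n)"
    if "\<not> precompact_ball x (R / 2 ^ n)" for x n
    using extend_precompact_ball[of "R / 2 ^ n" x] that R by (auto simp: field_simps)
  then obtain s where s: "\<And>n. \<not> precompact_ball (s n) (R / 2 ^ n)"
    "\<And>n. joined (s n) (s (Suc n)) (R / 2 ^ n)"
    using dependent_nat_choice[of "\<lambda>n x. \<not> precompact_ball x (R / 2 ^ n)"
        "\<lambda>n x y. joined x y (R / 2 ^ n)"] n by (metis div_by_1 power_0)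
  \<comment> \<open>the steps form a geometric series\<close>
  have far: "joined (s i) (s (i + k)) (2 * R / 2 ^ i - 2 * R / 2 ^ (i + k))" for i k
  proof (induction k)
    case 0
    then show ?case by (simp add: joined_refl)
  next
    case (Suc k)
    have "joined (s i) (s (i + Suc k)) ((2 * R / 2 ^ i - 2 * R / 2 ^ (i + k)) + R / 2 ^ (i + k))"
      using joined_trans[OF s(2)[of "i + k"] Suc.IH] by simp
    moreover have "(2 * R / 2 ^ i - 2 * R / 2 ^ (i + k)) + R / 2 ^ (i + k) = 2 * R / 2 ^ i - 2 * R / 2 ^ (i + Suc k)"
      by (simp add: field_simps)
    ultimately show ?case by simp
  qed
  have small: "\<exists>N. \<forall>i\<ge>N. 2 * R / 2 ^ i < e" if "e > 0" for e :: real
  proof -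
    have "(\<lambda>i. 2 * R * (1 / 2) ^ i) \<longlonglongrightarrow> 2 * R * 0"
      by (intro tendsto_mult_left LIMSEQ_realpow_zero) auto
    then have "\<forall>\<^sub>F i in sequentially. 2 * R * (1 / 2) ^ i < e" using that by (intro order_tendstoD) auto
    then show ?thesis by (simp add: eventually_sequentially power_divide)
  qed
  have near: "joined (s i) (s j) (2 * R / 2 ^ N)" if "N \<le> i" "N \<le> j" for N i j
  proof -
    have A: "joined (s i) (s j) (2 * R / 2 ^ N)" if "N \<le> i" "i \<le> j" for i j
    proof -
      have "2 * R / 2 ^ i \<le> 2 * R / 2 ^ N" using that R by (intro divide_left_mono) (auto simp: power_increasing)
      moreover have "0 \<le> 2 * R / 2 ^ j" using R by simp
      moreover have "joined (s i) (s j) (2 * R / 2 ^ i - 2 * R / 2 ^ j)" using far[of i "j - i"] that by simp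
      ultimately show ?thesis using joined_mono[of "s i" "s j" "2 * R / 2 ^ i - 2 * R / 2 ^ j" "2 * R / 2 ^ N"] by linarith
    qed
    show ?thesis using A[of i j] A[of j i] joined_sym that by (cases "i \<le> j") auto
  qed
  have "\<forall>e>0. \<exists>N. \<forall>i\<ge>N. \<forall>j\<ge>N. riemannian_dist A F (s i) (s j) < e"
  proof (intro allI impI)
    fix e :: ennreal assume "e > 0"
    then obtain x where x: "0 < x" "x < e" using dense by blast
    then have "x < top" by (meson less_le_trans top_greatest)
    with x have e': "enn2real x > 0" "ennreal (enn2real x) < e" by (simp_all add: enn2real_positive_iff)
    let ?e' = "enn2real x"
    obtain N where N: "\<And>i. i \<ge> N \<Longrightarrow> 2 * R / 2 ^ i < ?e' / 2" using small[of "?e' / 2"] e' by auto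
    have "riemannian_dist A F (s i) (s j) < e" if "i \<ge> N" "j \<ge> N" for i j
    proof -
      have "riemannian_dist A F (s i) (s j) \<le> ennreal (2 * R / 2 ^ N + ?e' / 2)"
        by (rule riemannian_dist_le_joined[OF near[OF that]]) (use e' in simp)
      also have "\<dots> \<le> ennreal ?e'" using N[of N] by (intro ennreal_leI) simp
      finally show ?thesis using e' by (meson order.strict_trans1)
    qed
    then show "\<exists>N. \<forall>i\<ge>N. \<forall>j\<ge>N. riemannian_dist A F (s i) (s j) < e" by blast
  qed
  then have "\<exists>l. \<forall>e>0. \<exists>N. \<forall>i\<ge>N. riemannian_dist A F (s i) l < e"
    by (rule complete[unfolded complete_immersion_def, THEN spec[of _ s], THEN mp])
  then obtain l where l: "\<And>e. e > 0 \<Longrightarrow> \<exists>N. \<forall>i\<ge>N. riemannian_dist A F (s i) l < e" by blast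
  obtain r where r: "0 < r" "precompact_ball l r" by (rule ex_precompact_ball)
  have r2: "0 < r / 2" using r by simp
  obtain U where U: "open U" "l \<in> U" "\<And>q. q \<in> U \<Longrightarrow> joined l q (r / 2)"
    by (rule joined_nearby[OF r2, of l]) blast
  obtain \<delta> where \<delta>: "0 < \<delta>" "\<And>q. riemannian_dist A F q l < ennreal \<delta> \<Longrightarrow> q \<in> U"
    by (rule riemannian_dist_escape[OF U(1,2)]) blast
  obtain N where N: "\<And>i. i \<ge> N \<Longrightarrow> riemannian_dist A F (s i) l < ennreal \<delta>"
    using l[of "ennreal \<delta>"] \<delta>(1) by (metis ennreal_less_zero_iff)
  obtain M where M: "\<And>i. i \<ge> M \<Longrightarrow> 2 * R / 2 ^ i < r / 2" using small[of "r / 2"] r by auto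
  let ?i = "max N M"
  have "joined l (s ?i) (r / 2)" by (rule U(3)[OF \<delta>(2)[OF N]]) simp
  then have "precompact_ball (s ?i) (r / 2)" using precompact_ball_shift[of l "r / 2" "r / 2"] r by simp
  moreover have "R / 2 ^ ?i \<le> r / 2"
    using M[of ?i] R mult_right_mono[of 1 2 "R / 2 ^ ?i"] by simp
  ultimately show False using s(1)[of ?i] precompact_ball_mono[of "s ?i" "r / 2" "R / 2 ^ ?i"] by blast
qed

end


section \<open>Cutoffs, transition maps and gradients\<close>

context immersed_manifold
begin

text \<open>
  The function \<open>max 0 (1 - d / R)\<close>, where \<open>d\<close> is the infimum of the costs of chains from \<open>p\<close>.  Writing it as a supremum
  that includes 0 covers the points that no chain reaches.  Its support is compact by completeness.
\<close>

lemma ex_cutoff: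
  assumes complete: "complete_immersion A F" and R: "0 < R"
  obtains \<phi> :: "'a \<Rightarrow> real" and K where
    "\<And>x. 0 \<le> \<phi> x" "\<And>x. \<phi> x \<le> 1" "\<And>x y l. joined x y l \<Longrightarrow> \<bar>\<phi> y - \<phi> x\<bar> \<le> l / R"
    "compact K" "\<And>x. x \<notin> K \<Longrightarrow> \<phi> x = 0" "\<And>x l. joined p x l \<Longrightarrow> 1 - l / R \<le> \<phi> x"
proof -
  obtain K where K: "compact K" "{q. joined p q R} \<subseteq> K"
    using complete_imp_precompact_balls[OF complete R, of p] unfolding precompact_ball_def by blast
  define S where "S x = insert 0 {1 - l / R |l. joined p x l}" for x
  define \<phi> where "\<phi> x = Sup (S x)" for x
  have ub: "s \<le> 1" if "s \<in> S x" for s x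
    using that joined_nonneg[of p x] R by (auto simp: S_def)
  have bdd: "bdd_above (S x)" for x using ub by (rule bdd_aboveI)
  have up: "s \<le> \<phi> x" if "s \<in> S x" for s x unfolding \<phi>_def using that bdd by (rule cSup_upper)
  have least: "\<phi> x \<le> b" if "\<And>s. s \<in> S x \<Longrightarrow> s \<le> b" for x b
    unfolding \<phi>_def by (rule cSup_least) (use that in \<open>auto simp: S_def\<close>)
  have pos: "0 \<le> \<phi> x" for x by (rule up) (simp add: S_def)
  have lip: "\<phi> x - l / R \<le> \<phi> y" if "joined x y l" for x y l
  proof -
    have l: "0 \<le> l / R" using joined_nonneg[OF that] R by simp
    have "\<phi> x \<le> \<phi> y + l / R"
    proof (rule least)
      fix s assume s: "s \<in> S x"
      show "s \<le> \<phi> y + l / R"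
      proof (cases "s = 0")
        case True
        then show ?thesis using pos[of y] l by simp
      next
        case False
        then obtain k where k: "s = 1 - k / R" "joined p x k" using s by (auto simp: S_def)
        have "1 - (k + l) / R \<in> S y" using joined_trans[OF that k(2)] by (auto simp: S_def)
        then show ?thesis using up[of "1 - (k + l) / R" y] k(1) by (simp add: add_divide_distrib)
      qed
    qed
    then show ?thesis by simp
  qed
  show ?thesis
  proof (rule that[of \<phi> K])
    show "0 \<le> \<phi> x" "\<phi> x \<le> 1" for x using pos least ub by auto
    show "\<bar>\<phi> y - \<phi> x\<bar> \<le> l / R" if "joined x y l" for x y l
      using lip[OF that] lip[OF joined_sym[OF that]] by linarith
    show "compact K" by (rule K)
    show "\<phi> x = 0" if x: "x \<notin> K" for x
    proof (rule antisym[OF least pos])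
      fix s assume s: "s \<in> S x"
      show "s \<le> 0"
      proof (rule ccontr)
        assume "\<not> s \<le> 0"
        then obtain l where l: "s = 1 - l / R" "joined p x l" using s by (auto simp: S_def)
        have "l / R < 1" using l(1) \<open>\<not> s \<le> 0\<close> by simp
        then have "l \<le> R" using R by (simp add: field_simps)
        from joined_mono[OF l(2) this] K(2) x show False by blast
      qed
    qed
    show "1 - l / R \<le> \<phi> x" if "joined p x l" for x l
      by (rule up) (use that in \<open>auto simp: S_def\<close>)
  qed
qed

lemma continuous_of_joined_Lipschitz:
  fixes \<phi> :: "'a \<Rightarrow> real"
  assumes R: "0 < R" and lip: "\<And>x y l. joined x y l \<Longrightarrow> \<bar>\<phi> y - \<phi> x\<bar> \<le> l / R"
  shows "continuous_on UNIV \<phi>"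
  unfolding continuous_on_eq_continuous_at[OF open_UNIV] continuous_at tendsto_iff
proof (intro ballI allI impI)
  fix x and e :: real assume "0 < e"
  then have e: "0 < e * R / 2" using R by simp
  obtain U where U: "open U" "x \<in> U" "\<And>y. y \<in> U \<Longrightarrow> joined x y (e * R / 2)"
    by (rule joined_nearby[OF e, of x]) blast
  have "dist (\<phi> y) (\<phi> x) < e" if "y \<in> U" for y
  proof -
    have "\<bar>\<phi> y - \<phi> x\<bar> \<le> e * R / 2 / R" by (rule lip[OF U(3)[OF that]])
    also have "\<dots> < e" using R \<open>0 < e\<close> by simp
    finally show ?thesis by (simp add: dist_real_def)
  qed
  then show "\<forall>\<^sub>F y in at x. dist (\<phi> y) (\<phi> x) < e"
    unfolding eventually_at_topological using U(1,2) by blast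
qed

definition overlap :: "('a, 'm) chart \<Rightarrow> ('a, 'm) chart \<Rightarrow> (real^'m) set" where
  "overlap c d = snd c ` (fst c \<inter> fst d)"

abbreviation transition :: "('a, 'm) chart \<Rightarrow> ('a, 'm) chart \<Rightarrow> real^'m \<Rightarrow> real^'m" where
  "transition c d \<equiv> snd d \<circ> chart_inv c"

lemma overlap_iff:
  assumes c: "c \<in> A" shows "x \<in> overlap c d \<longleftrightarrow> x \<in> chart_image c \<and> chart_inv c x \<in> fst d"
  unfolding overlap_def
proof
  assume "x \<in> snd c ` (fst c \<inter> fst d)"
  then show "x \<in> chart_image c \<and> chart_inv c x \<in> fst d" using chart_facts(5,6)[OF c] by auto
next
  assume "x \<in> chart_image c \<and> chart_inv c x \<in> fst d"
  then show "x \<in> snd c ` (fst c \<inter> fst d)"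
    using chart_facts(7,8)[OF c, of x] by (intro image_eqI[of _ _ "chart_inv c x"]) auto
qed

lemma open_overlap:
  assumes c: "c \<in> A" and d: "d \<in> A" shows "open (overlap c d)"
proof -
  have "open (chart_inv c -` fst d \<inter> chart_image c)"
    using continuous_on_open_vimage[OF chart_facts(2)[OF c]] chart_facts(4)[OF c] chart_facts(1)[OF d] by blast
  moreover have "overlap c d = chart_inv c -` fst d \<inter> chart_image c"
    using overlap_iff[OF c, of _ d] by auto
  ultimately show ?thesis by simp
qed

lemma C1_transition: "c \<in> A \<Longrightarrow> d \<in> A \<Longrightarrow> C1_on (transition c d) (overlap c d)"
  using atlas unfolding oriented_smooth_atlas_def smooth_on_def C1_on_def overlap_def by blast

lemma transition_in: "c \<in> A \<Longrightarrow> d \<in> A \<Longrightarrow> x \<in> overlap c d \<Longrightarrow> transition c d x \<in> chart_image d"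
  using chart_facts(5)[of d "chart_inv c x"] overlap_iff[of c x d] by simp

lemma chart_inv_transition:
  "c \<in> A \<Longrightarrow> d \<in> A \<Longrightarrow> x \<in> overlap c d \<Longrightarrow> chart_inv d (transition c d x) = chart_inv c x"
  using chart_facts(6)[of d "chart_inv c x"] overlap_iff[of c x d] by simp

lemma det_transition_nz:
  assumes "c \<in> A" "d \<in> A" "x \<in> overlap c d"
  shows "det (matrix (frechet_derivative (transition c d) (at x))) \<noteq> 0"
proof -
  have "\<forall>p \<in> snd c ` (fst c \<inter> fst d). 0 < det (jacobian (transition c d) (at p))"
    using atlas assms(1,2) unfolding oriented_smooth_atlas_def by blast
  from bspec[OF this assms(3)[unfolded overlap_def]] show ?thesis by (simp add: jacobian_def)
qed

lemma surj_transition_derivative: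
  assumes "c \<in> A" "d \<in> A" "x \<in> overlap c d"
  shows "surj (frechet_derivative (transition c d) (at x))"
proof -
  have l: "linear (frechet_derivative (transition c d) (at x))"
    using C1_on_has_derivative[OF C1_transition[OF assms(1,2)] assms(3)] by (rule has_derivative_linear)
  then have "inj (frechet_derivative (transition c d) (at x))"
    using det_nz_iff_inj det_transition_nz[OF assms] by blast
  then show ?thesis using l linear_injective_imp_surjective by blast
qed

text \<open>
  The chain rule between two charts; \<open>a\<close> may be a scalar function or the immersion itself.
\<close>

lemma frechet_derivative_transition:
  fixes a :: "'a \<Rightarrow> 'b::real_normed_vector"
  assumes c: "c \<in> A" "d \<in> A" and x: "x \<in> overlap c d" and a: "C1_on (in_chart a d) (chart_image d)"
  shows "frechet_derivative (in_chart a c) (at x) v =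
    frechet_derivative (in_chart a d) (at (transition c d x)) (frechet_derivative (transition c d) (at x) v)"
proof -
  have "frechet_derivative (in_chart a c) (at x) = frechet_derivative (\<lambda>y. in_chart a d (transition c d y)) (at x)"
    by (rule frechet_derivative_cong_open[OF open_overlap[OF c] x])
      (use chart_inv_transition[OF c] in \<open>simp add: in_chart_def\<close>)
  moreover have "((\<lambda>y. in_chart a d (transition c d y)) has_derivative
     (\<lambda>v. frechet_derivative (in_chart a d) (at (transition c d x)) (frechet_derivative (transition c d) (at x) v))) (at x)"
    by (rule has_derivative_compose[OF C1_on_has_derivative[OF C1_transition[OF c] x]
        C1_on_has_derivative[OF a transition_in[OF c x]]])
  ultimately show ?thesis using frechet_derivative_at by metis
qed

definition C1_function :: "('a \<Rightarrow> real) \<Rightarrow> bool" where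
  "C1_function a \<longleftrightarrow> C_k_function 1 A a"

lemma C1_functionD: "C1_function a \<Longrightarrow> c \<in> A \<Longrightarrow> C1_on (in_chart a c) (chart_image c)"
  by (simp add: C1_function_def C_k_function_def C1_on_def)

lemma C1_functionI: "(\<And>c. c \<in> A \<Longrightarrow> C1_on (in_chart a c) (chart_image c)) \<Longrightarrow> C1_function a"
  by (simp add: C1_function_def C_k_function_def C1_on_def)

lemma continuous_from_charts:
  fixes a :: "'a \<Rightarrow> 'b::topological_space"
  assumes "\<And>c. c \<in> A \<Longrightarrow> continuous_on (chart_image c) (in_chart a c)"
  shows "continuous_on UNIV a"
proof -
  have "continuous_on (fst c) a" if c: "c \<in> A" for c
  proof -
    have "continuous_on (fst c) (\<lambda>p. in_chart a c (snd c p))"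
      by (rule continuous_on_compose2[OF assms[OF c] chart_facts(3)[OF c]]) (auto intro: chart_facts(5)[OF c])
    then show ?thesis by (rule continuous_on_eq) (simp add: in_chart_def chart_facts(6)[OF c])
  qed
  then have "continuous_on (\<Union>c\<in>A. fst c) a" by (intro continuous_on_open_UN) (auto simp: chart_facts(1))
  then show ?thesis using atlas by (simp add: oriented_smooth_atlas_def)
qed

lemma C1_function_continuous: "C1_function a \<Longrightarrow> continuous_on UNIV a"
  by (intro continuous_from_charts C1_on_continuous C1_functionD)

text \<open>
  The gradient as a vector of the ambient space, tangent to the immersion.  In this form it does not depend on the
  chart, whose choice is therefore immaterial.
\<close>

definition mgrad :: "('a \<Rightarrow> real) \<Rightarrow> 'a \<Rightarrow> 'e" where
  "mgrad a p = (let c = (SOME c. c \<in> A \<and> p \<in> fst c); x = snd c p in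
     frechet_derivative (in_chart F c) (at x) (grad (in_chart F c) (in_chart a c) x))"

lemma tangent_space_transition:
  assumes c: "c \<in> A" "d \<in> A" and x: "x \<in> overlap c d"
  shows "tangent_space (in_chart F c) x = tangent_space (in_chart F d) (transition c d x)"
proof -
  let ?t = "frechet_derivative (transition c d) (at x)"
    and ?J = "frechet_derivative (in_chart F d) (at (transition c d x))"
  have "range (\<lambda>v. ?J (?t v)) = ?J ` range ?t" by (rule image_image[symmetric])
  then show ?thesis
    unfolding tangent_space_def frechet_derivative_transition[OF c x C1_F[OF c(2)]]
    by (simp add: surj_transition_derivative[OF c x])
qed

text \<open>
  In both charts the pushed forward gradient lies in the same tangent space and represents the same differential,
  so \<open>tangent_unique\<close> identifies the two.
\<close>

lemma mgrad_chart:
  assumes a: "C1_function a" and d: "d \<in> A" and y: "y \<in> chart_image d"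
  shows "mgrad a (chart_inv d y) = frechet_derivative (in_chart F d) (at y) (grad (in_chart F d) (in_chart a d) y)"
proof -
  define c where "c = (SOME c. c \<in> A \<and> chart_inv d y \<in> fst c)"
  have "\<exists>c. c \<in> A \<and> chart_inv d y \<in> fst c" by (meson ex_chart)
  then have c: "c \<in> A" "chart_inv d y \<in> fst c" unfolding c_def by (metis (mono_tags, lifting) someI_ex)+
  define x where "x = snd c (chart_inv d y)"
  have x: "x \<in> chart_image c" "chart_inv c x = chart_inv d y" using chart_facts(5,6)[OF c(1)] c(2) by (auto simp: x_def)
  have xo: "x \<in> overlap c d" using x chart_facts(7)[OF d y] by (simp add: overlap_iff[OF c(1)])
  have ty: "transition c d x = y" using x chart_facts(8)[OF d y] by simp
  interpret C: immersed_patch "in_chart F c" "chart_image c" by (rule patch[OF c(1)])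
  interpret D: immersed_patch "in_chart F d" "chart_image d" by (rule patch[OF d])
  let ?C = "C.J x (grad (in_chart F c) (in_chart a c) x)" and ?D = "D.J y (grad (in_chart F d) (in_chart a d) y)"
  have "?C = ?D"
  proof (rule C.tangent_unique[OF x(1)])
    show "?C \<in> tangent_space (in_chart F c) x" by (simp add: tangent_space_def)
    show "?D \<in> tangent_space (in_chart F c) x"
      unfolding tangent_space_transition[OF c(1) d xo] ty by (simp add: tangent_space_def)
    fix X
    let ?X = "frechet_derivative (transition c d) (at x) X"
    have "?D \<bullet> C.J x X = ?D \<bullet> D.J y ?X"
      unfolding frechet_derivative_transition[OF c(1) d xo C1_F[OF d]] ty ..
    also have "\<dots> = frechet_derivative (in_chart a d) (at y) ?X"
      by (rule D.inner_grad[OF y C1_on_differentiable[OF C1_functionD[OF a d] y]])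
    also have "\<dots> = frechet_derivative (in_chart a c) (at x) X"
      unfolding frechet_derivative_transition[OF c(1) d xo C1_functionD[OF a d]] ty ..
    also have "\<dots> = ?C \<bullet> C.J x X"
      by (rule C.inner_grad[symmetric, OF x(1) C1_on_differentiable[OF C1_functionD[OF a c(1)] x(1)]])
    finally show "?C \<bullet> C.J x X = ?D \<bullet> C.J x X" by simp
  qed
  then show ?thesis unfolding mgrad_def Let_def c_def[symmetric] x_def[symmetric] .
qed

lemma inner_mgrad:
  assumes a: "C1_function a" and d: "d \<in> A" and y: "y \<in> chart_image d"
  shows "mgrad a (chart_inv d y) \<bullet> frechet_derivative (in_chart F d) (at y) X = frechet_derivative (in_chart a d) (at y) X"
  unfolding mgrad_chart[OF assms]
  by (rule immersed_patch.inner_grad[OF patch[OF d] y C1_on_differentiable[OF C1_functionD[OF a d] y]])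

lemma continuous_mgrad:
  assumes a: "C1_function a" shows "continuous_on UNIV (mgrad a)"
proof (rule continuous_from_charts)
  fix c assume c: "c \<in> A"
  have "continuous_on (chart_image c) (\<lambda>y. frechet_derivative (in_chart F c) (at y) (grad (in_chart F c) (in_chart a c) y))"
    by (rule continuous_on_frechet_derivative[OF C1_F[OF c] continuous_on_id])
      (auto intro: immersed_patch.continuous_grad[OF patch[OF c] C1_functionD[OF a c]])
  then show "continuous_on (chart_image c) (in_chart (mgrad a) c)"
    by (rule continuous_on_eq) (simp add: in_chart_def mgrad_chart[OF a c, unfolded in_chart_def])
qed

lemma mgrad_locally_constant:
  assumes a: "C1_function a" and U: "open U" "p \<in> U" "\<And>q. q \<in> U \<Longrightarrow> a q = k"
  shows "mgrad a p = 0"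
proof -
  obtain c where c: "c \<in> A" "p \<in> fst c" by (rule ex_chart)
  let ?x = "snd c p"
  have x: "?x \<in> chart_image c" "chart_inv c ?x = p" using chart_facts(5,6)[OF c(1)] c(2) by auto
  have "open (chart_inv c -` U \<inter> chart_image c)"
    using continuous_on_open_vimage[OF chart_facts(2)[OF c(1)]] chart_facts(4)[OF c(1)] U(1) by blast
  then have "frechet_derivative (in_chart a c) (at ?x) = frechet_derivative (\<lambda>_. k) (at ?x)"
    by (rule frechet_derivative_cong_open) (use x U in \<open>auto simp: in_chart_def\<close>)
  then have D: "frechet_derivative (in_chart a c) (at ?x) = (\<lambda>_. 0)" by simp
  have "mgrad a p \<bullet> mgrad a p = 0"
    using inner_mgrad[OF a c(1) x(1), of "grad (in_chart F c) (in_chart a c) ?x"] mgrad_chart[OF a c(1) x(1)]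
    unfolding x(2) D by simp
  then show ?thesis by simp
qed

lemma C1_function_sum: "(\<And>i. i \<in> I \<Longrightarrow> C1_function (a i)) \<Longrightarrow> C1_function (\<lambda>p. \<Sum>i\<in>I. a i p)"
proof (rule C1_functionI)
  fix c assume "\<And>i. i \<in> I \<Longrightarrow> C1_function (a i)" "c \<in> A"
  then have "C1_on (\<lambda>x. \<Sum>i\<in>I. in_chart (a i) c x) (chart_image c)" by (intro C1_on_sum C1_functionD)
  then show "C1_on (in_chart (\<lambda>p. \<Sum>i\<in>I. a i p) c) (chart_image c)" by (simp add: in_chart_def o_def)
qed

text \<open>
  Both sides are tangent and represent the same differential.
\<close>

lemma mgrad_sum:
  assumes a: "\<And>i. i \<in> I \<Longrightarrow> C1_function (a i)"
  shows "mgrad (\<lambda>p. \<Sum>i\<in>I. a i p) p = (\<Sum>i\<in>I. mgrad (a i) p)"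
proof -
  obtain c where c: "c \<in> A" "p \<in> fst c" by (rule ex_chart)
  let ?x = "snd c p"
  have x: "?x \<in> chart_image c" "chart_inv c ?x = p" using chart_facts(5,6)[OF c(1)] c(2) by auto
  interpret C: immersed_patch "in_chart F c" "chart_image c" by (rule patch[OF c(1)])
  let ?s = "\<lambda>p. \<Sum>i\<in>I. a i p"
  have s: "C1_function ?s" using a by (rule C1_function_sum)
  have S: "subspace (tangent_space (in_chart F c) ?x)" by (rule C.subspace_tangent[OF x(1)])
  have T: "mgrad b p \<in> tangent_space (in_chart F c) ?x" if "C1_function b" for b
    using mgrad_chart[OF that c(1) x(1)] unfolding x(2) by (simp add: tangent_space_def)
  show ?thesis
  proof (rule C.tangent_unique[OF x(1)])
    show "mgrad ?s p \<in> tangent_space (in_chart F c) ?x" by (rule T[OF s])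
    show "(\<Sum>i\<in>I. mgrad (a i) p) \<in> tangent_space (in_chart F c) ?x" by (intro subspace_sum S T a)
    fix X
    have "in_chart ?s c = (\<lambda>y. \<Sum>i\<in>I. in_chart (a i) c y)" by (simp add: in_chart_def o_def)
    then have "((in_chart ?s c) has_derivative (\<lambda>X. \<Sum>i\<in>I. frechet_derivative (in_chart (a i) c) (at ?x) X)) (at ?x)"
      using C1_on_has_derivative[OF C1_functionD[OF a c(1)] x(1)] by (simp add: has_derivative_sum)
    then have D: "frechet_derivative (in_chart ?s c) (at ?x) = (\<lambda>X. \<Sum>i\<in>I. frechet_derivative (in_chart (a i) c) (at ?x) X)"
      by (rule frechet_derivative_at[symmetric])
    have "mgrad ?s p \<bullet> C.J ?x X = (\<Sum>i\<in>I. frechet_derivative (in_chart (a i) c) (at ?x) X)"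
      using inner_mgrad[OF s c(1) x(1), of X] unfolding x(2) D .
    also have "\<dots> = (\<Sum>i\<in>I. mgrad (a i) p \<bullet> C.J ?x X)"
      using inner_mgrad[OF a c(1) x(1), of _ X] unfolding x(2) by simp
    finally show "mgrad ?s p \<bullet> C.J ?x X = (\<Sum>i\<in>I. mgrad (a i) p) \<bullet> C.J ?x X" by (simp add: inner_sum_left)
  qed
qed

lemma square_pos_part_derivative:
  "((\<lambda>s::real. (max 0 s)\<^sup>2) has_real_derivative 2 * max 0 s) (at s)"
proof -
  consider "s < 0" | "s = 0" | "s > 0" by linarith
  then show ?thesis
  proof cases
    case 1
    have "((\<lambda>s::real. 0) has_real_derivative 2 * max 0 s) (at s)" using 1 by simp
    then show ?thesis by (rule has_field_derivative_transform_within_open[of _ _ _ "{..<0}"]) (use 1 in auto)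
  next
    case 3
    have "((\<lambda>s::real. s\<^sup>2) has_real_derivative 2 * max 0 s) (at s)" using 3 by (auto intro!: derivative_eq_intros)
    then show ?thesis by (rule has_field_derivative_transform_within_open[of _ _ _ "{0<..}"]) (use 3 in auto)
  next
    case 2
    have "\<bar>(max 0 h)\<^sup>2 / h\<bar> \<le> \<bar>h\<bar>" for h :: real
      by (cases "h > 0") (auto simp: power2_eq_square)
    then have "((\<lambda>h::real. (max 0 h)\<^sup>2 / h) \<longlongrightarrow> 0) (at 0)"
      by (intro tendsto_0_le[OF tendsto_ident_at, of _ 1] always_eventually allI) simp
    then show ?thesis using 2 by (simp add: DERIV_def)
  qed
qed

lemma C1_on_square_pos_part: "C1_on f S \<Longrightarrow> C1_on (\<lambda>x. (max 0 (f x :: real))\<^sup>2) S"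
  by (rule C1_on_real_compose[where g' = "\<lambda>s. 2 * max 0 s"])
    (auto intro!: continuous_intros square_pos_part_derivative)

text \<open>
  The function is \<open>(max 0 (1 - |y - x|\<^sup>2 / r\<^sup>2))\<^sup>2\<close> in one chart and 0 outside it.  The square makes it continuously
  differentiable across the boundary of its support, which is all the regularity needed later.
\<close>

lemma ex_bump:
  assumes U: "open U" "p \<in> U"
  obtains c \<theta> K where "c \<in> A" "C1_function \<theta>" "\<And>q. 0 \<le> \<theta> q" "\<And>q. \<theta> q \<le> 1" "0 < \<theta> p"
    "compact K" "K \<subseteq> fst c \<inter> U" "\<And>q. q \<notin> K \<Longrightarrow> \<theta> q = 0"
proof -
  obtain c where c: "c \<in> A" "p \<in> fst c" by (rule ex_chart)
  let ?x = "snd c p"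
  have x: "?x \<in> chart_image c" "chart_inv c ?x = p" using chart_facts(5,6)[OF c(1)] c(2) by auto
  have "open (chart_inv c -` U \<inter> chart_image c)"
    using continuous_on_open_vimage[OF chart_facts(2)[OF c(1)]] chart_facts(4)[OF c(1)] U(1) by blast
  then obtain r where r: "r > 0" "cball ?x r \<subseteq> chart_inv c -` U \<inter> chart_image c"
    using x U(2) open_contains_cball by (metis IntI vimageI)
  define \<beta> where "\<beta> y = (max 0 (1 - ((y - ?x) \<bullet> (y - ?x)) / r\<^sup>2))\<^sup>2" for y
  define \<theta> where "\<theta> q = (if q \<in> fst c then \<beta> (snd c q) else 0)" for q
  let ?K = "chart_inv c ` cball ?x r"
  have K: "compact ?K" using r by (intro compact_image_chart_inv c) auto
  have KU: "?K \<subseteq> fst c \<inter> U"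
  proof (rule image_subsetI)
    fix y assume "y \<in> cball ?x r"
    then have "y \<in> chart_inv c -` U \<inter> chart_image c" using r(2) by blast
    then show "chart_inv c y \<in> fst c \<inter> U" using chart_facts(7)[OF c(1)] by simp
  qed
  have \<beta>0: "\<beta> y = 0" if "y \<notin> cball ?x r" for y
  proof -
    have "r < norm (y - ?x)" using that by (simp add: dist_norm norm_minus_commute)
    then have "r\<^sup>2 \<le> (y - ?x) \<bullet> (y - ?x)" using r(1) by (simp add: power2_norm_eq_inner[symmetric] power_mono)
    then have "1 \<le> ((y - ?x) \<bullet> (y - ?x)) / r\<^sup>2" using r(1) by simp
    then show ?thesis by (simp add: \<beta>_def)
  qed
  have \<theta>0: "\<theta> q = 0" if "q \<notin> ?K" for q
  proof (cases "q \<in> fst c")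
    case True
    then have "snd c q \<notin> cball ?x r" using that chart_facts(6)[OF c(1) True] by (metis image_eqI)
    then show ?thesis by (simp add: \<theta>_def \<beta>0)
  qed (simp add: \<theta>_def)
  have C1\<beta>: "C1_on \<beta> UNIV" unfolding \<beta>_def
    by (intro C1_on_square_pos_part C1_on_diff C1_on_const C1_on_inner C1_on_divide C1_on_linear bounded_linear_ident)
      (use r in auto)
  have C1: "C1_function \<theta>"
  proof (rule C1_functionI)
    fix d assume d: "d \<in> A"
    let ?V = "chart_inv d -` (- ?K) \<inter> chart_image d"
    have V: "open ?V"
      using continuous_on_open_vimage[OF chart_facts(2)[OF d]] chart_facts(4)[OF d] compact_imp_closed[OF K] by blast
    have "C1_on (in_chart \<theta> d) (overlap d c)"
    proof (rule C1_on_cong[OF open_overlap[OF d c(1)]])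
      show "in_chart \<theta> d y = \<beta> (transition d c y)" if "y \<in> overlap d c" for y
        using that by (simp add: in_chart_def \<theta>_def overlap_iff[OF d])
      show "C1_on (\<lambda>y. \<beta> (transition d c y)) (overlap d c)"
        by (rule C1_on_compose[OF C1\<beta> C1_transition[OF d c(1)]]) simp
    qed
    moreover have "C1_on (in_chart \<theta> d) ?V"
      by (rule C1_on_cong[OF V, of _ "\<lambda>_. 0"]) (auto simp: in_chart_def \<theta>0)
    ultimately have "C1_on (in_chart \<theta> d) (overlap d c \<union> ?V)"
      by (rule C1_on_open_Un[OF _ _ open_overlap[OF d c(1)] V])
    moreover have "chart_image d \<subseteq> overlap d c \<union> ?V"
      using overlap_iff[OF d, of _ c] KU by auto
    ultimately show "C1_on (in_chart \<theta> d) (chart_image d)" by (rule C1_on_subset)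
  qed
  show ?thesis
  proof (rule that[OF c(1) C1 _ _ _ K _ \<theta>0])
    show "0 \<le> \<theta> q" for q by (simp add: \<theta>_def \<beta>_def)
    show "\<theta> q \<le> 1" for q by (auto simp: \<theta>_def \<beta>_def intro!: power_le_one)
    show "0 < \<theta> p" using c(2) by (simp add: \<theta>_def \<beta>_def)
    show "?K \<subseteq> fst c \<inter> U" by (rule KU)
  qed
qed

end


section \<open>Weighted integration in charts\<close>

context immersed_manifold
begin

definition supported_in :: "('a, 'm) chart \<Rightarrow> ('a \<Rightarrow> real) \<Rightarrow> bool" where
  "supported_in c b \<longleftrightarrow> continuous_on UNIV b \<and> (\<exists>K. compact K \<and> K \<subseteq> fst c \<and> (\<forall>p. p \<notin> K \<longrightarrow> b p = 0))"

lemma supported_inI: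
  "continuous_on UNIV b \<Longrightarrow> compact K \<Longrightarrow> K \<subseteq> fst c \<Longrightarrow> (\<And>p. p \<notin> K \<Longrightarrow> b p = 0) \<Longrightarrow> supported_in c b"
  unfolding supported_in_def by blast

lemma supported_in_mult:
  "supported_in c b \<Longrightarrow> continuous_on UNIV a \<Longrightarrow> supported_in c (\<lambda>p. b p * a p)"
  unfolding supported_in_def by (auto intro!: continuous_on_mult)

lemma supported_in_add:
  assumes "supported_in c a" "supported_in c b" shows "supported_in c (\<lambda>p. a p + b p)"
proof -
  obtain K where K: "compact K" "K \<subseteq> fst c" "\<And>p. p \<notin> K \<Longrightarrow> a p = 0"
    using assms(1) unfolding supported_in_def by blast
  obtain L where L: "compact L" "L \<subseteq> fst c" "\<And>p. p \<notin> L \<Longrightarrow> b p = 0"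
    using assms(2) unfolding supported_in_def by blast
  show ?thesis
    by (rule supported_inI[of _ "K \<union> L"])
      (use assms K L in \<open>auto simp: supported_in_def compact_Un intro!: continuous_on_add\<close>)
qed

lemma supported_in_zero: "supported_in c (\<lambda>_. 0)"
  by (rule supported_inI[of _ "{}"]) auto

lemma supported_in_sum: "(\<And>i. i \<in> I \<Longrightarrow> supported_in c (b i)) \<Longrightarrow> supported_in c (\<lambda>p. \<Sum>i\<in>I. b i p)"
  by (induction I rule: infinite_finite_induct) (simp_all add: supported_in_zero supported_in_add)

abbreviation chart_weight :: "'e \<Rightarrow> ('a, 'm) chart \<Rightarrow> real^'m \<Rightarrow> real" where
  "chart_weight T c \<equiv> immersed_patch.weight (in_chart F c) T"

lemma chart_weight_eq:
  "c \<in> A \<Longrightarrow> chart_weight T c x = sqrt (det (induced_metric (in_chart F c) x)) * exp (- (in_chart F c x \<bullet> T))"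
  by (rule immersed_patch.weight_def[OF patch])

text \<open>
  The integral against \<open>e\<^sup>-\<^sup>h dV\<close> over the domain of one chart.
\<close>

definition weighted_integral :: "'e \<Rightarrow> ('a, 'm) chart \<Rightarrow> ('a \<Rightarrow> real) \<Rightarrow> real" where
  "weighted_integral T c b = integral UNIV (\<lambda>x. if x \<in> chart_image c then chart_weight T c x * b (chart_inv c x) else 0)"

lemma image_in_chart:
  assumes c: "c \<in> A" and K: "K \<subseteq> fst c"
  shows "snd c ` K \<subseteq> chart_image c" "x \<in> chart_image c \<Longrightarrow> x \<in> snd c ` K \<longleftrightarrow> chart_inv c x \<in> K"
    "compact K \<Longrightarrow> compact (snd c ` K)"
proof -
  show "snd c ` K \<subseteq> chart_image c" using chart_facts(5)[OF c] K by blast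
  show "x \<in> snd c ` K \<longleftrightarrow> chart_inv c x \<in> K" if "x \<in> chart_image c"
  proof
    assume "x \<in> snd c ` K"
    then show "chart_inv c x \<in> K" using chart_facts(6)[OF c] K by auto
  next
    assume "chart_inv c x \<in> K"
    then show "x \<in> snd c ` K" using chart_facts(8)[OF c that] by (metis image_eqI)
  qed
  show "compact (snd c ` K)" if "compact K"
    using compact_continuous_image[OF continuous_on_subset[OF chart_facts(3)[OF c] K] that] .
qed

lemma weighted_integral_eq:
  assumes c: "c \<in> A" and K: "K \<subseteq> fst c" "\<And>p. p \<notin> K \<Longrightarrow> b p = 0"
  shows "weighted_integral T c b = integral (snd c ` K) (\<lambda>x. chart_weight T c x * b (chart_inv c x))"
proof -
  have "(if x \<in> chart_image c then chart_weight T c x * b (chart_inv c x) else 0) =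
      (if x \<in> snd c ` K then chart_weight T c x * b (chart_inv c x) else 0)" for x
    using image_in_chart(1)[OF c K(1)] image_in_chart(2)[OF c K(1), of x] K(2)[of "chart_inv c x"] by auto
  then show ?thesis unfolding weighted_integral_def by (simp add: integral_restrict_UNIV)
qed

lemma continuous_weighted_integrand:
  assumes c: "c \<in> A" and b: "continuous_on UNIV b" and K: "K \<subseteq> chart_image c"
  shows "continuous_on K (\<lambda>x. chart_weight T c x * b (chart_inv c x))"
  by (intro continuous_on_mult continuous_on_subset[OF C1_on_continuous[OF immersed_patch.C1_weight[OF patch[OF c]]] K]
      continuous_on_compose2[OF b continuous_on_subset[OF chart_facts(4)[OF c] K]]) auto

lemma weighted_integrand_integrable:
  assumes c: "c \<in> A" and b: "supported_in c b"
  shows "(\<lambda>x. if x \<in> chart_image c then chart_weight T c x * b (chart_inv c x) else 0) integrable_on UNIV"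
proof -
  obtain K where K: "compact K" "K \<subseteq> fst c" "\<And>p. p \<notin> K \<Longrightarrow> b p = 0" and cb: "continuous_on UNIV b"
    using b unfolding supported_in_def by blast
  have "(if x \<in> chart_image c then chart_weight T c x * b (chart_inv c x) else 0) =
      (if x \<in> snd c ` K then chart_weight T c x * b (chart_inv c x) else 0)" for x
    using image_in_chart(1)[OF c K(2)] image_in_chart(2)[OF c K(2), of x] K(3)[of "chart_inv c x"] by auto
  moreover have "(\<lambda>x. chart_weight T c x * b (chart_inv c x)) integrable_on snd c ` K"
    by (intro integrable_continuous_compact continuous_weighted_integrand[OF c cb] image_in_chart[OF c K(2)] K(1))
  ultimately show ?thesis by (simp add: integrable_restrict_UNIV)
qed

lemma weighted_integral_add:
  assumes c: "c \<in> A" and "supported_in c a" "supported_in c b"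
  shows "weighted_integral T c (\<lambda>p. a p + b p) = weighted_integral T c a + weighted_integral T c b"
  unfolding weighted_integral_def
  by (subst integral_add[symmetric]) (use assms in \<open>auto intro!: weighted_integrand_integrable integral_cong simp: distrib_left\<close>)

lemma weighted_integral_zero: "weighted_integral T c (\<lambda>_. 0) = 0"
  unfolding weighted_integral_def by (simp cong: if_cong)

lemma weighted_integral_sum:
  assumes c: "c \<in> A"
  shows "(\<And>i. i \<in> I \<Longrightarrow> supported_in c (b i)) \<Longrightarrow>
    weighted_integral T c (\<lambda>p. \<Sum>i\<in>I. b i p) = (\<Sum>i\<in>I. weighted_integral T c (b i))"
  by (induction I rule: infinite_finite_induct)
    (simp_all add: weighted_integral_zero weighted_integral_add[OF c] supported_in_sum)

lemma weighted_integral_cmult: "weighted_integral T c (\<lambda>p. k * b p) = k * weighted_integral T c b"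
proof -
  have "(\<lambda>x. if x \<in> chart_image c then chart_weight T c x * (k * b (chart_inv c x)) else 0)
    = (\<lambda>x. k * (if x \<in> chart_image c then chart_weight T c x * b (chart_inv c x) else 0))" by auto
  then show ?thesis unfolding weighted_integral_def by simp
qed

lemma weighted_integral_mono:
  assumes c: "c \<in> A" and "supported_in c a" "supported_in c b" "\<And>p. a p \<le> b p"
  shows "weighted_integral T c a \<le> weighted_integral T c b"
  unfolding weighted_integral_def
  by (rule integral_le[OF weighted_integrand_integrable[OF c assms(2)] weighted_integrand_integrable[OF c assms(3)]])
    (auto intro!: mult_left_mono assms(4) less_imp_le[OF immersed_patch.weight_pos[OF patch[OF c]]])

text \<open>
  The metric transforms by \<open>g\<^sub>c = J\<^sup>T g\<^sub>d J\<close>, where \<open>J\<close> is the Jacobian matrix of the transition map.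
\<close>

lemma chart_weight_transition:
  assumes c: "c \<in> A" "d \<in> A" and x: "x \<in> overlap c d"
  shows "chart_weight T c x = \<bar>det (matrix (frechet_derivative (transition c d) (at x)))\<bar> * chart_weight T d (transition c d x)"
proof -
  let ?t = "frechet_derivative (transition c d) (at x)" and ?y = "transition c d x"
  let ?P = "matrix ?t" and ?J = "frechet_derivative (in_chart F d) (at (transition c d x))"
  have y: "?y \<in> chart_image d" by (rule transition_in[OF c x])
  have l: "linear ?t"
    using C1_on_has_derivative[OF C1_transition[OF c] x] by (rule has_derivative_linear)
  have "induced_metric (in_chart F c) x $ i $ j = (transpose ?P ** induced_metric (in_chart F d) ?y ** ?P) $ i $ j" for i j
  proof -
    let ?ei = "axis i 1 :: real^'m" and ?ej = "axis j 1 :: real^'m"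
    have "induced_metric (in_chart F c) x $ i $ j = ?J (?t ?ei) \<bullet> ?J (?t ?ej)"
      by (simp add: induced_metric_def partial_deriv_def frechet_derivative_transition[OF c x C1_F[OF c(2)]])
    also have "\<dots> = metric_inner (in_chart F d) ?y (?P *v ?ei) (?P *v ?ej)"
      unfolding immersed_patch.metric_inner_eq[OF patch[OF c(2)] y] matrix_vector_mul(2)[OF l] ..
    also have "\<dots> = ?ei \<bullet> ((transpose ?P ** induced_metric (in_chart F d) ?y ** ?P) *v ?ej)"
      unfolding metric_inner_def matrix_vector_mul_assoc[symmetric]
      by (metis dot_lmul_matrix vector_transpose_matrix)
    also have "\<dots> = (transpose ?P ** induced_metric (in_chart F d) ?y ** ?P) $ i $ j"
      by (simp add: inner_axis' matrix_vector_mult_basis column_def)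
    finally show ?thesis .
  qed
  then have "induced_metric (in_chart F c) x = transpose ?P ** induced_metric (in_chart F d) ?y ** ?P"
    by (simp add: vec_eq_iff)
  then have "det (induced_metric (in_chart F c) x) = (det ?P)\<^sup>2 * det (induced_metric (in_chart F d) ?y)"
    by (simp add: det_mul power2_eq_square)
  then have "sqrt (det (induced_metric (in_chart F c) x)) = \<bar>det ?P\<bar> * sqrt (det (induced_metric (in_chart F d) ?y))"
    by (simp add: real_sqrt_mult)
  moreover have "in_chart F c x = in_chart F d ?y"
    using chart_inv_transition[OF c x] by (simp add: in_chart_def)
  ultimately show ?thesis by (simp add: chart_weight_eq c)
qed

lemma weighted_integral_chart_independent:
  assumes c: "c \<in> A" "d \<in> A" and b: "continuous_on UNIV b"
    and K: "compact K" "K \<subseteq> fst c \<inter> fst d" "\<And>p. p \<notin> K \<Longrightarrow> b p = 0"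
  shows "weighted_integral T c b = weighted_integral T d b"
proof -
  let ?Kc = "snd c ` K" and ?Kd = "snd d ` K" and ?\<tau> = "transition c d"
  have Kc: "K \<subseteq> fst c" and Kd: "K \<subseteq> fst d" using K(2) by auto
  have ov: "?Kc \<subseteq> overlap c d" using K(2) by (auto simp: overlap_def)
  have im: "?\<tau> ` ?Kc = ?Kd"
    using chart_facts(6)[OF c(1)] Kc by (force simp: image_image intro!: image_cong)
  let ?f = "\<lambda>y. chart_weight T d y * b (chart_inv d y)"
  have D: "(?\<tau> has_derivative frechet_derivative ?\<tau> (at x)) (at x)" if "x \<in> ?Kc" for x
    using C1_on_has_derivative[OF C1_transition[OF c]] ov that by blast
  have "weighted_integral T d b = integral (?\<tau> ` ?Kc) ?f"
    unfolding im by (rule weighted_integral_eq[OF c(2) Kd K(3)])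
  also have "\<dots> = integral ?Kc (\<lambda>x. \<bar>det (matrix (frechet_derivative ?\<tau> (at x)))\<bar> * ?f (?\<tau> x))"
  proof (rule integral_change_of_variables_finite)
    show "compact ?Kc" by (rule image_in_chart(3)[OF c(1) Kc K(1)])
    show "(?\<tau> has_derivative frechet_derivative ?\<tau> (at x)) (at x within ?Kc)" if "x \<in> ?Kc" for x
      by (rule has_derivative_at_withinI[OF D[OF that]])
    show "continuous_on ?Kc (\<lambda>x. det (matrix (frechet_derivative ?\<tau> (at x))))"
      unfolding det_def matrix_def vec_lambda_beta
      by (intro continuous_intros continuous_on_subset[OF C1_on_continuous_derivative[OF C1_transition[OF c]] ov])
    show "inj_on ?\<tau> ?Kc"
    proof (rule inj_onI)
      fix x y assume "x \<in> ?Kc" "y \<in> ?Kc" and e: "?\<tau> x = ?\<tau> y"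
      then have xy: "x \<in> overlap c d" "y \<in> overlap c d" using ov by auto
      have "chart_inv c x = chart_inv c y" using e chart_inv_transition[OF c xy(1)] chart_inv_transition[OF c xy(2)] by simp
      then show "x = y" using xy chart_facts(8)[OF c(1)] unfolding overlap_iff[OF c(1)] by metis
    qed
    show "continuous_on (?\<tau> ` ?Kc) ?f"
      unfolding im by (rule continuous_weighted_integrand[OF c(2) b image_in_chart(1)[OF c(2) Kd]])
  qed
  also have "\<dots> = integral ?Kc (\<lambda>x. chart_weight T c x * b (chart_inv c x))"
  proof (rule integral_cong)
    fix x assume "x \<in> ?Kc"
    then have "x \<in> overlap c d" using ov by blast
    then show "\<bar>det (matrix (frechet_derivative ?\<tau> (at x)))\<bar> * ?f (?\<tau> x) = chart_weight T c x * b (chart_inv c x)"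
      using chart_weight_transition[OF c] chart_inv_transition[OF c] by simp
  qed
  also have "\<dots> = weighted_integral T c b" by (rule weighted_integral_eq[symmetric, OF c(1) Kc K(3)])
  finally show ?thesis by simp
qed

lemma sets_volume_measure: "sets (volume_measure A F) = sets borel"
proof -
  obtain c where "c \<in> A" by (rule ex_chart)
  then have "A \<noteq> {}" by blast
  then show ?thesis
    unfolding volume_measure_def by (subst sets_SUP[of _ _ borel]) (auto simp: chart_volume_def)
qed

text \<open>
  The volume measure is the supremum of the chart volumes and therefore dominates each of them.
\<close>

lemma weighted_integral_le_nn_integral:
  assumes c: "c \<in> A" and b: "supported_in c b" "\<And>p. 0 \<le> b p"
  shows "ennreal (weighted_integral T c b) \<le> (\<integral>\<^sup>+p. ennreal (b p * exp (- (F p \<bullet> T))) \<partial>volume_measure A F)"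
proof -
  obtain K where K: "compact K" "K \<subseteq> fst c" "\<And>p. p \<notin> K \<Longrightarrow> b p = 0" and cb: "continuous_on UNIV b"
    using b(1) unfolding supported_in_def by blast
  let ?\<Omega> = "chart_image c" and ?\<rho> = "\<lambda>x. sqrt (det (induced_metric (in_chart F c) x))"
  let ?b = "\<lambda>p. ennreal (b p * exp (- (F p \<bullet> T)))"
  let ?M = "restrict_space lborel ?\<Omega>"
  have \<Omega>: "?\<Omega> \<in> sets borel" using chart_facts(2)[OF c] by simp
  have meas: "f \<in> borel_measurable ?M" if "continuous_on ?\<Omega> f" for f :: "real^'m \<Rightarrow> 'z::topological_space"
    using borel_measurable_continuous_on_restrict[OF that]
    by (simp only: measurable_cong_sets[OF sets_restrict_space_cong[OF sets_lborel] refl])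
  have m1: "chart_inv c \<in> borel_measurable ?M" by (rule meas[OF chart_facts(4)[OF c]])
  have m2: "(\<lambda>x. ennreal (?\<rho> x)) \<in> borel_measurable ?M"
    by (intro measurable_compose[OF meas measurable_ennreal] C1_on_continuous immersed_patch.C1_volume[OF patch[OF c]])
  have cb': "continuous_on UNIV (\<lambda>p. b p * exp (- (F p \<bullet> T)))"
    by (intro continuous_intros cb continuous_F)
  then have m3: "?b \<in> borel_measurable borel"
    by (intro measurable_compose[OF borel_measurable_continuous_onI measurable_ennreal])
  have "weighted_integral T c b = integral (snd c ` K) (\<lambda>x. chart_weight T c x * b (chart_inv c x))"
    by (rule weighted_integral_eq[OF c K(2,3)])
  also have "\<dots> = (LINT x:snd c ` K|lborel. chart_weight T c x * b (chart_inv c x))"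
    by (rule set_borel_integral_eq_integral(2)[symmetric], unfold set_integrable_def, rule borel_integrable_compact)
      (intro image_in_chart[OF c K(2)] K(1) continuous_weighted_integrand[OF c cb])+
  also have "ennreal \<dots> = (\<integral>\<^sup>+x. ennreal (indicator (snd c ` K) x * (chart_weight T c x * b (chart_inv c x))) \<partial>lborel)"
    unfolding set_lebesgue_integral_def real_scaleR_def
  proof (rule nn_integral_eq_integral[symmetric])
    show "integrable lborel (\<lambda>x. indicator (snd c ` K) x * (chart_weight T c x * b (chart_inv c x)))"
      using borel_integrable_compact[OF image_in_chart(3)[OF c K(2,1)] continuous_weighted_integrand[OF c cb image_in_chart(1)[OF c K(2)]]]
      by simp
    have "0 \<le> chart_weight T c x * b (chart_inv c x)" if "x \<in> snd c ` K" for x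
      using immersed_patch.weight_pos[OF patch[OF c], of x T] image_in_chart(1)[OF c K(2)] that b(2)
      by (intro mult_nonneg_nonneg) (auto intro: less_imp_le)
    then show "AE x in lborel. 0 \<le> indicator (snd c ` K) x * (chart_weight T c x * b (chart_inv c x))"
      by (intro AE_I2) (auto simp: indicator_def)
  qed
  also have "\<dots> = (\<integral>\<^sup>+x. ennreal (?\<rho> x) * ?b (chart_inv c x) * indicator ?\<Omega> x \<partial>lborel)"
  proof (rule nn_integral_cong)
    fix x
    show "ennreal (indicator (snd c ` K) x * (chart_weight T c x * b (chart_inv c x))) =
        ennreal (?\<rho> x) * ?b (chart_inv c x) * indicator ?\<Omega> x"
    proof (cases "x \<in> ?\<Omega>")
      case True
      have r: "0 \<le> ?\<rho> x" using immersed_patch.det_metric_pos[OF patch[OF c] True] by simp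
      have E: "indicator (snd c ` K) x * (chart_weight T c x * b (chart_inv c x)) = ?\<rho> x * (b (chart_inv c x) * exp (- (F (chart_inv c x) \<bullet> T)))"
      proof -
        have "indicator (snd c ` K) x * (chart_weight T c x * b (chart_inv c x)) = chart_weight T c x * b (chart_inv c x)"
          using image_in_chart(2)[OF c K(2) True] K(3)[of "chart_inv c x"] by (cases "x \<in> snd c ` K") simp_all
        also have "\<dots> = ?\<rho> x * exp (- (F (chart_inv c x) \<bullet> T)) * b (chart_inv c x)"
          unfolding chart_weight_eq[OF c] by (simp add: in_chart_def)
        finally show ?thesis by (simp only: mult_ac)
      qed
      show ?thesis unfolding E using True r b(2) by (simp add: ennreal_mult)
    next
      case False
      then have "x \<notin> snd c ` K" using image_in_chart(1)[OF c K(2)] by blast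
      then show ?thesis using False by simp
    qed
  qed
  also have "\<dots> = (\<integral>\<^sup>+x. ennreal (?\<rho> x) * ?b (chart_inv c x) \<partial>?M)"
    by (rule nn_integral_restrict_space[symmetric]) (use \<Omega> in simp)
  also have "\<dots> = (\<integral>\<^sup>+x. ?b (chart_inv c x) \<partial>density ?M (\<lambda>x. ennreal (?\<rho> x)))"
    by (rule nn_integral_density[symmetric]) (use m2 measurable_compose[OF m1 m3] in auto)
  also have "\<dots> = (\<integral>\<^sup>+p. ?b p \<partial>chart_volume F c)"
    unfolding chart_volume_def by (rule nn_integral_distr[symmetric]) (use m1 m3 in auto)
  also have "\<dots> \<le> (\<integral>\<^sup>+p. ?b p \<partial>volume_measure A F)"
  proof (rule nn_integral_mono_measure)
    show "chart_volume F c \<le> volume_measure A F"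
      unfolding volume_measure_def by (rule SUP_upper[OF c])
    show "sets (chart_volume F c) = sets (volume_measure A F)"
      by (simp add: sets_volume_measure chart_volume_def)
  qed
  finally show ?thesis .
qed

end


section \<open>The test field\<close>

context immersed_patch
begin

lemma weighted_divergence_mult:
  assumes p: "p \<in> \<Omega>" and s: "C_k_on 2 s \<Omega>" and b: "C1_on b \<Omega>" and f: "\<And>z. f z = 2 * (z \<bullet> T)"
  shows "(\<Sum>i\<in>UNIV. partial_deriv i (\<lambda>q. b q * (weight T q * grad \<phi> s q $ i)) p) =
    weight T p * (b p * drift_laplacian \<phi> f s p + frechet_derivative b (at p) (grad \<phi> s p))"
proof -
  have "partial_deriv i (\<lambda>q. b q * (weight T q * grad \<phi> s q $ i)) p =
     b p * partial_deriv i (\<lambda>q. weight T q * grad \<phi> s q $ i) p + weight T p * (grad \<phi> s p $ i * partial_deriv i b p)" for i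
  proof -
    have "(\<lambda>q. weight T q * grad \<phi> s q $ i) differentiable (at p)"
      by (intro C1_on_differentiable[OF _ p] C1_on_mult C1_weight C1_on_vec_nth C1_grad s)
    then show ?thesis
      using partial_deriv_mult[OF C1_on_differentiable[OF b p], of "\<lambda>q. weight T q * grad \<phi> s q $ i" i]
      by (simp add: algebra_simps)
  qed
  then have "(\<Sum>i\<in>UNIV. partial_deriv i (\<lambda>q. b q * (weight T q * grad \<phi> s q $ i)) p) =
     b p * (\<Sum>i\<in>UNIV. partial_deriv i (\<lambda>q. weight T q * grad \<phi> s q $ i) p)
     + weight T p * (\<Sum>i\<in>UNIV. grad \<phi> s p $ i * partial_deriv i b p)"
    by (simp only: sum.distrib sum_distrib_left)
  also have "(\<Sum>i\<in>UNIV. grad \<phi> s p $ i * partial_deriv i b p) = frechet_derivative b (at p) (grad \<phi> s p)"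
    by (simp add: linear_partial_deriv[OF C1_on_differentiable[OF b p]])
  finally show ?thesis by (simp add: weighted_divergence[OF p s f] algebra_simps)
qed

end

lemma frechet_derivative_mult_real:
  fixes a b :: "'e::real_normed_vector \<Rightarrow> real"
  assumes "a differentiable (at x)" "b differentiable (at x)"
  shows "frechet_derivative (\<lambda>y. a y * b y) (at x) v = a x * frechet_derivative b (at x) v + frechet_derivative a (at x) v * b x"
  using bounded_bilinear.FDERIV[OF bounded_bilinear_mult assms[unfolded frechet_derivative_works], THEN frechet_derivative_at]
  by metis

locale translator = immersed_manifold A F
  for A :: "('a::t2_space, 'm::finite) chart set" and F :: "'a \<Rightarrow> 'e::euclidean_space" +
  fixes T :: 'e and f :: "'e \<Rightarrow> real" and u :: "'a \<Rightarrow> real"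
  assumes norm_T: "norm T = 1" and soliton: "translating_soliton A F T" and f: "\<And>z. f z = 2 * (z \<bullet> T)"
    and u_C2: "C_k_function 2 A u" and u_harmonic: "drift_harmonic A F f u"
begin

definition height :: "'a \<Rightarrow> real" where "height p = F p \<bullet> T"

lemma in_chart_height: "in_chart height c = (\<lambda>x. in_chart F c x \<bullet> T)"
  by (simp add: in_chart_def height_def o_def)

lemma C2_height_chart: "c \<in> A \<Longrightarrow> C_k_on 2 (in_chart height c) (chart_image c)"
  unfolding in_chart_height by (rule immersed_patch.C2_height[OF patch])

lemma C2_imp_C1:
  assumes "C_k_on 2 a S" shows "C1_on a S"
  using assms C1_on_continuous[OF C_2_onD[OF assms]] by (simp add: C1_on_iff numeral_2_eq_2)

lemma C2_u_chart: "c \<in> A \<Longrightarrow> C_k_on 2 (in_chart u c) (chart_image c)"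
  using u_C2 by (simp add: C_k_function_def)

lemma C1_u: "C1_function u" by (intro C1_functionI C2_imp_C1 C2_u_chart)

lemma C1_height: "C1_function height" by (intro C1_functionI C2_imp_C1 C2_height_chart)

text \<open>
  The gradient of the height is the orthogonal projection of the unit vector \<open>T\<close> to the tangent space.
\<close>

lemma norm_mgrad_height: "norm (mgrad height p) \<le> 1"
proof -
  obtain c where c: "c \<in> A" "p \<in> fst c" by (rule ex_chart)
  let ?x = "snd c p"
  have x: "?x \<in> chart_image c" "chart_inv c ?x = p" using chart_facts(5,6)[OF c(1)] c(2) by auto
  let ?X = "grad (in_chart F c) (in_chart height c) ?x" and ?J = "frechet_derivative (in_chart F c) (at ?x)"
  have D: "frechet_derivative (in_chart height c) (at ?x) v = ?J v \<bullet> T" for v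
    unfolding in_chart_height
    using has_derivative_inner_left[OF C1_on_has_derivative[OF C1_F[OF c(1)] x(1)], of T, THEN frechet_derivative_at] by metis
  have J: "mgrad height p = ?J ?X" using mgrad_chart[OF C1_height c(1) x(1)] unfolding x(2) .
  have "mgrad height p \<bullet> mgrad height p = mgrad height p \<bullet> T"
    using inner_mgrad[OF C1_height c(1) x(1), of ?X] unfolding x(2) D J[symmetric] .
  also have "\<dots> \<le> norm (mgrad height p) * 1" using norm_cauchy_schwarz[of "mgrad height p" T] norm_T by simp
  finally have "norm (mgrad height p) * norm (mgrad height p) \<le> norm (mgrad height p) * 1"
    by (simp add: power2_norm_eq_inner[symmetric] power2_eq_square)
  then show ?thesis by (cases "mgrad height p = 0") (simp_all add: mult_le_cancel_left)
qed

text \<open>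
  The vector field \<open>8 u \<nabla>u - u\<^sup>2 \<nabla>h\<close>.  Its first part produces the energy \<open>8 |\<nabla>u|\<^sup>2\<close> because \<open>u\<close> is harmonic; its second
  part produces \<open>u\<^sup>2\<close> because \<open>h\<close> has drift Laplacian -1.
\<close>

definition flux :: "'a \<Rightarrow> 'e" where
  "flux p = (8 * u p) *\<^sub>R mgrad u p - (u p)\<^sup>2 *\<^sub>R mgrad height p"

text \<open>
  The divergence of the flux with respect to \<open>e\<^sup>-\<^sup>h dV\<close>.  The factor 8 lets the energy absorb the mixed term.
\<close>

definition flux_divergence :: "'a \<Rightarrow> real" where
  "flux_divergence p = 8 * (mgrad u p \<bullet> mgrad u p) - 2 * u p * (mgrad u p \<bullet> mgrad height p) + (u p)\<^sup>2"

definition flux_coords :: "('a, 'm) chart \<Rightarrow> real^'m \<Rightarrow> real^'m" where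
  "flux_coords c x = (8 * in_chart u c x) *\<^sub>R grad (in_chart F c) (in_chart u c) x
     - (in_chart u c x)\<^sup>2 *\<^sub>R grad (in_chart F c) (in_chart height c) x"

lemma flux_chart:
  assumes c: "c \<in> A" and x: "x \<in> chart_image c"
  shows "frechet_derivative (in_chart F c) (at x) (flux_coords c x) = flux (chart_inv c x)"
  using linear_dF[OF c x]
  by (simp add: flux_coords_def flux_def linear_diff linear_scale mgrad_chart[OF C1_u c x] mgrad_chart[OF C1_height c x])
    (simp add: in_chart_def)

lemma C1_flux_coords: "c \<in> A \<Longrightarrow> C1_on (flux_coords c) (chart_image c)"
  unfolding flux_coords_def[abs_def] power2_eq_square
  by (intro C1_on_diff C1_on_scaleR C1_on_mult C1_on_const C1_functionD[OF C1_u]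
      immersed_patch.C1_grad[OF patch] C2_u_chart C2_height_chart)

lemma continuous_flux: "continuous_on UNIV flux"
  unfolding flux_def
  by (intro continuous_intros C1_function_continuous continuous_mgrad C1_u C1_height)

lemma continuous_flux_divergence: "continuous_on UNIV flux_divergence"
  unfolding flux_divergence_def
  by (intro continuous_intros C1_function_continuous continuous_mgrad C1_u C1_height)

text \<open>
  The field \<open>\<xi> V\<close> is written as \<open>8 \<xi> u \<nabla>u - \<xi> u\<^sup>2 \<nabla>h\<close>, a combination of gradients with scalar coefficients, to which the
  divergence formula for \<open>b \<nabla>s\<close> applies with drift Laplacians 0 and -1.
\<close>

lemma weighted_flux_divergence:
  assumes c: "c \<in> A" and x: "x \<in> chart_image c" and \<xi>: "C1_function \<xi>"
  shows "(\<Sum>i\<in>UNIV. partial_deriv i (\<lambda>q. (chart_weight T c q * in_chart \<xi> c q) * flux_coords c q $ i) x) =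
    chart_weight T c x * (\<xi> (chart_inv c x) * flux_divergence (chart_inv c x) + mgrad \<xi> (chart_inv c x) \<bullet> flux (chart_inv c x))"
proof -
  interpret P: immersed_patch "in_chart F c" "chart_image c" by (rule patch[OF c])
  let ?p = "chart_inv c x"
  let ?\<xi> = "in_chart \<xi> c" and ?u = "in_chart u c" and ?h = "in_chart height c" and ?w = "P.weight T"
  let ?gu = "grad (in_chart F c) ?u" and ?gh = "grad (in_chart F c) ?h"
  let ?a = "\<lambda>q. (8 * ?u q) * ?\<xi> q" and ?b = "\<lambda>q. (- (?u q * ?u q)) * ?\<xi> q"
  have Cu: "C1_on ?u (chart_image c)" and C\<xi>: "C1_on ?\<xi> (chart_image c)"
    using C1_functionD[OF C1_u c] C1_functionD[OF \<xi> c] .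
  have C8: "C1_on (\<lambda>q. 8 * ?u q) (chart_image c)" by (intro C1_on_mult C1_on_const Cu)
  have Cuu: "C1_on (\<lambda>q. - (?u q * ?u q)) (chart_image c)"
    using C1_on_mult[OF C1_on_const C1_on_mult[OF Cu Cu], of "-1"] by simp
  have Ca: "C1_on ?a (chart_image c)" and Cb: "C1_on ?b (chart_image c)"
    by (intro C1_on_mult C8 Cuu C\<xi>)+
  have du: "?u differentiable (at x)" "?\<xi> differentiable (at x)" "(\<lambda>q. 8 * ?u q) differentiable (at x)"
    "(\<lambda>q. - (?u q * ?u q)) differentiable (at x)"
    using C1_on_differentiable x Cu C\<xi> C8 Cuu by blast+
  have iu: "frechet_derivative (in_chart a c) (at x) (grad (in_chart F c) (in_chart b c) x) = mgrad a ?p \<bullet> mgrad b ?p"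
    if "C1_function a" "C1_function b" for a b
    using inner_mgrad[OF that(1) c x, of "grad (in_chart F c) (in_chart b c) x"] mgrad_chart[OF that(2) c x] by simp
  have D8: "frechet_derivative (\<lambda>q. 8 * ?u q) (at x) v = 8 * frechet_derivative ?u (at x) v" for v
    using frechet_derivative_mult_real[of "\<lambda>_. 8" x ?u v] du(1) by simp
  have Duu: "frechet_derivative (\<lambda>q. - (?u q * ?u q)) (at x) v = - 2 * ?u x * frechet_derivative ?u (at x) v" for v
    using frechet_derivative_mult_real[of "\<lambda>q. - ?u q" x ?u v] frechet_derivative_mult_real[of "\<lambda>_. -1" x ?u v] du(1)
    by (simp add: algebra_simps)
  have "partial_deriv i (\<lambda>q. (?w q * ?\<xi> q) * flux_coords c q $ i) x =
      partial_deriv i (\<lambda>q. ?a q * (?w q * ?gu q $ i)) x + partial_deriv i (\<lambda>q. ?b q * (?w q * ?gh q $ i)) x" for i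
  proof -
    have d: "(\<lambda>q. ?a q * (?w q * ?gu q $ i)) differentiable (at x)" "(\<lambda>q. ?b q * (?w q * ?gh q $ i)) differentiable (at x)"
      by (intro C1_on_differentiable[OF _ x] C1_on_mult[OF Ca] C1_on_mult[OF Cb] C1_on_mult[OF P.C1_weight] C1_on_vec_nth P.C1_grad
          C2_u_chart C2_height_chart c)+
    have E: "(\<lambda>q. (?w q * ?\<xi> q) * flux_coords c q $ i) = (\<lambda>q. ?a q * (?w q * ?gu q $ i) + ?b q * (?w q * ?gh q $ i))"
      by (simp add: flux_coords_def fun_eq_iff algebra_simps power2_eq_square)
    have H: "((\<lambda>q. ?a q * (?w q * ?gu q $ i) + ?b q * (?w q * ?gh q $ i)) has_derivative
      (\<lambda>v. frechet_derivative (\<lambda>q. ?a q * (?w q * ?gu q $ i)) (at x) v + frechet_derivative (\<lambda>q. ?b q * (?w q * ?gh q $ i)) (at x) v)) (at x)"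
      by (intro has_derivative_add d[unfolded frechet_derivative_works])
    show ?thesis unfolding partial_deriv_def E frechet_derivative_at[OF H, symmetric] ..
  qed
  then have "(\<Sum>i\<in>UNIV. partial_deriv i (\<lambda>q. (?w q * ?\<xi> q) * flux_coords c q $ i) x) =
      ?w x * (?a x * drift_laplacian (in_chart F c) f ?u x + frechet_derivative ?a (at x) (?gu x)) +
      ?w x * (?b x * drift_laplacian (in_chart F c) f ?h x + frechet_derivative ?b (at x) (?gh x))"
    by (simp only: sum.distrib P.weighted_divergence_mult[OF x C2_u_chart[OF c] Ca f] P.weighted_divergence_mult[OF x C2_height_chart[OF c] Cb f])
  also have "drift_laplacian (in_chart F c) f ?u x = 0"
    using u_harmonic c x by (simp add: drift_harmonic_def)
  also have "drift_laplacian (in_chart F c) f ?h x = -1"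
    unfolding in_chart_height
    by (rule P.drift_laplacian_height[OF x f norm_T]) (use soliton c x in \<open>simp add: translating_soliton_def\<close>)
  also have "frechet_derivative ?a (at x) (?gu x) = 8 * u ?p * (mgrad \<xi> ?p \<bullet> mgrad u ?p) + 8 * (mgrad u ?p \<bullet> mgrad u ?p) * \<xi> ?p"
    unfolding frechet_derivative_mult_real[OF du(3,2)] D8 iu[OF \<xi> C1_u] iu[OF C1_u C1_u] by (simp add: in_chart_def)
  also have "frechet_derivative ?b (at x) (?gh x) =
      - (u ?p)\<^sup>2 * (mgrad \<xi> ?p \<bullet> mgrad height ?p) - 2 * u ?p * (mgrad u ?p \<bullet> mgrad height ?p) * \<xi> ?p"
    unfolding frechet_derivative_mult_real[OF du(4,2)] Duu iu[OF \<xi> C1_height] iu[OF C1_u C1_height]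
    by (simp add: in_chart_def power2_eq_square)
  finally have E: "(\<Sum>i\<in>UNIV. partial_deriv i (\<lambda>q. (?w q * ?\<xi> q) * flux_coords c q $ i) x) = ?w x * (?a x * 0 +
      (8 * u ?p * (mgrad \<xi> ?p \<bullet> mgrad u ?p) + 8 * (mgrad u ?p \<bullet> mgrad u ?p) * \<xi> ?p)) + ?w x * (?b x * - 1 +
      (- (u ?p)\<^sup>2 * (mgrad \<xi> ?p \<bullet> mgrad height ?p) - 2 * u ?p * (mgrad u ?p \<bullet> mgrad height ?p) * \<xi> ?p))" .
  have "in_chart \<xi> c x = \<xi> ?p" "in_chart u c x = u ?p" by (simp_all add: in_chart_def)
  then show ?thesis unfolding E
    by (simp add: flux_divergence_def flux_def inner_diff_right power2_eq_square algebra_simps)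
qed

text \<open>
  For small \<open>t\<close> the segment from \<open>x\<close> to \<open>x + t W x\<close> is a chain with a single link, whose cost is at most
  \<open>t (|dF\<^sub>x (W x)| + e)\<close> by uniform continuity of the differential near \<open>K\<close>.
\<close>

lemma Lipschitz_along_field:
  fixes \<phi> :: "'a \<Rightarrow> real" and W :: "real^'m \<Rightarrow> real^'m"
  assumes c: "c \<in> A" and K: "compact K" "K \<subseteq> chart_image c" and W: "continuous_on K W"
    and R: "0 < R" and lip: "\<And>x y l. joined x y l \<Longrightarrow> \<bar>\<phi> y - \<phi> x\<bar> \<le> l / R" and e: "0 < e"
  shows "\<exists>t0>0. \<forall>t x. 0 < t \<longrightarrow> t < t0 \<longrightarrow> x \<in> K \<longrightarrow>
    \<bar>\<phi> (chart_inv c (x + t *\<^sub>R W x)) - \<phi> (chart_inv c x)\<bar> \<le> t * ((norm (frechet_derivative (in_chart F c) (at x) (W x)) + e) / R)"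
proof (cases "K = {}")
  case True
  then show ?thesis by (intro exI[of _ 1]) simp
next
  case False
  let ?D = "\<lambda>z v. frechet_derivative (in_chart F c) (at z) v"
  have "\<exists>\<rho>>0. \<forall>x\<in>K. cball x \<rho> \<subseteq> chart_image c"
  proof -
    obtain \<rho> where \<rho>: "\<rho> > 0" "\<And>x. x \<in> K \<Longrightarrow> ball x \<rho> \<subseteq> chart_image c"
      using compact_subset_open_imp_ball_epsilon_subset[OF K(1) chart_facts(2)[OF c] K(2)] by (metis UN_subset_iff)
    have "cball x (\<rho> / 2) \<subseteq> chart_image c" if "x \<in> K" for x
    proof -
      have "cball x (\<rho> / 2) \<subseteq> ball x \<rho>" using \<rho>(1) by auto
      then show ?thesis using \<rho>(2)[OF that] by blast
    qed
    then show ?thesis using \<rho>(1) by (intro exI[of _ "\<rho> / 2"]) auto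
  qed
  then obtain \<rho> where \<rho>: "\<rho> > 0" "\<And>x. x \<in> K \<Longrightarrow> cball x \<rho> \<subseteq> chart_image c" by blast
  \<comment> \<open>the closed \<open>\<rho>\<close>-neighbourhood of \<open>K\<close>\<close>
  define K' where "K' = (\<lambda>(x, y). x + y) ` (K \<times> cball (0 :: real^'m) \<rho>)"
  have K': "compact K'" unfolding K'_def split_beta
    by (intro compact_continuous_image compact_Times K compact_cball continuous_intros)
  have inK': "z \<in> K'" if "x \<in> K" "norm (z - x) \<le> \<rho>" for x z
    unfolding K'_def by (rule image_eqI[of _ _ "(x, z - x)"]) (use that in auto)
  have K'\<Omega>: "K' \<subseteq> chart_image c"
  proof
    fix z assume "z \<in> K'"
    then obtain x y where "x \<in> K" "y \<in> cball 0 \<rho>" "z = x + y" unfolding K'_def by auto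
    then have "z \<in> cball x \<rho>" "x \<in> K" by (simp_all add: dist_norm)
    then show "z \<in> chart_image c" using \<rho>(2) by blast
  qed
  let ?N = "\<lambda>y. norm (?D (fst y) (W (snd y)))"
  have "continuous_on (K' \<times> K) ?N"
    by (intro continuous_on_norm continuous_on_frechet_derivative[OF C1_F[OF c]] continuous_on_fst continuous_on_id
        continuous_on_compose2[OF W continuous_on_snd[OF continuous_on_id]]) (use K'\<Omega> in auto)
  then have "uniformly_continuous_on (K' \<times> K) ?N" by (intro compact_uniformly_continuous compact_Times K' K)
  then obtain d where d: "d > 0" "\<And>y z. y \<in> K' \<times> K \<Longrightarrow> z \<in> K' \<times> K \<Longrightarrow> dist z y < d \<Longrightarrow> dist (?N z) (?N y) < e"
    using e unfolding uniformly_continuous_on_def by metis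
  obtain B where B: "B > 0" "\<And>x. x \<in> K \<Longrightarrow> norm (W x) \<le> B"
    using compact_imp_bounded[OF compact_continuous_image[OF W K(1)]] unfolding bounded_pos by force
  define t0 where "t0 = min \<rho> d / (2 * B)"
  have t0: "t0 > 0" using \<rho>(1) d(1) B(1) by (simp add: t0_def)
  have "\<bar>\<phi> (chart_inv c (x + t *\<^sub>R W x)) - \<phi> (chart_inv c x)\<bar> \<le> t * ((norm (?D x (W x)) + e) / R)"
    if t: "0 < t" "t < t0" and x: "x \<in> K" for t x
  proof -
    have "t * B < min \<rho> d"
    proof -
      have "t * (2 * B) < min \<rho> d" using t(2) B(1) by (simp add: t0_def pos_less_divide_eq)
      moreover have "0 \<le> t * B" using t(1) B(1) by simp
      ultimately show ?thesis by linarith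
    qed
    moreover have "t * norm (W x) \<le> t * B" using B(2)[OF x] t(1) by (intro mult_left_mono) auto
    ultimately have tB: "t * norm (W x) < \<rho>" "t * norm (W x) < d" by linarith+
    let ?y = "x + t *\<^sub>R W x"
    have near: "norm (z - x) \<le> t * norm (W x)" if "z \<in> closed_segment x ?y" for z
      using segment_bound(1)[OF that] t(1) by simp
    have "joined (chart_inv c x) (chart_inv c ?y) (t * (norm (?D x (W x)) + e))"
    proof (rule joined_segment[OF c])
      show "closed_segment x ?y \<subseteq> chart_image c"
        using near tB(1) inK'[OF x] K'\<Omega> by (meson less_imp_le order_trans subsetD subsetI)
      show "0 \<le> t * (norm (?D x (W x)) + e)" using t(1) e by simp
      fix z assume z: "z \<in> closed_segment x ?y"
      have zK: "z \<in> K'" "x \<in> K'" using inK'[OF x, of z] inK'[OF x, of x] near[OF z] tB(1) \<rho>(1) by auto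
      have "dist (z, x) (x, x) < d" using near[OF z] tB(2) by (simp add: dist_Pair_Pair dist_norm)
      then have "dist (?N (z, x)) (?N (x, x)) < e" using zK x by (intro d(2)) auto
      then have "norm (?D z (W x)) \<le> norm (?D x (W x)) + e" by (simp add: dist_real_def)
      moreover have "?D z (?y - x) = t *\<^sub>R ?D z (W x)"
        using linear_scale[OF linear_dF[OF c, of z]] zK K'\<Omega> by auto
      ultimately show "norm (?D z (?y - x)) \<le> t * (norm (?D x (W x)) + e)" using t(1) by simp
    qed
    from lip[OF this] show ?thesis by simp
  qed
  then show ?thesis using t0 by blast
qed

text \<open>
  The divergence inequality, applied in the chart to the coordinate field of \<open>\<xi> V\<close> times the weight and to \<open>\<eta> = \<phi>\<^sup>2\<close>.
  If \<open>\<phi>\<close> is Lipschitz with constant \<open>1 / R\<close>, then \<open>\<phi>\<^sup>2\<close> changes along \<open>\<xi> V\<close> at rate at most \<open>2 \<phi> \<xi> |V| / R\<close>.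
\<close>

lemma chart_flux_inequality:
  fixes \<phi> \<xi> :: "'a \<Rightarrow> real"
  assumes c: "c \<in> A" and R: "0 < R" and lip: "\<And>x y l. joined x y l \<Longrightarrow> \<bar>\<phi> y - \<phi> x\<bar> \<le> l / R"
    and \<phi>: "\<And>x. 0 \<le> \<phi> x" "\<And>x. \<phi> x \<le> 1"
    and \<xi>: "C1_function \<xi>" "\<And>x. 0 \<le> \<xi> x" and K: "compact K" "K \<subseteq> fst c" "\<And>x. x \<notin> K \<Longrightarrow> \<xi> x = 0"
  shows "weighted_integral T c (\<lambda>p. (\<phi> p)\<^sup>2 * (\<xi> p * flux_divergence p + mgrad \<xi> p \<bullet> flux p))
    \<le> weighted_integral T c (\<lambda>p. 2 / R * \<phi> p * \<xi> p * norm (flux p))"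
proof -
  interpret P: immersed_patch "in_chart F c" "chart_image c" by (rule patch[OF c])
  let ?K = "snd c ` K" and ?\<Omega> = "chart_image c"
  note ic = image_in_chart[OF c K(2)]
  have cK: "compact ?K" by (rule ic(3)[OF K(1)])
  have c\<phi>: "continuous_on UNIV \<phi>" by (rule continuous_of_joined_Lipschitz[OF R lip])
  define W where "W x = (if x \<in> ?\<Omega> then (P.weight T x * in_chart \<xi> c x) *\<^sub>R flux_coords c x else 0)" for x
  have off: "in_chart \<xi> c x = 0" if "x \<in> ?\<Omega>" "x \<notin> ?K" for x
    using ic(2)[OF that(1)] that(2) K(3) by (simp add: in_chart_def)
  have W0: "W x = 0" if "x \<notin> ?K" for x using off[of x] that by (simp add: W_def)
  have "C1_on W (?\<Omega> \<union> - ?K)"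
  proof (rule C1_on_open_Un)
    show "C1_on W ?\<Omega>"
      by (rule C1_on_cong[OF chart_facts(2)[OF c], where g = "\<lambda>x. (P.weight T x * in_chart \<xi> c x) *\<^sub>R flux_coords c x"])
        (auto simp: W_def intro!: C1_on_scaleR C1_on_mult P.C1_weight C1_functionD[OF \<xi>(1) c] C1_flux_coords[OF c])
    show "C1_on W (- ?K)"
      by (rule C1_on_cong[where g = "\<lambda>_. 0"]) (use cK W0 in \<open>auto simp: compact_imp_closed\<close>)
  qed (use cK chart_facts(2)[OF c] in \<open>auto simp: compact_imp_closed\<close>)
  moreover have "?\<Omega> \<union> - ?K = UNIV" using ic(1) by blast
  ultimately have C1W: "C1_on W UNIV" by simp
  let ?\<eta> = "\<lambda>x. (\<phi> (chart_inv c x))\<^sup>2"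
  let ?b = "\<lambda>p. 2 / R * \<phi> p * \<xi> p * norm (flux p)"
  let ?M = "\<lambda>x. P.weight T x * ?b (chart_inv c x)"
  have cb: "continuous_on UNIV ?b"
    by (intro continuous_intros c\<phi> C1_function_continuous \<xi> continuous_flux)
  have JW: "norm (frechet_derivative (in_chart F c) (at x) (W x)) = P.weight T x * \<xi> (chart_inv c x) * norm (flux (chart_inv c x))"
    if "x \<in> ?K" for x
  proof -
    have x: "x \<in> ?\<Omega>" using ic(1) that by blast
    have "0 \<le> P.weight T x * \<xi> (chart_inv c x)" using P.weight_pos[OF x, of T] \<xi>(2) by (simp add: less_imp_le)
    moreover have "frechet_derivative (in_chart F c) (at x) (W x) = (P.weight T x * \<xi> (chart_inv c x)) *\<^sub>R flux (chart_inv c x)"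
    proof -
      have "in_chart \<xi> c x = \<xi> (chart_inv c x)" by (simp add: in_chart_def)
      then have "W x = (P.weight T x * \<xi> (chart_inv c x)) *\<^sub>R flux_coords c x" using x by (simp add: W_def)
      then show ?thesis by (simp only: linear_scale[OF linear_dF[OF c x]] flux_chart[OF c x])
    qed
    ultimately show ?thesis by simp
  qed
  have "integral ?K (\<lambda>x. ?\<eta> x * (\<Sum>i\<in>UNIV. partial_deriv i (\<lambda>q. W q $ i) x)) \<le> integral ?K ?M"
  proof (rule divergence_inequality[OF cK C1W W0])
    show "continuous_on ?K ?\<eta>"
      by (intro continuous_intros continuous_on_compose2[OF c\<phi> continuous_on_subset[OF chart_facts(4)[OF c] ic(1)]]) auto
    show "continuous_on ?K ?M" by (rule continuous_weighted_integrand[OF c cb ic(1)])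
    fix e :: real assume e: "0 < e"
    let ?N = "\<lambda>x. norm (frechet_derivative (in_chart F c) (at x) (W x))"
    have cW: "continuous_on ?K W" using C1_on_continuous[OF C1W] by (rule continuous_on_subset) simp
    have "continuous_on ?K ?N"
      by (intro continuous_on_norm continuous_on_frechet_derivative[OF C1_F[OF c]] continuous_on_id cW) (use ic(1) in auto)
    from compact_imp_bounded[OF compact_continuous_image[OF this cK]]
    obtain C where C0: "C > 0" "\<forall>y \<in> ?N ` ?K. norm y \<le> C" unfolding bounded_pos by blast
    have C: "?N x \<le> C" if "x \<in> ?K" for x
      using bspec[OF C0(2) imageI[OF that]] by simp
    \<comment> \<open>with this choice the error \<open>2 \<phi> e' / R\<close> of the linear term is at most \<open>e / 2\<close>\<close>
    define e' where "e' = e * R / 4"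
    have e': "e' > 0" using e R by (simp add: e'_def)
    obtain t1 where t1: "t1 > 0" "\<And>t x. 0 < t \<Longrightarrow> t < t1 \<Longrightarrow> x \<in> ?K \<Longrightarrow>
        \<bar>\<phi> (chart_inv c (x + t *\<^sub>R W x)) - \<phi> (chart_inv c x)\<bar> \<le> t * ((?N x + e') / R)"
      using Lipschitz_along_field[where \<phi> = \<phi>, OF c cK ic(1) cW R lip e'] by blast
    let ?q = "((C + e') / R)\<^sup>2"
    define Q where "Q = ?q + 1"
    have Q: "Q > 0" "?q \<le> Q" by (simp_all add: Q_def add_nonneg_pos)
    define t0 where "t0 = min t1 (e / (2 * Q))"
    have t0: "t0 > 0" using t1(1) e Q by (simp add: t0_def)
    show "\<exists>t0>0. \<forall>t x. 0 < t \<longrightarrow> t < t0 \<longrightarrow> x \<in> ?K \<longrightarrow> \<bar>?\<eta> (x + t *\<^sub>R W x) - ?\<eta> x\<bar> \<le> t * (?M x + e)"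
    proof (intro exI[of _ t0] conjI allI impI t0)
      fix t x assume t: "0 < t" "t < t0" and x: "x \<in> ?K"
      define a where "a = \<phi> (chart_inv c x)"
      define b where "b = \<phi> (chart_inv c (x + t *\<^sub>R W x))"
      define n where "n = (?N x + e') / R"
      have ab: "0 \<le> a" "a \<le> 1" "0 \<le> b" using \<phi> by (auto simp: a_def b_def)
      have n: "0 \<le> n" "n \<le> (C + e') / R"
        using C[OF x] e' R by (auto simp: n_def intro!: divide_right_mono)
      have d: "\<bar>b - a\<bar> \<le> t * n" using t1(2)[OF t(1) _ x] t(2) by (simp add: a_def b_def n_def t0_def)
      have "b\<^sup>2 - a\<^sup>2 = (b - a) * (b + a)" by (simp add: power2_eq_square algebra_simps)
      then have "\<bar>b\<^sup>2 - a\<^sup>2\<bar> = \<bar>b - a\<bar> * (b + a)" using ab by (simp add: abs_mult)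
      also have "\<dots> \<le> (t * n) * (2 * a + t * n)"
        using d ab n t by (intro mult_mono) auto
      also have "\<dots> = t * (2 * a * n + t * n\<^sup>2)" by (simp add: power2_eq_square algebra_simps)
      also have "\<dots> \<le> t * (?M x + e)"
      proof (rule mult_left_mono)
        have "2 * a * n = ?M x + 2 * a * (e' / R)"
          using JW[OF x] by (simp add: n_def a_def add_divide_distrib algebra_simps)
        moreover have "2 * a * (e' / R) \<le> e / 2"
        proof -
          have E: "e' / R = e / 4" using R by (simp add: e'_def)
          have "a * e \<le> 1 * e" using ab e by (intro mult_right_mono) auto
          then show ?thesis unfolding E by simp
        qed
        moreover have "t * n\<^sup>2 \<le> e / 2"
        proof -
          have "n\<^sup>2 \<le> Q" using n Q(2) power_mono[OF n(2,1), of 2] by linarith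
          then have "t * n\<^sup>2 \<le> t * Q" using t by (intro mult_left_mono) auto
          also have "\<dots> \<le> e / (2 * Q) * Q" using t Q by (intro mult_right_mono) (auto simp: t0_def)
          also have "\<dots> = e / 2" using Q by simp
          finally show ?thesis .
        qed
        ultimately show "2 * a * n + t * n\<^sup>2 \<le> ?M x + e" by linarith
      qed (use t in simp)
      finally show "\<bar>?\<eta> (x + t *\<^sub>R W x) - ?\<eta> x\<bar> \<le> t * (?M x + e)" by (simp only: a_def b_def)
    qed
  qed simp_all
  also have "integral ?K (\<lambda>x. ?\<eta> x * (\<Sum>i\<in>UNIV. partial_deriv i (\<lambda>q. W q $ i) x))
    = integral ?K (\<lambda>x. P.weight T x * ((\<phi> (chart_inv c x))\<^sup>2 *
        (\<xi> (chart_inv c x) * flux_divergence (chart_inv c x) + mgrad \<xi> (chart_inv c x) \<bullet> flux (chart_inv c x))))"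
  proof (rule integral_cong)
    fix x assume "x \<in> ?K"
    then have x: "x \<in> ?\<Omega>" using ic(1) by blast
    have "partial_deriv i (\<lambda>q. W q $ i) x = partial_deriv i (\<lambda>q. (P.weight T q * in_chart \<xi> c q) * flux_coords c q $ i) x" for i
      unfolding partial_deriv_def
      by (subst frechet_derivative_cong_open[OF chart_facts(2)[OF c] x, of _ "\<lambda>q. (P.weight T q * in_chart \<xi> c q) * flux_coords c q $ i"])
        (auto simp: W_def)
    then show "?\<eta> x * (\<Sum>i\<in>UNIV. partial_deriv i (\<lambda>q. W q $ i) x) = P.weight T x * (?\<eta> x *
        (\<xi> (chart_inv c x) * flux_divergence (chart_inv c x) + mgrad \<xi> (chart_inv c x) \<bullet> flux (chart_inv c x)))"
      using weighted_flux_divergence[OF c x \<xi>(1)] by (simp add: mult_ac)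
  qed
  also have "\<dots> = weighted_integral T c (\<lambda>p. (\<phi> p)\<^sup>2 * (\<xi> p * flux_divergence p + mgrad \<xi> p \<bullet> flux p))"
  proof (rule weighted_integral_eq[symmetric, OF c K(2)])
    fix p assume p: "p \<notin> K"
    have "mgrad \<xi> p = 0"
      by (rule mgrad_locally_constant[OF \<xi>(1), of "- K" p 0]) (use K p in \<open>auto simp: compact_imp_closed\<close>)
    then show "(\<phi> p)\<^sup>2 * (\<xi> p * flux_divergence p + mgrad \<xi> p \<bullet> flux p) = 0" using K(3)[OF p] by simp
  qed
  also have "integral ?K ?M = weighted_integral T c ?b"
    by (rule weighted_integral_eq[symmetric, OF c K(2)]) (simp add: K(3))
  finally show ?thesis .
qed

end


section \<open>Partition of unity and vanishing\<close>

context immersed_manifold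
begin

text \<open>
  Finitely many bumps \<open>\<theta>\<^sub>i\<close> have a sum \<open>\<Psi>\<close> that is at least some \<open>m > 0\<close> on \<open>K0\<close>.  Dividing by
  \<open>\<Psi> + (max 0 (m - \<Psi>))\<^sup>2\<close> instead of \<open>\<Psi>\<close> changes nothing on \<open>K0\<close> and keeps the denominator positive elsewhere.
\<close>

lemma ex_partition_of_unity:
  assumes K0: "compact K0"
  obtains I :: "'a set" and c \<xi> S where "finite I" "\<And>i. i \<in> I \<Longrightarrow> c i \<in> A"
    "\<And>i. i \<in> I \<Longrightarrow> C1_function (\<xi> i)" "\<And>i p. i \<in> I \<Longrightarrow> 0 \<le> \<xi> i p"
    "\<And>i. i \<in> I \<Longrightarrow> compact (S i)" "\<And>i. i \<in> I \<Longrightarrow> S i \<subseteq> fst (c i)"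
    "\<And>i p. i \<in> I \<Longrightarrow> p \<notin> S i \<Longrightarrow> \<xi> i p = 0"
    "\<And>p. (\<Sum>i\<in>I. \<xi> i p) \<le> 1" "\<And>p. p \<in> K0 \<Longrightarrow> (\<Sum>i\<in>I. \<xi> i p) = 1"
proof (cases "K0 = {}")
  case True
  then show ?thesis by (intro that[of "{}" undefined undefined undefined]) auto
next
  case False
  have "\<exists>c \<theta> S. c \<in> A \<and> C1_function \<theta> \<and> (\<forall>q. 0 \<le> \<theta> q) \<and> 0 < \<theta> p \<and> compact S \<and> S \<subseteq> fst c \<and>
      (\<forall>q. q \<notin> S \<longrightarrow> \<theta> q = 0)" for p
    by (rule ex_bump[OF open_UNIV UNIV_I, of p]) blast
  then obtain c \<theta> S where \<theta>: "\<And>i. c i \<in> A" "\<And>i. C1_function (\<theta> i)" "\<And>i q. 0 \<le> \<theta> i q" "\<And>i. 0 < \<theta> i i"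
    "\<And>i. compact (S i)" "\<And>i. S i \<subseteq> fst (c i)" "\<And>i q. q \<notin> S i \<Longrightarrow> \<theta> i q = 0" by metis
  have c\<theta>: "continuous_on UNIV (\<theta> i)" for i by (rule C1_function_continuous[OF \<theta>(2)])
  have o: "open {q. 0 < \<theta> i q}" for i by (rule open_Collect_less[OF continuous_on_const c\<theta>])
  have cover: "K0 \<subseteq> (\<Union>i\<in>K0. {q. 0 < \<theta> i q})" using \<theta>(4) by blast
  obtain I where I: "I \<subseteq> K0" "finite I" "K0 \<subseteq> (\<Union>i\<in>I. {q. 0 < \<theta> i q})"
    by (rule compactE_image[OF K0 o cover])
  define \<Psi> where "\<Psi> p = (\<Sum>i\<in>I. \<theta> i p)" for p
  have \<Psi>0: "0 \<le> \<Psi> p" for p unfolding \<Psi>_def by (intro sum_nonneg \<theta>(3))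
  have \<Psi>pos: "0 < \<Psi> p" if "p \<in> K0" for p
  proof -
    obtain i where "i \<in> I" "0 < \<theta> i p" using I(3) \<open>p \<in> K0\<close> by blast
    then show ?thesis unfolding \<Psi>_def using I(2) \<theta>(3) by (intro sum_pos2) auto
  qed
  have "continuous_on K0 \<Psi>"
    unfolding \<Psi>_def by (intro continuous_on_sum continuous_on_subset[OF c\<theta>]) auto
  then obtain q where q: "q \<in> K0" "\<And>p. p \<in> K0 \<Longrightarrow> \<Psi> q \<le> \<Psi> p"
    using continuous_attains_inf[OF K0 False] by blast
  define D where "D p = \<Psi> p + (max 0 (\<Psi> q - \<Psi> p))\<^sup>2" for p
  have D: "0 < D p" for p
    using \<Psi>0[of p] \<Psi>pos[OF q(1)] by (cases "\<Psi> p = 0") (auto simp: D_def intro!: add_pos_nonneg)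
  define \<xi> where "\<xi> i p = \<theta> i p / D p" for i p
  have sum\<xi>: "(\<Sum>i\<in>I. \<xi> i p) = \<Psi> p / D p" for p by (simp add: \<xi>_def \<Psi>_def sum_divide_distrib)
  have C1: "C1_function (\<xi> i)" for i
  proof (rule C1_functionI)
    fix d assume d: "d \<in> A"
    have "C1_on (\<lambda>x. in_chart (\<theta> i) d x / ((\<Sum>i\<in>I. in_chart (\<theta> i) d x) +
        (max 0 (\<Psi> q - (\<Sum>i\<in>I. in_chart (\<theta> i) d x)))\<^sup>2)) (chart_image d)"
    proof (intro C1_on_divide C1_on_add C1_on_square_pos_part C1_on_diff C1_on_sum C1_on_const C1_functionD[OF \<theta>(2) d])
      fix x
      have "D (chart_inv d x) \<noteq> 0" using D[of "chart_inv d x"] by simp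
      then show "(\<Sum>i\<in>I. in_chart (\<theta> i) d x) + (max 0 (\<Psi> q - (\<Sum>i\<in>I. in_chart (\<theta> i) d x)))\<^sup>2 \<noteq> 0"
        by (simp add: D_def \<Psi>_def in_chart_def)
    qed
    then show "C1_on (in_chart (\<xi> i) d) (chart_image d)"
      by (simp add: in_chart_def \<xi>_def D_def \<Psi>_def o_def)
  qed
  show ?thesis
  proof (rule that[of I c \<xi> S])
    show "finite I" by (rule I)
    show "c i \<in> A" "C1_function (\<xi> i)" "compact (S i)" "S i \<subseteq> fst (c i)" for i by (rule \<theta> C1)+
    show "0 \<le> \<xi> i p" for i p using \<theta>(3)[of i p] D[of p] by (simp add: \<xi>_def)
    show "\<xi> i p = 0" if "p \<notin> S i" for i p using \<theta>(7)[OF that] by (simp add: \<xi>_def)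
    show "(\<Sum>i\<in>I. \<xi> i p) \<le> 1" for p
      unfolding sum\<xi> using D[of p] by (simp add: D_def)
    show "(\<Sum>i\<in>I. \<xi> i p) = 1" if "p \<in> K0" for p
      unfolding sum\<xi> using \<Psi>pos[OF that] q(2)[OF that] by (simp add: D_def)
  qed
qed

end

context translator
begin

text \<open>
  Young's inequality and \<open>|\<nabla>h| \<le> 1\<close> absorb the mixed terms into \<open>8 |\<nabla>u|\<^sup>2\<close> and \<open>u\<^sup>2\<close>; what remains of the cutoff error is
  of order \<open>u\<^sup>2 / R\<^sup>2\<close>.
\<close>

lemma energy_inequality:
  fixes s R :: real
  assumes s: "0 \<le> s" and R: "0 < R"
  shows "s\<^sup>2 * (u p)\<^sup>2 / 4 - 20 / R\<^sup>2 * (u p)\<^sup>2 \<le> s\<^sup>2 * flux_divergence p - 2 / R * s * norm (flux p)"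
proof -
  define a where "a = norm (mgrad u p)"
  define v where "v = \<bar>u p\<bar>"
  have av: "0 \<le> a" "0 \<le> v" "(u p)\<^sup>2 = v\<^sup>2" "mgrad u p \<bullet> mgrad u p = a\<^sup>2" by (auto simp: a_def v_def power2_norm_eq_inner)
  have "norm (flux p) \<le> 8 * v * a + v\<^sup>2 * norm (mgrad height p)"
    unfolding flux_def by (rule order_trans[OF norm_triangle_ineq4]) (simp add: a_def v_def abs_mult)
  also have "\<dots> \<le> 8 * v * a + v\<^sup>2 * 1" using norm_mgrad_height[of p] by (intro add_left_mono mult_left_mono) auto
  finally have "2 / R * s * norm (flux p) \<le> 2 / R * s * (8 * v * a + v\<^sup>2)"
    using s R by (intro mult_left_mono) auto
  also have "\<dots> \<le> (4 * s\<^sup>2 * a\<^sup>2 + 16 * v\<^sup>2 / R\<^sup>2) + (s\<^sup>2 * v\<^sup>2 / 4 + 4 * v\<^sup>2 / R\<^sup>2)"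
  proof -
    have "0 \<le> (2 * s * a - 4 * v / R)\<^sup>2" "0 \<le> (s * v / 2 - 2 * v / R)\<^sup>2" by simp_all
    then show ?thesis using R by (simp add: power2_diff power_mult_distrib power_divide algebra_simps power2_eq_square)
  qed
  finally have 1: "2 / R * s * norm (flux p) \<le> 4 * s\<^sup>2 * a\<^sup>2 + s\<^sup>2 * v\<^sup>2 / 4 + 20 / R\<^sup>2 * v\<^sup>2" by simp
  have "2 * u p * (mgrad u p \<bullet> mgrad height p) \<le> 2 * v * a"
  proof -
    have "\<bar>mgrad u p \<bullet> mgrad height p\<bar> \<le> a * norm (mgrad height p)" unfolding a_def by (rule Cauchy_Schwarz_ineq2)
    also have "\<dots> \<le> a * 1" using norm_mgrad_height[of p] av by (intro mult_left_mono) auto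
    finally have "\<bar>u p * (mgrad u p \<bullet> mgrad height p)\<bar> \<le> v * a"
      unfolding abs_mult v_def[symmetric] using av by (intro mult_left_mono) auto
    then show ?thesis by (simp add: abs_le_iff)
  qed
  moreover have "2 * v * a \<le> 4 * a\<^sup>2 + v\<^sup>2 / 4"
  proof -
    have "0 \<le> (2 * a - v / 2)\<^sup>2" by simp
    then show ?thesis by (simp add: power2_diff power_mult_distrib power_divide mult_ac)
  qed
  ultimately have "4 * a\<^sup>2 + v\<^sup>2 / 2 \<le> flux_divergence p"
    unfolding flux_divergence_def av(3,4) using zero_le_power2[of v] by linarith
  then have "s\<^sup>2 * (4 * a\<^sup>2 + v\<^sup>2 / 2) \<le> s\<^sup>2 * flux_divergence p" by (intro mult_left_mono) auto
  then show ?thesis using 1 unfolding av(3) by (simp add: algebra_simps)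
qed

text \<open>
  Let \<open>J\<close> be the weighted integral of \<open>\<theta> u\<^sup>2\<close> for a bump \<open>\<theta>\<close> at \<open>p0\<close>.  Summing the chart inequalities over a partition of unity
  on the support of the cutoff \<open>\<phi>\<close> bounds \<open>J / 16\<close> by \<open>20 E / R\<^sup>2\<close>, where \<open>E\<close> is the energy of \<open>u\<close>: the terms with
  \<open>\<nabla>\<xi>\<^sub>i\<close> cancel because the \<open>\<xi>\<^sub>i\<close> add up to 1 on the open set where \<open>\<phi>\<close> is positive.  As \<open>R\<close> grows this forces
  \<open>J = 0\<close>, so \<open>u\<close> vanishes at \<open>p0\<close>.
\<close>

lemma u_vanishes:
  assumes complete: "complete_immersion A F"
    and finite_energy: "(\<integral>\<^sup>+p. ennreal ((u p)\<^sup>2 * exp (- (F p \<bullet> T))) \<partial>volume_measure A F) < \<infinity>"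
  shows "u p0 = 0"
proof (rule ccontr)
  assume u0: "u p0 \<noteq> 0"
  define E where "E = enn2real (\<integral>\<^sup>+p. ennreal ((u p)\<^sup>2 * exp (- (F p \<bullet> T))) \<partial>volume_measure A F)"
  have E: "ennreal E = (\<integral>\<^sup>+p. ennreal ((u p)\<^sup>2 * exp (- (F p \<bullet> T))) \<partial>volume_measure A F)" "0 \<le> E"
    unfolding E_def using finite_energy by (simp_all add: less_top[symmetric])
  note cu = C1_function_continuous[OF C1_u]
  obtain U where U: "open U" "p0 \<in> U" "\<And>p. p \<in> U \<Longrightarrow> joined p0 p 1"
    by (rule joined_nearby[OF zero_less_one, of p0]) blast
  obtain c0 \<theta> K\<^sub>\<theta> where c0: "c0 \<in> A" and \<theta>: "C1_function \<theta>" "\<And>q. 0 \<le> \<theta> q" "\<And>q. \<theta> q \<le> 1" "0 < \<theta> p0"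
    "compact K\<^sub>\<theta>" "K\<^sub>\<theta> \<subseteq> fst c0 \<inter> U" "\<And>q. q \<notin> K\<^sub>\<theta> \<Longrightarrow> \<theta> q = 0"
    by (rule ex_bump[OF U(1,2)]) blast
  note c\<theta> = C1_function_continuous[OF \<theta>(1)]
  have s\<theta>: "supported_in c0 \<theta>" by (rule supported_inI[OF c\<theta> \<theta>(5)]) (use \<theta> in auto)
  define J where "J = weighted_integral T c0 (\<lambda>p. \<theta> p * (u p)\<^sup>2)"
  have bound: "J / 16 \<le> 20 / R\<^sup>2 * E" if R: "2 \<le> R" for R
  proof -
    have R0: "0 < R" using R by simp
    obtain \<phi> :: "'a \<Rightarrow> real" and K0 where \<phi>: "\<And>x. 0 \<le> \<phi> x" "\<And>x. \<phi> x \<le> 1"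
      "\<And>x y l. joined x y l \<Longrightarrow> \<bar>\<phi> y - \<phi> x\<bar> \<le> l / R"
      "compact K0" "\<And>x. x \<notin> K0 \<Longrightarrow> \<phi> x = 0" "\<And>x l. joined p0 x l \<Longrightarrow> 1 - l / R \<le> \<phi> x"
      by (rule ex_cutoff[OF complete R0, of p0]) blast
    have c\<phi>: "continuous_on UNIV \<phi>" by (rule continuous_of_joined_Lipschitz[OF R0 \<phi>(3)])
    obtain I :: "'a set" and c \<xi> S where I: "finite I" and c: "\<And>i. i \<in> I \<Longrightarrow> c i \<in> A"
      and \<xi>: "\<And>i. i \<in> I \<Longrightarrow> C1_function (\<xi> i)" "\<And>i p. i \<in> I \<Longrightarrow> 0 \<le> \<xi> i p"
      and S: "\<And>i. i \<in> I \<Longrightarrow> compact (S i)" "\<And>i. i \<in> I \<Longrightarrow> S i \<subseteq> fst (c i)"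
        "\<And>i p. i \<in> I \<Longrightarrow> p \<notin> S i \<Longrightarrow> \<xi> i p = 0"
      and le1: "\<And>p. (\<Sum>i\<in>I. \<xi> i p) \<le> 1" and eq1: "\<And>p. p \<in> K0 \<Longrightarrow> (\<Sum>i\<in>I. \<xi> i p) = 1"
      by (rule ex_partition_of_unity[OF \<phi>(4)]) blast
    note c\<xi> = C1_function_continuous[OF \<xi>(1)]
    have s\<xi>: "supported_in (c i) (\<xi> i)" if "i \<in> I" for i
      by (rule supported_inI[OF c\<xi>[OF that] S(1)[OF that] S(2)[OF that] S(3)[OF that]])
    let ?W = "\<lambda>i. weighted_integral T (c i)"
    have mg0: "mgrad (\<xi> i) p = 0" if "i \<in> I" "p \<notin> S i" for i p
      by (rule mgrad_locally_constant[OF \<xi>(1)[OF that(1)], of "- S i" p 0])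
        (use S that in \<open>auto simp: compact_imp_closed\<close>)
    define g where "g i p = (\<phi> p)\<^sup>2 * (mgrad (\<xi> i) p \<bullet> flux p)" for i p
    have cg: "continuous_on UNIV (g i)" if "i \<in> I" for i
      unfolding g_def by (intro continuous_intros c\<phi> continuous_mgrad \<xi>(1) that continuous_flux)
    have g0: "g i p = 0" if "i \<in> I" "p \<notin> S i" for i p using mg0[OF that] by (simp add: g_def)
    have sg: "supported_in (c i) (g i)" if "i \<in> I" for i
      by (rule supported_inI[OF cg[OF that] S(1)[OF that] S(2)[OF that] g0[OF that]])
    \<comment> \<open>integrals in one chart are redistributed over all charts\<close>
    have split: "weighted_integral T d b = (\<Sum>j\<in>I. ?W j (\<lambda>p. \<xi> j p * b p))"
      if d: "d \<in> A" and b: "continuous_on UNIV b" and K: "compact K" "K \<subseteq> fst d" "\<And>p. p \<notin> K \<Longrightarrow> b p = 0"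
        and b0: "\<And>p. \<phi> p = 0 \<Longrightarrow> b p = 0" for d b K
    proof -
      have "b = (\<lambda>p. \<Sum>j\<in>I. \<xi> j p * b p)"
      proof
        fix p
        have "(\<Sum>j\<in>I. \<xi> j p) * b p = b p" using eq1[of p] \<phi>(5)[of p] b0[of p] by (cases "p \<in> K0") auto
        then show "b p = (\<Sum>j\<in>I. \<xi> j p * b p)" by (simp add: sum_distrib_right)
      qed
      then have "weighted_integral T d b = weighted_integral T d (\<lambda>p. \<Sum>j\<in>I. \<xi> j p * b p)" by simp
      also have "\<dots> = (\<Sum>j\<in>I. weighted_integral T d (\<lambda>p. \<xi> j p * b p))"
        by (rule weighted_integral_sum[OF d], rule supported_inI[OF _ K(1,2)])
          (use K(3) in \<open>auto intro!: continuous_intros c\<xi> b\<close>)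
      also have "\<dots> = (\<Sum>j\<in>I. ?W j (\<lambda>p. \<xi> j p * b p))"
      proof (rule sum.cong[OF refl])
        fix j assume j: "j \<in> I"
        show "weighted_integral T d (\<lambda>p. \<xi> j p * b p) = ?W j (\<lambda>p. \<xi> j p * b p)"
        proof (rule weighted_integral_chart_independent[OF d c[OF j]])
          show "continuous_on UNIV (\<lambda>p. \<xi> j p * b p)" by (intro continuous_intros c\<xi> j b)
          show "compact (K \<inter> S j)" using K(1) S(1)[OF j] by (simp add: compact_Int_closed compact_imp_closed)
          show "K \<inter> S j \<subseteq> fst d \<inter> fst (c j)" using K(2) S(2)[OF j] by blast
          show "\<xi> j p * b p = 0" if "p \<notin> K \<inter> S j" for p using that K(3)[of p] S(3)[OF j, of p] by auto
        qed
      qed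
      finally show ?thesis .
    qed
    have "(\<Sum>i\<in>I. ?W i (g i)) = (\<Sum>i\<in>I. \<Sum>j\<in>I. ?W j (\<lambda>p. \<xi> j p * g i p))"
    proof (rule sum.cong[OF refl])
      fix i assume i: "i \<in> I"
      show "?W i (g i) = (\<Sum>j\<in>I. ?W j (\<lambda>p. \<xi> j p * g i p))"
        by (rule split[OF c[OF i] cg[OF i] S(1)[OF i] S(2)[OF i]]) (simp_all add: g0[OF i], simp add: g_def)
    qed
    also have "\<dots> = (\<Sum>j\<in>I. \<Sum>i\<in>I. ?W j (\<lambda>p. \<xi> j p * g i p))" by (rule sum.swap)
    also have "\<dots> = (\<Sum>j\<in>I. ?W j (\<lambda>p. \<Sum>i\<in>I. \<xi> j p * g i p))"
      by (intro sum.cong refl weighted_integral_sum[symmetric] c supported_in_mult[OF s\<xi>] cg)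
    also have "\<dots> = (\<Sum>j\<in>I. 0)"
    proof (rule sum.cong[OF refl])
      fix j
      have "(\<Sum>i\<in>I. \<xi> j p * g i p) = 0" for p
      proof (cases "\<phi> p = 0")
        case False
        let ?V = "{q. 0 < \<phi> q}"
        have "mgrad (\<lambda>q. \<Sum>i\<in>I. \<xi> i q) p = 0"
        proof (rule mgrad_locally_constant[where U = ?V and k = 1])
          show "C1_function (\<lambda>q. \<Sum>i\<in>I. \<xi> i q)" by (rule C1_function_sum[OF \<xi>(1)])
          show "open ?V" by (rule open_Collect_less[OF continuous_on_const c\<phi>])
          show "p \<in> ?V" using False \<phi>(1)[of p] by simp
          show "(\<Sum>i\<in>I. \<xi> i q) = 1" if "q \<in> ?V" for q using that \<phi>(5)[of q] eq1[of q] by force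
        qed
        then have "(\<Sum>i\<in>I. mgrad (\<xi> i) p) = 0" using mgrad_sum[of I \<xi> p, OF \<xi>(1)] by simp
        moreover have "(\<Sum>i\<in>I. \<xi> j p * g i p) = \<xi> j p * (\<phi> p)\<^sup>2 * ((\<Sum>i\<in>I. mgrad (\<xi> i) p) \<bullet> flux p)"
          by (simp add: g_def inner_sum_left sum_distrib_left mult.assoc)
        ultimately show ?thesis by simp
      qed (simp add: g_def)
      then show "?W j (\<lambda>p. \<Sum>i\<in>I. \<xi> j p * g i p) = 0" by (simp add: weighted_integral_zero)
    qed
    finally have cancel: "(\<Sum>i\<in>I. ?W i (g i)) = 0" by simp
    have main: "?W i (\<lambda>p. \<xi> i p * ((\<phi> p)\<^sup>2 * (u p)\<^sup>2)) / 4 + ?W i (g i) \<le> 20 / R\<^sup>2 * ?W i (\<lambda>p. \<xi> i p * (u p)\<^sup>2)"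
      if i: "i \<in> I" for i
    proof -
      let ?X = "\<lambda>p. \<xi> i p * ((\<phi> p)\<^sup>2 * (u p)\<^sup>2)" and ?Y = "\<lambda>p. \<xi> i p * (u p)\<^sup>2"
      let ?Z = "\<lambda>p. 2 / R * \<phi> p * \<xi> i p * norm (flux p)"
      have sX: "supported_in (c i) ?X" and sY: "supported_in (c i) ?Y"
        by (intro supported_in_mult[OF s\<xi>[OF i]] continuous_intros c\<phi> cu)+
      have "supported_in (c i) (\<lambda>p. \<xi> i p * (2 / R * \<phi> p * norm (flux p)))"
        by (intro supported_in_mult[OF s\<xi>[OF i]] continuous_intros c\<phi> continuous_flux)
      then have sZ: "supported_in (c i) ?Z" by (simp add: mult_ac)
      have s4X: "supported_in (c i) (\<lambda>p. 1 / 4 * ?X p)" and s20Y: "supported_in (c i) (\<lambda>p. - 20 / R\<^sup>2 * ?Y p)"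
        using supported_in_mult[OF sX continuous_on_const, of "1/4"] supported_in_mult[OF sY continuous_on_const, of "- 20 / R\<^sup>2"]
        by (simp_all add: mult_ac)
      have sD: "supported_in (c i) (\<lambda>p. \<xi> i p * ((\<phi> p)\<^sup>2 * flux_divergence p))"
        by (intro supported_in_mult[OF s\<xi>[OF i]] continuous_intros c\<phi> continuous_flux_divergence)
      have "1 / 4 * ?W i ?X + - 20 / R\<^sup>2 * ?W i ?Y + (?W i ?Z + ?W i (g i))
        = ?W i (\<lambda>p. (1 / 4 * ?X p + - 20 / R\<^sup>2 * ?Y p) + (?Z p + g i p))"
        by (simp only: weighted_integral_add[OF c[OF i]] weighted_integral_cmult supported_in_add s4X s20Y sZ sg[OF i])
      also have "\<dots> \<le> ?W i (\<lambda>p. \<xi> i p * ((\<phi> p)\<^sup>2 * flux_divergence p) + g i p)"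
      proof (rule weighted_integral_mono[OF c[OF i]])
        show "supported_in (c i) (\<lambda>p. (1 / 4 * ?X p + - 20 / R\<^sup>2 * ?Y p) + (?Z p + g i p))"
          by (intro supported_in_add s4X s20Y sZ sg[OF i])
        show "supported_in (c i) (\<lambda>p. \<xi> i p * ((\<phi> p)\<^sup>2 * flux_divergence p) + g i p)"
          by (intro supported_in_add sD sg[OF i])
        fix p
        have "\<xi> i p * ((\<phi> p)\<^sup>2 * (u p)\<^sup>2 / 4 - 20 / R\<^sup>2 * (u p)\<^sup>2) \<le>
            \<xi> i p * ((\<phi> p)\<^sup>2 * flux_divergence p - 2 / R * \<phi> p * norm (flux p))"
          by (intro mult_left_mono energy_inequality \<phi>(1) R0 \<xi>(2)[OF i])
        then show "(1 / 4 * ?X p + - 20 / R\<^sup>2 * ?Y p) + (?Z p + g i p) \<le> \<xi> i p * ((\<phi> p)\<^sup>2 * flux_divergence p) + g i p"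
          by (simp add: algebra_simps)
      qed
      also have "(\<lambda>p. \<xi> i p * ((\<phi> p)\<^sup>2 * flux_divergence p) + g i p) =
          (\<lambda>p. (\<phi> p)\<^sup>2 * (\<xi> i p * flux_divergence p + mgrad (\<xi> i) p \<bullet> flux p))"
        by (simp add: g_def fun_eq_iff algebra_simps)
      also have "?W i \<dots> \<le> ?W i ?Z"
        by (rule chart_flux_inequality[OF c[OF i] R0 \<phi>(3,1,2) \<xi>(1)[OF i] \<xi>(2)[OF i] S(1)[OF i] S(2)[OF i] S(3)[OF i]])
      finally show ?thesis by simp
    qed
    have "(\<Sum>i\<in>I. ?W i (\<lambda>p. \<xi> i p * ((\<phi> p)\<^sup>2 * (u p)\<^sup>2))) / 4 =
        (\<Sum>i\<in>I. ?W i (\<lambda>p. \<xi> i p * ((\<phi> p)\<^sup>2 * (u p)\<^sup>2)) / 4 + ?W i (g i))"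
      by (simp add: sum.distrib cancel sum_divide_distrib)
    also have "\<dots> \<le> (\<Sum>i\<in>I. 20 / R\<^sup>2 * ?W i (\<lambda>p. \<xi> i p * (u p)\<^sup>2))" by (intro sum_mono main)
    also have "\<dots> = 20 / R\<^sup>2 * (\<Sum>i\<in>I. ?W i (\<lambda>p. \<xi> i p * (u p)\<^sup>2))" by (simp only: sum_distrib_left)
    finally have A1: "(\<Sum>i\<in>I. ?W i (\<lambda>p. \<xi> i p * ((\<phi> p)\<^sup>2 * (u p)\<^sup>2))) / 4 \<le> 20 / R\<^sup>2 * (\<Sum>i\<in>I. ?W i (\<lambda>p. \<xi> i p * (u p)\<^sup>2))" .
    have A2: "(\<Sum>i\<in>I. ?W i (\<lambda>p. \<xi> i p * (u p)\<^sup>2)) \<le> E"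
    proof -
      let ?n = "\<lambda>i. \<integral>\<^sup>+p. ennreal (\<xi> i p * (u p)\<^sup>2 * exp (- (F p \<bullet> T))) \<partial>volume_measure A F"
      have sY: "supported_in (c i) (\<lambda>p. \<xi> i p * (u p)\<^sup>2)" if "i \<in> I" for i
        by (intro supported_in_mult[OF s\<xi>[OF that]] continuous_intros cu)
      have W0: "0 \<le> ?W i (\<lambda>p. \<xi> i p * (u p)\<^sup>2)" if "i \<in> I" for i
        using weighted_integral_mono[OF c[OF that] supported_in_zero sY[OF that]] \<xi>(2)[OF that]
        by (simp add: weighted_integral_zero)
      have "ennreal (\<Sum>i\<in>I. ?W i (\<lambda>p. \<xi> i p * (u p)\<^sup>2)) = (\<Sum>i\<in>I. ennreal (?W i (\<lambda>p. \<xi> i p * (u p)\<^sup>2)))"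
        using W0 by (simp add: sum_ennreal)
      also have "\<dots> \<le> (\<Sum>i\<in>I. ?n i)"
        by (intro sum_mono weighted_integral_le_nn_integral c sY) (auto simp: \<xi>(2))
      also have "\<dots> = (\<integral>\<^sup>+p. (\<Sum>i\<in>I. ennreal (\<xi> i p * (u p)\<^sup>2 * exp (- (F p \<bullet> T)))) \<partial>volume_measure A F)"
      proof (rule nn_integral_sum[symmetric])
        fix i assume i: "i \<in> I"
        have "continuous_on UNIV (\<lambda>p. \<xi> i p * (u p)\<^sup>2 * exp (- (F p \<bullet> T)))"
          by (intro continuous_intros c\<xi>[OF i] cu continuous_F)
        then have "(\<lambda>p. ennreal (\<xi> i p * (u p)\<^sup>2 * exp (- (F p \<bullet> T)))) \<in> borel_measurable borel"
          by (intro measurable_compose[OF borel_measurable_continuous_onI measurable_ennreal])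
        then show "(\<lambda>p. ennreal (\<xi> i p * (u p)\<^sup>2 * exp (- (F p \<bullet> T)))) \<in> borel_measurable (volume_measure A F)"
          by (simp only: measurable_cong_sets[OF sets_volume_measure refl])
      qed
      also have "\<dots> \<le> (\<integral>\<^sup>+p. ennreal ((u p)\<^sup>2 * exp (- (F p \<bullet> T))) \<partial>volume_measure A F)"
      proof (rule nn_integral_mono)
        fix p
        have "(\<Sum>i\<in>I. ennreal (\<xi> i p * (u p)\<^sup>2 * exp (- (F p \<bullet> T)))) = ennreal (\<Sum>i\<in>I. \<xi> i p * (u p)\<^sup>2 * exp (- (F p \<bullet> T)))"
          by (intro sum_ennreal) (simp add: \<xi>(2))
        also have "(\<Sum>i\<in>I. \<xi> i p * (u p)\<^sup>2 * exp (- (F p \<bullet> T))) = (\<Sum>i\<in>I. \<xi> i p) * ((u p)\<^sup>2 * exp (- (F p \<bullet> T)))"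
          by (simp only: sum_distrib_right mult.assoc)
        also have "ennreal \<dots> \<le> ennreal (1 * ((u p)\<^sup>2 * exp (- (F p \<bullet> T))))"
          by (intro ennreal_leI mult_right_mono le1) simp
        finally show "(\<Sum>i\<in>I. ennreal (\<xi> i p * (u p)\<^sup>2 * exp (- (F p \<bullet> T)))) \<le> ennreal ((u p)\<^sup>2 * exp (- (F p \<bullet> T)))" by simp
      qed
      finally show ?thesis using E by (metis ennreal_le_iff)
    qed
    have A3: "J / 4 \<le> (\<Sum>i\<in>I. ?W i (\<lambda>p. \<xi> i p * ((\<phi> p)\<^sup>2 * (u p)\<^sup>2)))"
    proof -
      let ?b = "\<lambda>p. \<theta> p * ((\<phi> p)\<^sup>2 * (u p)\<^sup>2)"
      have sb: "supported_in c0 ?b" by (intro supported_in_mult[OF s\<theta>] continuous_intros c\<phi> cu)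
      have "J / 4 = weighted_integral T c0 (\<lambda>p. 1 / 4 * (\<theta> p * (u p)\<^sup>2))"
        by (simp only: weighted_integral_cmult J_def)
      also have "\<dots> \<le> weighted_integral T c0 ?b"
      proof (rule weighted_integral_mono[OF c0 _ sb])
        have "supported_in c0 (\<lambda>p. \<theta> p * (1 / 4 * (u p)\<^sup>2))"
          by (intro supported_in_mult[OF s\<theta>] continuous_intros cu)
        then show "supported_in c0 (\<lambda>p. 1 / 4 * (\<theta> p * (u p)\<^sup>2))" by (simp add: mult_ac)
        fix p
        show "1 / 4 * (\<theta> p * (u p)\<^sup>2) \<le> ?b p"
        proof (cases "p \<in> K\<^sub>\<theta>")
          case True
          then have "joined p0 p 1" using U(3) \<theta>(6) by blast
          then have "1 - 1 / R \<le> \<phi> p" by (rule \<phi>(6))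
          moreover have "1 / R \<le> 1 / 2" using R by (simp add: field_simps)
          ultimately have "1 / 2 \<le> \<phi> p" by linarith
          then have "(1 / 2)\<^sup>2 \<le> (\<phi> p)\<^sup>2" by (intro power_mono) auto
          then have "1 / 4 * (\<theta> p * (u p)\<^sup>2) \<le> (\<phi> p)\<^sup>2 * (\<theta> p * (u p)\<^sup>2)"
            using \<theta>(2)[of p] by (intro mult_right_mono) (auto simp: power2_eq_square)
          then show ?thesis by (simp add: mult_ac)
        qed (simp add: \<theta>(7))
      qed
      also have "\<dots> = (\<Sum>i\<in>I. ?W i (\<lambda>p. \<xi> i p * ?b p))"
        by (rule split[OF c0 _ \<theta>(5)]) (use \<theta>(6,7) in \<open>auto intro!: continuous_intros c\<theta> c\<phi> cu\<close>)
      also have "\<dots> \<le> (\<Sum>i\<in>I. ?W i (\<lambda>p. \<xi> i p * ((\<phi> p)\<^sup>2 * (u p)\<^sup>2)))"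
      proof (rule sum_mono)
        fix i assume i: "i \<in> I"
        show "?W i (\<lambda>p. \<xi> i p * ?b p) \<le> ?W i (\<lambda>p. \<xi> i p * ((\<phi> p)\<^sup>2 * (u p)\<^sup>2))"
        proof (rule weighted_integral_mono[OF c[OF i]])
          show "supported_in (c i) (\<lambda>p. \<xi> i p * ?b p)"
            by (intro supported_in_mult[OF s\<xi>[OF i]] continuous_intros c\<theta> c\<phi> cu)
          show "supported_in (c i) (\<lambda>p. \<xi> i p * ((\<phi> p)\<^sup>2 * (u p)\<^sup>2))"
            by (intro supported_in_mult[OF s\<xi>[OF i]] continuous_intros c\<phi> cu)
          fix p
          have "?b p \<le> 1 * ((\<phi> p)\<^sup>2 * (u p)\<^sup>2)" by (intro mult_right_mono \<theta>(3)) simp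
          then show "\<xi> i p * ?b p \<le> \<xi> i p * ((\<phi> p)\<^sup>2 * (u p)\<^sup>2)" using \<xi>(2)[OF i, of p] by (intro mult_left_mono) auto
        qed
      qed
      finally show ?thesis .
    qed
    have "20 / R\<^sup>2 * (\<Sum>i\<in>I. ?W i (\<lambda>p. \<xi> i p * (u p)\<^sup>2)) \<le> 20 / R\<^sup>2 * E" by (intro mult_left_mono A2) simp
    then show ?thesis using A1 A3 by linarith
  qed
  have "J \<le> 0"
  proof (rule field_le_epsilon)
    fix e :: real assume e: "0 < e"
    \<comment> \<open>chosen so that \<open>16 * 20 E / R\<^sup>2 \<le> e\<close>\<close>
    define R where "R = max 2 (320 * E / e + 1)"
    have R: "2 \<le> R" "320 * E / e \<le> R" by (auto simp: R_def)
    have "320 * E \<le> e * R" using R(2) e by (simp add: field_simps)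
    also have "\<dots> \<le> e * R\<^sup>2" using R(1) e by (simp add: power2_eq_square)
    finally have "320 * E / R\<^sup>2 \<le> e" using R(1) by (simp add: field_simps)
    then show "J \<le> 0 + e" using bound[OF R(1)] by simp
  qed
  moreover have "0 < J"
  proof -
    let ?\<Omega> = "chart_image c0" and ?b = "\<lambda>p. \<theta> p * (u p)\<^sup>2"
    let ?h = "\<lambda>x. chart_weight T c0 x * ?b (chart_inv c0 x)"
    have K: "K\<^sub>\<theta> \<subseteq> fst c0" using \<theta>(6) by blast
    note ic = image_in_chart[OF c0 K]
    have cb: "continuous_on UNIV ?b" by (intro continuous_intros c\<theta> cu)
    have p0: "p0 \<in> K\<^sub>\<theta>" using \<theta>(4,7) by force
    have x0: "snd c0 p0 \<in> ?\<Omega>" "chart_inv c0 (snd c0 p0) = p0" using chart_facts(5,6)[OF c0, of p0] K p0 by auto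
    have w: "0 < chart_weight T c0 x" if "x \<in> ?\<Omega>" for x by (rule immersed_patch.weight_pos[OF patch[OF c0] that])
    have h0: "0 \<le> ?h x" if "x \<in> ?\<Omega>" for x using w[OF that] \<theta>(2) by (simp add: less_imp_le)
    define k where "k = ?h (snd c0 p0) / 2"
    have "0 < ?h (snd c0 p0)" using w[OF x0(1)] \<theta>(4) u0 x0(2) by simp
    then have k: "0 < k" "k < ?h (snd c0 p0)" unfolding k_def by linarith+
    have ch: "continuous_on ?\<Omega> ?h" by (rule continuous_weighted_integrand[OF c0 cb order_refl])
    then have "open (?h -` {k<..} \<inter> ?\<Omega>)"
      using continuous_on_open_vimage[OF chart_facts(2)[OF c0], of ?h] open_greaterThan by blast
    moreover have "snd c0 p0 \<in> ?h -` {k<..} \<inter> ?\<Omega>" using x0(1) k(2) by simp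
    ultimately obtain r where r: "0 < r" "cball (snd c0 p0) r \<subseteq> ?h -` {k<..} \<inter> ?\<Omega>"
      using open_contains_cball by blast
    let ?B = "cball (snd c0 p0) r"
    have rB: "x \<in> ?\<Omega>" "k < ?h x" if "x \<in> ?B" for x using subsetD[OF r(2) that] by auto
    have B\<Omega>: "?B \<subseteq> ?\<Omega>" using rB(1) by blast
    have BK: "?B \<subseteq> snd c0 ` K\<^sub>\<theta>"
    proof
      fix x assume "x \<in> ?B"
      then have x: "x \<in> ?\<Omega>" "k < ?h x" by (rule rB)+
      then have "\<theta> (chart_inv c0 x) \<noteq> 0" using k by auto
      then show "x \<in> snd c0 ` K\<^sub>\<theta>" using ic(2)[OF x(1)] \<theta>(7) by blast
    qed
    have Bi: "?h integrable_on ?B"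
      by (intro integrable_continuous_compact continuous_on_subset[OF ch B\<Omega>]) auto
    have "0 < k * measure lebesgue ?B" using k content_cball_pos[OF r(1), of "snd c0 p0"] by simp
    also have "\<dots> = k * integral ?B (\<lambda>x. 1)" by (simp only: lmeasure_integral[OF lmeasurable_cball])
    also have "\<dots> = integral ?B (\<lambda>x. k * 1)" by (rule integral_mult_right[symmetric])
    also have "\<dots> \<le> integral ?B ?h"
      by (rule integral_le[OF _ Bi]) (auto intro!: integrable_continuous_compact less_imp_le rB(2))
    also have "\<dots> \<le> integral (snd c0 ` K\<^sub>\<theta>) ?h"
    proof (rule integral_subset_le[OF BK Bi])
      show "?h integrable_on snd c0 ` K\<^sub>\<theta>"
        by (intro integrable_continuous_compact continuous_on_subset[OF ch] ic \<theta>(5))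
    qed (use h0 ic(1) in blast)
    also have "\<dots> = J"
      unfolding J_def by (rule weighted_integral_eq[symmetric, OF c0 K]) (simp add: \<theta>(7))
    finally show ?thesis .
  qed
  ultimately show False by simp
qed

end

theorem proposition1p4:
  fixes A :: "('a::{t2_space, second_countable_topology}, 'm::finite) chart set"
    and F :: "'a \<Rightarrow> complex ^ 'm"
    and T :: "complex ^ 'm"
    and f :: "complex ^ 'm \<Rightarrow> real"
    and u :: "'a \<Rightarrow> real"
  assumes "oriented_smooth_atlas A"
    and "connected (UNIV :: 'a set)"
    and "lagrangian_immersion A F"
    and "complete_immersion A F"
    and "norm T = 1"
    and "translating_soliton A F T"
    and "\<And>z. f z = 2 * (z \<bullet> T)"
    and "C_k_function 2 A u"
    and "(\<integral>\<^sup>+p. ennreal ((u p)\<^sup>2 * exp (- (1/2) * f (F p))) \<partial>volume_measure A F) < \<infinity>"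
    and "drift_harmonic A F f u"
  shows "\<forall>p. u p = 0"
proof -
  have "smooth_immersion A F" using assms(3) by (simp add: lagrangian_immersion_def)
  then interpret translator A F T f u
    using assms by unfold_locales auto
  have "(\<integral>\<^sup>+p. ennreal ((u p)\<^sup>2 * exp (- (F p \<bullet> T))) \<partial>volume_measure A F) < \<infinity>"
    using assms(9) by (simp add: assms(7))
  then show ?thesis using u_vanishes[OF assms(4)] by blast
qed

end
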